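(* Let $u_{h_n}\in V_{h_n}$ be the final approximation produced by the Full Multigrid Scheme described in the context, with $p$ correction steps per level, error reduction rate $\theta<1$ and refinement index $\beta>1$, and let $\bar u_{h_n}\in V_{h_n}$ be the exact finite element solution on $V_{h_n}$. There is a constant $C>0$, independent of the mesh sizes $H,h_1,\dots,h_n$, of the number of levels $n$ and of the iterates, such that, with $$\gamma:=\big(\theta+(1+\theta)C\eta_a(V_H)\big)\big(1+C\eta_a(V_H)\big),$$ under the condition that the coarsest mesh size $H$ is small enough such that $\gamma^p\beta<1$, the following error estimates hold: $$\|\bar u_{h_n}-u_{h_n}\|_a\le \frac{2\gamma^p\beta}{1-\gamma^p\beta}\,\delta_{h_n}(u),$$ $$\|\bar u_{h_n}-u_{h_n}\|_0\le C\,\eta_a(V_H)\,\|\bar u_{h_n}-u_{h_n}\|_a .$$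
   Context: **Problem.** $\Omega\subset\mathbb{R}^d$ ($d=2,3$) is a bounded convex domain with Lipschitz boundary, $V=H_0^1(\Omega)$, $(\cdot,\cdot)$ is the $L^2(\Omega)$ inner product (duality pairing), $\|\cdot\|_s$ is the norm of $H^s(\Omega)$. $\mathcal{A}=(a_{i,j})_{d\times d}$ is a symmetric positive definite matrix with $a_{i,j}\in W^{1,\infty}(\Omega)$, and $a(w,v)=(\mathcal{A}\nabla w,\nabla v)$ is bounded and coercive: $a(w,v)\le C_a\|w\|_1\|v\|_1$ and $c_a\|w\|_1^2\le a(w,w)$ for all $w,v\in V$; $\|w\|_a:=\sqrt{a(w,w)}$. The function $f(x,u)$ is nonlinear in its second variable and $g$ is a given right-hand side. The exact solution $u\in V$ satisfies $a(u,v)+(f(x,u),v)=(g,v)$ for all $v\in V$. **Assumption A.** For all $w,v,\phi\in V$: $(f(x,w)-f(x,v),w-v)\ge 0$ and $(f(x,w)-f(x,v),\phi)\le C_f\|w-v\|_0\|\phi\|_1$. **Finite element notation.** For a finite-dimensional subspace $W\subset V$, $\eta_a(W)=\sup_{\psi\in L^2(\Omega),\|\psi\|_0=1}\inf_{v\in W}\|L^{-1}\psi-v\|_a$, where $L:H_0^1(\Omega)\to H^{-1}(\Omega)$ is given by $(Lw,v)=a(w,v)$ for all $w,v\in V$. For a mesh $\mathcal{T}_h$, $V_h=\{v\in C(\Omega): v|_K\in\mathcal{P}_1\ \forall K\in\mathcal{T}_h\}\cap H_0^1(\Omega)$ is the linear finite element space ($\mathcal{P}_1$ being the linear functions), $\delta_h(u)=\inf_{v_h\in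 V_h}\|u-v_h\|_a$, and $\bar u_h\in V_h$ is the solution of $a(\bar u_h,v_h)+(f(x,\bar u_h),v_h)=(g,v_h)$ for all $v_h\in V_h$. **Meshes.** $\mathcal{T}_H$ is a shape-regular coarse mesh of $\Omega$ of size $H$; $\mathcal{T}_{h_1}$ is obtained from $\mathcal{T}_H$ by regular refinements and $\mathcal{T}_{h_k}$ from $\mathcal{T}_{h_{k-1}}$ by one regular refinement (each element giving $\beta^d$ subelements), so $h_k=h_{k-1}/\beta$, $k=2,\dots,n$, with $\beta>1$. The spaces are nested: $V_H\subseteq V_{h_1}\subset\cdots\subset V_{h_n}$. They satisfy the approximation relations $\eta_a(V_{h_k})\approx\frac1\beta\eta_a(V_{h_{k-1}})$ and $\delta_{h_k}(u)\approx\frac1\beta\delta_{h_{k-1}}(u)$ for $k=2,\dots,n$, where $x\approx y$ means $cx\le y\le C'x$ with constants $c,C'>0$. **One correction step.** Let $\theta<1$ be a fixed constant independent of the mesh sizes. Given $u_{h_k}^{(\ell)}\in V_{h_k}$, the new iterate $u_{h_k}^{(\ell+1)}=\mathrm{SemilinearMG}(V_H,u_{h_k}^{(\ell)},V_{h_k})$ is defined as follows. (1) Let $\widehat u_{h_k}^{(\ell+1)}\in V_{h_k}$ solve $a(\widehat u_{h_k}^{(\ell+1)},v)=-(f(x,u_{h_k}^{(\ell)}),v)+(g,v)$ for all $v\in V_{h_k}$. By $m$ multigrid iteration steps for this linear problem with initial value $u_{h_k}^{(\ell)}$ one obtains $\widetilde u_{h_k}^{(\ell+1)}\in V_{h_k}$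 with $\|\widetilde u_{h_k}^{(\ell+1)}-\widehat u_{h_k}^{(\ell+1)}\|_a\le\theta\|u_{h_k}^{(\ell)}-\widehat u_{h_k}^{(\ell+1)}\|_a$. (2) Let $V_{H,h_k}=V_H+\mathrm{span}\{\widetilde u_{h_k}^{(\ell+1)}\}$ and let $u_{h_k}^{(\ell+1)}\in V_{H,h_k}$ solve $a(u_{h_k}^{(\ell+1)},v)+(f(x,u_{h_k}^{(\ell+1)}),v)=(g,v)$ for all $v\in V_{H,h_k}$. **Full Multigrid Scheme.** (1) Let $u_{h_1}\in V_{h_1}$ solve $a(u_{h_1},v)+(f(x,u_{h_1}),v)=(g,v)$ for all $v\in V_{h_1}$. (2) For $k=2,\dots,n$: set $u_{h_k}^{(0)}=u_{h_{k-1}}$; for $\ell=0,\dots,p-1$ set $u_{h_k}^{(\ell+1)}=\mathrm{SemilinearMG}(V_H,u_{h_k}^{(\ell)},V_{h_k})$; define $u_{h_k}=u_{h_k}^{(p)}$. The output is $u_{h_n}$.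
   Formalization: In the energy estimate and its smallness condition, β is replaced by κβ with κ = max(1,C′), C′ the upper constant in δ_{h_k}(u) ≈ (1/β)δ_{h_{k-1}}(u); for C′ ≤ 1 this is the stated estimate, while for large C′ the stated one can fail. The L² estimate is unchanged. *)

theory Defs
  imports "HOL-Analysis.Analysis"
begin

text \<open>
  Functions on \<open>\<Omega>\<close> are total functions on \<open>real ^ 'd\<close>; their values outside \<open>\<Omega>\<close> and on null sets
  never matter, so no quotient by almost-everywhere equality is taken. All integrals are Lebesgue
  integrals over \<open>lebesgue_on \<Omega>\<close>.
\<close>

type_synonym 'd rfun = "real ^ 'd \<Rightarrow> real"

section \<open>Domains\<close>

text \<open>Locally, after a rotation, \<open>\<Omega>\<close> is the set below the graph of a Lipschitz function \<open>g\<close> of the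
  coordinates orthogonal to the direction \<open>\<nu>\<close>.\<close>

definition lipschitz_boundary :: "(real ^ 'd) set \<Rightarrow> bool" where
  "lipschitz_boundary \<Omega> \<longleftrightarrow>
     (\<forall>x\<in>frontier \<Omega>. \<exists>r>0. \<exists>\<nu> g l. norm \<nu> = 1 \<and> l-lipschitz_on UNIV g \<and>
        (\<forall>y\<in>ball x r. y \<in> \<Omega> \<longleftrightarrow> y \<bullet> \<nu> < (g (y - (y \<bullet> \<nu>) *\<^sub>R \<nu>) :: real)))"

section \<open>Sobolev spaces\<close>

definition L2 :: "(real ^ 'd) set \<Rightarrow> 'd rfun set" where
  "L2 \<Omega> = {w. w \<in> borel_measurable (lebesgue_on \<Omega>) \<and> integrable (lebesgue_on \<Omega>) (\<lambda>x. (w x)\<^sup>2)}"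

definition ip0 :: "(real ^ 'd) set \<Rightarrow> 'd rfun \<Rightarrow> 'd rfun \<Rightarrow> real" where
  "ip0 \<Omega> w v = (LINT x|lebesgue_on \<Omega>. w x * v x)"

definition norm0 :: "(real ^ 'd) set \<Rightarrow> 'd rfun \<Rightarrow> real" where
  "norm0 \<Omega> w = sqrt (ip0 \<Omega> w w)"

definition partial :: "'d::finite \<Rightarrow> 'd rfun \<Rightarrow> 'd rfun" where
  "partial i \<phi> x = frechet_derivative \<phi> (at x) (axis i 1)"

primrec Ck :: "nat \<Rightarrow> 'd::finite rfun \<Rightarrow> bool" where
  "Ck 0 \<phi> \<longleftrightarrow> continuous_on UNIV \<phi>"
| "Ck (Suc k) \<phi> \<longleftrightarrow> (\<forall>x. \<phi> differentiable (at x)) \<and> (\<forall>i. Ck k (partial i \<phi>))"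

definition test_functions :: "(real ^ 'd) set \<Rightarrow> 'd rfun set" where
  "test_functions \<Omega> =
     {\<phi>. (\<forall>k. Ck k \<phi>) \<and> (\<exists>K. compact K \<and> K \<subseteq> \<Omega> \<and> (\<forall>x. x \<notin> K \<longrightarrow> \<phi> x = 0))}"

definition is_weak_gradient ::
    "(real ^ 'd) set \<Rightarrow> 'd rfun \<Rightarrow> (real ^ 'd \<Rightarrow> real ^ 'd) \<Rightarrow> bool" where
  "is_weak_gradient \<Omega> w G \<longleftrightarrow>
     (\<forall>\<phi>\<in>test_functions \<Omega>. \<forall>i. ip0 \<Omega> w (partial i \<phi>) = - ip0 \<Omega> (\<lambda>x. G x $ i) \<phi>)"

definition is_L2_gradient ::
    "(real ^ 'd) set \<Rightarrow> 'd rfun \<Rightarrow> (real ^ 'd \<Rightarrow> real ^ 'd) \<Rightarrow> bool" where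
  "is_L2_gradient \<Omega> w G \<longleftrightarrow> (\<forall>i. (\<lambda>x. G x $ i) \<in> L2 \<Omega>) \<and> is_weak_gradient \<Omega> w G"

definition H1 :: "(real ^ 'd) set \<Rightarrow> 'd rfun set" where
  "H1 \<Omega> = {w \<in> L2 \<Omega>. \<exists>G. is_L2_gradient \<Omega> w G}"

text \<open>The weak gradient is unique up to null sets, so the choice below is immaterial.\<close>

definition wgrad :: "(real ^ 'd) set \<Rightarrow> 'd rfun \<Rightarrow> real ^ 'd \<Rightarrow> real ^ 'd" where
  "wgrad \<Omega> w = (SOME G. is_L2_gradient \<Omega> w G)"

definition norm1 :: "(real ^ 'd) set \<Rightarrow> 'd rfun \<Rightarrow> real" where
  "norm1 \<Omega> w = sqrt ((norm0 \<Omega> w)\<^sup>2 + (\<Sum>i\<in>UNIV. (norm0 \<Omega> (\<lambda>x. wgrad \<Omega> w x $ i))\<^sup>2))"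

definition H10 :: "(real ^ 'd) set \<Rightarrow> 'd rfun set" where
  "H10 \<Omega> = {w \<in> H1 \<Omega>. \<exists>\<phi> :: nat \<Rightarrow> 'd rfun. (\<forall>m. \<phi> m \<in> test_functions \<Omega>) \<and>
              (\<lambda>m. norm1 \<Omega> (\<lambda>x. w x - \<phi> m x)) \<longlonglongrightarrow> 0}"

text \<open>Elements of the dual space are functionals that are only constrained on \<open>H10 \<Omega>\<close>; the pairing of
  \<open>g\<close> with \<open>v\<close> is the application \<open>g v\<close>, and \<open>g \<in> L2 \<Omega>\<close> corresponds to the functional \<open>ip0 \<Omega> g\<close>.\<close>

definition Hminus1 :: "(real ^ 'd) set \<Rightarrow> ('d rfun \<Rightarrow> real) set" where
  "Hminus1 \<Omega> =
     {g. (\<forall>v\<in>H10 \<Omega>. \<forall>w\<in>H10 \<Omega>. \<forall>b c. g (\<lambda>x. b * v x + c * w x) = b * g v + c * g w) \<and>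
         (\<exists>M. \<forall>v\<in>H10 \<Omega>. \<bar>g v\<bar> \<le> M * norm1 \<Omega> v)}"

definition W1inf :: "(real ^ 'd) set \<Rightarrow> 'd rfun set" where
  "W1inf \<Omega> =
     {w. w \<in> borel_measurable (lebesgue_on \<Omega>) \<and>
         (\<exists>G M. (\<forall>i. (\<lambda>x. G x $ i) \<in> borel_measurable (lebesgue_on \<Omega>)) \<and>
                is_weak_gradient \<Omega> w G \<and>
                (AE x in lebesgue_on \<Omega>. \<bar>w x\<bar> \<le> M \<and> (\<forall>i. \<bar>G x $ i\<bar> \<le> M)))}"

section \<open>The semilinear problem\<close>

definition coefficient_matrix :: "(real ^ 'd) set \<Rightarrow> (real ^ 'd \<Rightarrow> real ^ 'd ^ 'd) \<Rightarrow> bool" where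
  "coefficient_matrix \<Omega> A \<longleftrightarrow>
     (\<forall>i j. (\<lambda>x. A x $ i $ j) \<in> W1inf \<Omega>) \<and>
     (AE x in lebesgue_on \<Omega>. transpose (A x) = A x \<and> (\<forall>\<xi>. \<xi> \<noteq> 0 \<longrightarrow> \<xi> \<bullet> (A x *v \<xi>) > 0))"

definition aform ::
    "(real ^ 'd) set \<Rightarrow> (real ^ 'd \<Rightarrow> real ^ 'd ^ 'd) \<Rightarrow> 'd rfun \<Rightarrow> 'd rfun \<Rightarrow> real" where
  "aform \<Omega> A w v = (LINT x|lebesgue_on \<Omega>. (A x *v wgrad \<Omega> w x) \<bullet> wgrad \<Omega> v x)"

definition norm_a :: "(real ^ 'd) set \<Rightarrow> (real ^ 'd \<Rightarrow> real ^ 'd ^ 'd) \<Rightarrow> 'd rfun \<Rightarrow> real" where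
  "norm_a \<Omega> A w = sqrt (aform \<Omega> A w w)"

text \<open>The superposition operator \<open>w \<mapsto> f(x, w(x))\<close> and the conditions making \<open>f(x, w)\<close>
  measurable (Caratheodory) and its pairing with \<open>H10 \<Omega>\<close> a convergent integral.\<close>

definition nemytskii :: "(real ^ 'd \<Rightarrow> real \<Rightarrow> real) \<Rightarrow> 'd rfun \<Rightarrow> 'd rfun" where
  "nemytskii f w = (\<lambda>x. f x (w x))"

definition admissible_nonlinearity ::
    "(real ^ 'd) set \<Rightarrow> (real ^ 'd \<Rightarrow> real \<Rightarrow> real) \<Rightarrow> bool" where
  "admissible_nonlinearity \<Omega> f \<longleftrightarrow>
     (\<forall>s. (\<lambda>x. f x s) \<in> borel_measurable (lebesgue_on \<Omega>)) \<and>
     (AE x in lebesgue_on \<Omega>. continuous_on UNIV (f x)) \<and>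
     (\<forall>w\<in>H10 \<Omega>. \<forall>\<phi>\<in>H10 \<Omega>. integrable (lebesgue_on \<Omega>) (\<lambda>x. nemytskii f w x * \<phi> x))"

definition assumption_A ::
    "(real ^ 'd) set \<Rightarrow> (real ^ 'd \<Rightarrow> real \<Rightarrow> real) \<Rightarrow> real \<Rightarrow> bool" where
  "assumption_A \<Omega> f Cf \<longleftrightarrow>
     (\<forall>w\<in>H10 \<Omega>. \<forall>v\<in>H10 \<Omega>. \<forall>\<phi>\<in>H10 \<Omega>.
        ip0 \<Omega> (\<lambda>x. nemytskii f w x - nemytskii f v x) (\<lambda>x. w x - v x) \<ge> 0 \<and>
        ip0 \<Omega> (\<lambda>x. nemytskii f w x - nemytskii f v x) \<phi>
          \<le> Cf * norm0 \<Omega> (\<lambda>x. w x - v x) * norm1 \<Omega> \<phi>)"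

text \<open>For \<open>W = H10 \<Omega>\<close> this is the weak formulation, for \<open>W\<close> a subspace its Galerkin
  discretization.\<close>

definition solves_on ::
    "(real ^ 'd) set \<Rightarrow> (real ^ 'd \<Rightarrow> real ^ 'd ^ 'd) \<Rightarrow> (real ^ 'd \<Rightarrow> real \<Rightarrow> real) \<Rightarrow>
     ('d rfun \<Rightarrow> real) \<Rightarrow> 'd rfun set \<Rightarrow> 'd rfun \<Rightarrow> bool" where
  "solves_on \<Omega> A f g W w \<longleftrightarrow>
     w \<in> W \<and> (\<forall>v\<in>W. aform \<Omega> A w v + ip0 \<Omega> (nemytskii f w) v = g v)"

definition Lop ::
    "(real ^ 'd) set \<Rightarrow> (real ^ 'd \<Rightarrow> real ^ 'd ^ 'd) \<Rightarrow> 'd rfun \<Rightarrow> ('d rfun \<Rightarrow> real)" where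
  "Lop \<Omega> A w = (\<lambda>v. aform \<Omega> A w v)"

text \<open>\<open>L\<^sup>-\<^sup>1 \<psi>\<close> for \<open>\<psi> \<in> L2 \<Omega>\<close>; by Lax-Milgram it exists and is unique up to null sets.\<close>

definition Linv ::
    "(real ^ 'd) set \<Rightarrow> (real ^ 'd \<Rightarrow> real ^ 'd ^ 'd) \<Rightarrow> 'd rfun \<Rightarrow> 'd rfun" where
  "Linv \<Omega> A \<psi> = (SOME w. w \<in> H10 \<Omega> \<and> (\<forall>v\<in>H10 \<Omega>. Lop \<Omega> A w v = ip0 \<Omega> \<psi> v))"

definition best_error_a ::
    "(real ^ 'd) set \<Rightarrow> (real ^ 'd \<Rightarrow> real ^ 'd ^ 'd) \<Rightarrow> 'd rfun set \<Rightarrow> 'd rfun \<Rightarrow> real" where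
  "best_error_a \<Omega> A W w = (INF v\<in>W. norm_a \<Omega> A (\<lambda>x. w x - v x))"

definition eta_a ::
    "(real ^ 'd) set \<Rightarrow> (real ^ 'd \<Rightarrow> real ^ 'd ^ 'd) \<Rightarrow> 'd rfun set \<Rightarrow> real" where
  "eta_a \<Omega> A W = (SUP \<psi>\<in>{\<psi> \<in> L2 \<Omega>. norm0 \<Omega> \<psi> = 1}. best_error_a \<Omega> A W (Linv \<Omega> A \<psi>))"

section \<open>Meshes and finite element spaces\<close>

definition mesh :: "(real ^ 'd) set \<Rightarrow> (real ^ 'd) set set \<Rightarrow> bool" where
  "mesh \<Omega> \<T> \<longleftrightarrow>
     triangulation \<T> \<and> (\<forall>K\<in>\<T>. int CARD('d) simplex K) \<and> \<Union>\<T> = closure \<Omega>"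

definition shape_regular :: "real \<Rightarrow> (real ^ 'd) set set \<Rightarrow> bool" where
  "shape_regular \<sigma> \<T> \<longleftrightarrow> (\<forall>K\<in>\<T>. \<exists>z. \<exists>\<rho>>0. cball z \<rho> \<subseteq> K \<and> diameter K \<le> \<sigma> * \<rho>)"

text \<open>The size of an element is measured by \<open>|K|\<^bsup>1/d\<^esup>\<close>, which on shape-regular meshes is equivalent to
  its diameter. Diameters themselves need not scale exactly by \<open>1/\<beta>\<close> under regular refinement: the
  inner subtetrahedra of a halved regular tetrahedron are longer than half of it.\<close>

definition mesh_size :: "(real ^ 'd) set set \<Rightarrow> real" where
  "mesh_size \<T> = Max ((\<lambda>K. root CARD('d) (measure lebesgue K)) ` \<T>)"

definition regular_refinement ::
    "(real ^ 'd) set \<Rightarrow> real \<Rightarrow> (real ^ 'd) set set \<Rightarrow> (real ^ 'd) set set \<Rightarrow> bool" where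
  "regular_refinement \<Omega> b \<T> \<T>' \<longleftrightarrow>
     mesh \<Omega> \<T> \<and> mesh \<Omega> \<T>' \<and>
     (\<forall>K'\<in>\<T>'. \<exists>K\<in>\<T>. K' \<subseteq> K) \<and>
     (\<forall>K\<in>\<T>. real (card {K'\<in>\<T>'. K' \<subseteq> K}) = b ^ CARD('d) \<and>
            (\<forall>K'\<in>\<T>'. K' \<subseteq> K \<longrightarrow> measure lebesgue K' = measure lebesgue K / b ^ CARD('d)))"

definition mesh_hierarchy ::
    "(real ^ 'd) set \<Rightarrow> real \<Rightarrow> real \<Rightarrow> nat \<Rightarrow> (real ^ 'd) set set \<Rightarrow> (nat \<Rightarrow> (real ^ 'd) set set) \<Rightarrow> bool"
  where
  "mesh_hierarchy \<Omega> \<sigma> \<beta> n \<T>H \<T> \<longleftrightarrow>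
     mesh \<Omega> \<T>H \<and> shape_regular \<sigma> \<T>H \<and>
     (\<lambda>\<S> \<S>'. \<exists>b>1. regular_refinement \<Omega> b \<S> \<S>')\<^sup>*\<^sup>* \<T>H (\<T> 1) \<and>
     (\<forall>k\<in>{2..n}. regular_refinement \<Omega> \<beta> (\<T> (k - 1)) (\<T> k) \<and>
                  mesh_size (\<T> k) = mesh_size (\<T> (k - 1)) / \<beta>)"

definition fe_space :: "(real ^ 'd) set \<Rightarrow> (real ^ 'd) set set \<Rightarrow> 'd rfun set" where
  "fe_space \<Omega> \<T> =
     {v \<in> H10 \<Omega>. continuous_on \<Omega> v \<and> (\<forall>K\<in>\<T>. \<exists>a b. \<forall>x\<in>K \<inter> \<Omega>. v x = a \<bullet> x + b)}"

text \<open>The relation \<open>x \<approx> y\<close> with its two constants made explicit.\<close>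

definition approx_rel :: "real \<Rightarrow> real \<Rightarrow> real \<Rightarrow> real \<Rightarrow> bool" where
  "approx_rel c C x y \<longleftrightarrow> c * x \<le> y \<and> y \<le> C * x"

section \<open>The full multigrid scheme\<close>

text \<open>One correction step. The result of the inner multigrid iteration is an arbitrary element of the
  fine space satisfying the contraction estimate; hence the step is a relation.\<close>

definition semilinear_mg ::
    "(real ^ 'd) set \<Rightarrow> (real ^ 'd \<Rightarrow> real ^ 'd ^ 'd) \<Rightarrow> (real ^ 'd \<Rightarrow> real \<Rightarrow> real) \<Rightarrow>
     ('d rfun \<Rightarrow> real) \<Rightarrow> real \<Rightarrow> 'd rfun set \<Rightarrow> 'd rfun set \<Rightarrow> 'd rfun \<Rightarrow> 'd rfun \<Rightarrow> bool" where
  "semilinear_mg \<Omega> A f g \<theta> VH Vh w w' \<longleftrightarrow>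
     w \<in> Vh \<and>
     (\<exists>what\<in>Vh. \<exists>wtilde\<in>Vh.
        (\<forall>v\<in>Vh. aform \<Omega> A what v = - ip0 \<Omega> (nemytskii f w) v + g v) \<and>
        norm_a \<Omega> A (\<lambda>x. wtilde x - what x) \<le> \<theta> * norm_a \<Omega> A (\<lambda>x. w x - what x) \<and>
        solves_on \<Omega> A f g {\<lambda>x. v x + c * wtilde x |v c. v \<in> VH} w')"

definition full_multigrid ::
    "(real ^ 'd) set \<Rightarrow> (real ^ 'd \<Rightarrow> real ^ 'd ^ 'd) \<Rightarrow> (real ^ 'd \<Rightarrow> real \<Rightarrow> real) \<Rightarrow>
     ('d rfun \<Rightarrow> real) \<Rightarrow> real \<Rightarrow> 'd rfun set \<Rightarrow> (nat \<Rightarrow> 'd rfun set) \<Rightarrow> nat \<Rightarrow> nat \<Rightarrow>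
     (nat \<Rightarrow> 'd rfun) \<Rightarrow> bool" where
  "full_multigrid \<Omega> A f g \<theta> VH V p n uh \<longleftrightarrow>
     solves_on \<Omega> A f g (V 1) (uh 1) \<and>
     (\<forall>k\<in>{2..n}. \<exists>it :: nat \<Rightarrow> 'd rfun.
        it 0 = uh (k - 1) \<and>
        (\<forall>l<p. semilinear_mg \<Omega> A f g \<theta> VH (V k) (it l) (it (Suc l))) \<and>
        uh k = it p)"

end

theory Submission
  imports Defs
begin

text \<open>
  Every iterate \<open>w\<close> of the scheme is itself a Galerkin solution on some space between \<open>V\<^sub>H\<close> and
  \<open>V\<^sub>h\<close>, so its error satisfies \<open>\<parallel>e\<parallel>\<^sub>0 \<le> C \<eta> \<parallel>e\<parallel>\<^sub>a\<close> by a duality argument for the residual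
  functional. This makes the nonlinear terms in one correction step perturbations of relative size
  \<open>C \<eta>\<close> and gives a contraction with a factor slightly smaller than \<open>\<gamma>\<close>; the slack, obtained by
  enlarging \<open>C\<close> (\<open>\<eta>\<close> is bounded by coercivity), absorbs the quasi-optimality constant of the
  finite element solutions, and a geometric sum over the levels gives the constant \<open>2\<close>.

  The existence of \<open>L\<^sup>-\<^sup>1 \<psi>\<close> and of the residual representatives rests on the completeness of
  \<open>H10 \<Omega>\<close>, and the linearity of \<open>wgrad\<close> on the uniqueness of weak gradients.
\<close>

section \<open>Semi-inner product spaces of functions\<close>

text \<open>The nonlinearity is only monotone and Lipschitz from the \<open>L2\<close> norm into the
  dual of \<open>H10\<close>; it may fail to be differentiable, so there is no linearized adjoint
  problem. The dual problems involve the linear form \<open>aform\<close> alone, and every nonlinear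
  difference that monotonicity does not control is paid for by an \<open>L2\<close> error. Such an
  error is small relative to the energy error if the two functions satisfy the same equation tested
  against \<open>V\<^sub>H\<close>. This is why the correction spaces contain
  \<open>V\<^sub>H\<close>, and why one quantity, \<open>eta_a\<close> of the coarse space, governs
  all levels. The 2 in the final bound counts two discretization errors: on passing to the next
  level, the old and the new finite element solution are each compared with \<open>u\<close>. The
  constant \<open>C\<close> is fixed before \<theta>, \<beta>, \<open>p\<close>, \<open>n\<close>
  and the meshes, and is computed from \<open>ca\<close> and \<open>Cf\<close> alone.\<close>

lemma quadratic_nonneg_imp_zero:
  fixes s b :: real
  assumes quad: "\<And>t. 0 \<le> 2 * t * s + t\<^sup>2 * b" and b: "0 \<le> b"
  shows "s = 0"
proof (rule ccontr)
  assume s: "s \<noteq> 0"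
  \<comment> \<open>The vertex of the parabola is at \<open>- s / b\<close>; enlarging the
    denominator to \<open>b + 1\<close> covers \<open>b = 0\<close> and still gives a negative
    value.\<close>
  define t where "t = - s / (b + 1)"
  have t: "(b + 1) * t = - s" using b by (simp add: t_def)
  have "(b + 1)\<^sup>2 * (2 * t * s + t\<^sup>2 * b) = 2 * s * (b + 1) * ((b + 1) * t) + b * ((b + 1) * t)\<^sup>2"
    by (simp add: power2_eq_square algebra_simps)
  also have "\<dots> = - (s\<^sup>2 * (b + 2))"
    unfolding t by (simp add: power2_eq_square algebra_simps)
  also have "\<dots> < 0" using s b by simp
  finally have "2 * t * s + t\<^sup>2 * b < 0" using b by (simp add: mult_less_0_iff)
  then show False using quad[of t] by simp
qed

text \<open>Functions are not identified almost everywhere, so \<open>B w w = 0\<close> does not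
  force \<open>w\<close> to be zero and only semidefiniteness can be asked for. Restricting the laws
  to the carrier \<open>V\<close> lets the same form be used on \<open>L2\<close> and on
  \<open>H10\<close>.\<close>

locale semi_inner =
  fixes V :: "('x \<Rightarrow> real) set" and B :: "('x \<Rightarrow> real) \<Rightarrow> ('x \<Rightarrow> real) \<Rightarrow> real"
  assumes nonempty: "V \<noteq> {}"
    and comb: "\<And>w v b c. w \<in> V \<Longrightarrow> v \<in> V \<Longrightarrow> (\<lambda>x. b * w x + c * v x) \<in> V"
    and lin: "\<And>w v u b c. w \<in> V \<Longrightarrow> v \<in> V \<Longrightarrow> u \<in> V \<Longrightarrow>
      B (\<lambda>x. b * w x + c * v x) u = b * B w u + c * B v u"
    and sym: "\<And>w v. w \<in> V \<Longrightarrow> v \<in> V \<Longrightarrow> B w v = B v w"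
    and nonneg: "\<And>w. w \<in> V \<Longrightarrow> 0 \<le> B w w"
begin

definition nrm :: "('x \<Rightarrow> real) \<Rightarrow> real" where "nrm w = sqrt (B w w)"

lemma lin2:
  "w \<in> V \<Longrightarrow> v \<in> V \<Longrightarrow> u \<in> V \<Longrightarrow> B u (\<lambda>x. b * w x + c * v x) = b * B u w + c * B u v"
  using sym[of u "\<lambda>x. b * w x + c * v x"] comb[of w v b c] lin[of w v u b c] sym[of u w] sym[of u v]
  by simp

lemma zero_mem: "(\<lambda>x. 0) \<in> V"
  using nonempty comb[where b = 0 and c = 0] by fastforce

lemma diff_mem: "w \<in> V \<Longrightarrow> v \<in> V \<Longrightarrow> (\<lambda>x. w x - v x) \<in> V"
  using comb[of w v 1 "-1"] by simp

lemma add_mem: "w \<in> V \<Longrightarrow> v \<in> V \<Longrightarrow> (\<lambda>x. w x + v x) \<in> V"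
  using comb[of w v 1 1] by simp

lemma scale_mem: "w \<in> V \<Longrightarrow> (\<lambda>x. c * w x) \<in> V"
  using comb[of w w c 0] by simp

lemma diff_left: "w \<in> V \<Longrightarrow> v \<in> V \<Longrightarrow> u \<in> V \<Longrightarrow> B (\<lambda>x. w x - v x) u = B w u - B v u"
  using lin[of w v u 1 "-1"] by simp

lemma diff_right: "w \<in> V \<Longrightarrow> v \<in> V \<Longrightarrow> u \<in> V \<Longrightarrow> B u (\<lambda>x. w x - v x) = B u w - B u v"
  using lin2[of w v u 1 "-1"] by simp

lemma scale_left: "w \<in> V \<Longrightarrow> u \<in> V \<Longrightarrow> B (\<lambda>x. c * w x) u = c * B w u"
  using lin[of w w u c 0] by simp

lemma comb_square:
  assumes "w \<in> V" "v \<in> V"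
  shows "B (\<lambda>x. b * w x + c * v x) (\<lambda>x. b * w x + c * v x)
    = b\<^sup>2 * B w w + 2 * b * c * B w v + c\<^sup>2 * B v v"
  using assms comb[OF assms, of b c] sym[OF assms]
  by (simp add: lin lin2 power2_eq_square algebra_simps)

lemma nrm_nonneg: "w \<in> V \<Longrightarrow> 0 \<le> nrm w"
  by (simp add: nrm_def nonneg)

lemma nrm_square: "w \<in> V \<Longrightarrow> (nrm w)\<^sup>2 = B w w"
  by (simp add: nrm_def nonneg)

lemma Cauchy_Schwarz_square:
  assumes "w \<in> V" "v \<in> V"
  shows "(B w v)\<^sup>2 \<le> B w w * B v v"
proof (cases "B v v = 0")
  case True
  have "B w v = 0"
  proof (rule ccontr)
    assume ne: "B w v \<noteq> 0"
    \<comment> \<open>With \<open>B v v = 0\<close> the square of \<open>w + t v\<close> is affine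
      in \<open>t\<close>; this \<open>t\<close> would bring it down to -1.\<close>
    define t where "t = - (B w w + 1) / (2 * B w v)"
    have "0 \<le> B w w + 2 * t * B w v"
      using comb_square[OF assms, of 1 t] nonneg[OF comb[OF assms, of 1 t]] True by simp
    also have "\<dots> = -1" using ne by (simp add: t_def field_simps)
    finally show False by simp
  qed
  then show ?thesis using True by simp
next
  case False
  then have pos: "0 < B v v" using nonneg[OF assms(2)] by simp
  \<comment> \<open>This is the square of \<open>B v v * w - B w v * v\<close>, the part of
    \<open>w\<close> orthogonal to \<open>v\<close>, scaled so that no division occurs.\<close>
  have "0 \<le> (B v v)\<^sup>2 * B w w + 2 * B v v * (- B w v) * B w v + (- B w v)\<^sup>2 * B v v"
    using nonneg[OF comb[OF assms, of "B v v" "- B w v"]] unfolding comb_square[OF assms] .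
  also have "\<dots> = B v v * (B w w * B v v - (B w v)\<^sup>2)"
    by (simp add: power2_eq_square algebra_simps)
  finally show ?thesis using pos by (simp add: zero_le_mult_iff)
qed

lemma Cauchy_Schwarz:
  assumes "w \<in> V" "v \<in> V"
  shows "\<bar>B w v\<bar> \<le> nrm w * nrm v"
  using real_sqrt_le_mono[OF Cauchy_Schwarz_square[OF assms]]
  by (simp add: nrm_def real_sqrt_mult)

lemma nrm_comb_le:
  assumes "w \<in> V" "v \<in> V"
  shows "nrm (\<lambda>x. b * w x + c * v x) \<le> \<bar>b\<bar> * nrm w + \<bar>c\<bar> * nrm v"
proof (rule power2_le_imp_le)
  have "2 * b * c * B w v \<le> \<bar>2 * b * c\<bar> * \<bar>B w v\<bar>"
    using abs_ge_self[of "2 * b * c * B w v"] by (simp only: abs_mult)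
  also have "\<dots> \<le> \<bar>2 * b * c\<bar> * (nrm w * nrm v)"
    by (rule mult_left_mono[OF Cauchy_Schwarz[OF assms]]) simp
  finally have mixed: "2 * b * c * B w v \<le> \<bar>2 * b * c\<bar> * (nrm w * nrm v)" .
  have "(nrm (\<lambda>x. b * w x + c * v x))\<^sup>2 = b\<^sup>2 * (nrm w)\<^sup>2 + 2 * b * c * B w v + c\<^sup>2 * (nrm v)\<^sup>2"
    using assms by (simp only: nrm_square comb comb_square)
  also have "\<dots> \<le> b\<^sup>2 * (nrm w)\<^sup>2 + \<bar>2 * b * c\<bar> * (nrm w * nrm v) + c\<^sup>2 * (nrm v)\<^sup>2"
    using mixed by (simp only: add_le_cancel_left add_le_cancel_right)
  also have "\<dots> = (\<bar>b\<bar> * nrm w + \<bar>c\<bar> * nrm v)\<^sup>2"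
    by (simp add: power2_sum power_mult_distrib abs_mult)
  finally show "(nrm (\<lambda>x. b * w x + c * v x))\<^sup>2 \<le> (\<bar>b\<bar> * nrm w + \<bar>c\<bar> * nrm v)\<^sup>2" .
qed (use assms nrm_nonneg in simp)

lemma nrm_add_le: "w \<in> V \<Longrightarrow> v \<in> V \<Longrightarrow> nrm (\<lambda>x. w x + v x) \<le> nrm w + nrm v"
  using nrm_comb_le[of w v 1 1] by simp

lemma nrm_scale: "w \<in> V \<Longrightarrow> nrm (\<lambda>x. c * w x) = \<bar>c\<bar> * nrm w"
  using comb_square[of w w c 0] by (simp add: nrm_def real_sqrt_mult)

lemma nrm_diff_commute:
  assumes "w \<in> V" "v \<in> V" shows "nrm (\<lambda>x. w x - v x) = nrm (\<lambda>x. v x - w x)"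
  using nrm_scale[OF diff_mem[OF assms], of "-1"] by (simp add: minus_diff_eq)

lemma nrm_diff_triangle:
  assumes "w \<in> V" "v \<in> V" "u \<in> V"
  shows "nrm (\<lambda>x. w x - u x) \<le> nrm (\<lambda>x. w x - v x) + nrm (\<lambda>x. v x - u x)"
  using nrm_add_le[OF diff_mem[OF assms(1,2)] diff_mem[OF assms(2,3)]] by simp

lemma subspace:
  assumes "W \<subseteq> V" "W \<noteq> {}"
    and "\<And>w v b c. w \<in> W \<Longrightarrow> v \<in> W \<Longrightarrow> (\<lambda>x. b * w x + c * v x) \<in> W"
  shows "semi_inner W B"
  by unfold_locales (use assms lin sym nonneg in \<open>auto simp: subset_iff\<close>)

end

locale semi_hilbert = semi_inner +
  assumes complete: "\<And>X. (\<And>n. X n \<in> V) \<Longrightarrow>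
      (\<And>e. e > 0 \<Longrightarrow> \<exists>N. \<forall>i\<ge>N. \<forall>j\<ge>N. nrm (\<lambda>x. X i x - X j x) < e) \<Longrightarrow>
      \<exists>w\<in>V. (\<lambda>n. nrm (\<lambda>x. X n x - w x)) \<longlonglongrightarrow> 0"
begin

text \<open>Direct method: a minimizer of \<open>B v v - 2 * r v\<close> represents
  \<open>r\<close>, because its first variation in the direction \<open>v\<close> is
  \<open>2 * (B z v - r v)\<close>. Representers are determined only up to seminorm zero, so
  existence is all that is claimed.\<close>

lemma riesz_representation:
  assumes r_lin: "\<And>w v b c. w \<in> V \<Longrightarrow> v \<in> V \<Longrightarrow> r (\<lambda>x. b * w x + c * v x) = b * r w + c * r v"
    and r_bdd: "\<And>v. v \<in> V \<Longrightarrow> \<bar>r v\<bar> \<le> M * nrm v"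
  shows "\<exists>z\<in>V. \<forall>v\<in>V. B z v = r v"
proof -
  define J where "J v = B v v - 2 * r v" for v
  have J_lower: "- M\<^sup>2 \<le> J v" if "v \<in> V" for v
  proof -
    have "- M\<^sup>2 \<le> (nrm v)\<^sup>2 - 2 * (M * nrm v)"
      using zero_le_power2[of "nrm v - M"] by (simp add: power2_diff mult_ac)
    then show ?thesis using r_bdd[OF that] nrm_square[OF that] by (simp add: J_def)
  qed
  define d where "d = (INF v\<in>V. J v)"
  have bdd: "bdd_below (J ` V)" using J_lower by (auto simp: bdd_below_def)
  have d_le: "d \<le> J v" if "v \<in> V" for v
    using that bdd by (auto simp: d_def intro: cINF_lower)
  have "\<exists>v\<in>V. J v < d + inverse (real (Suc n))" for n
    using cINF_less_iff[OF nonempty bdd, of "d + inverse (real (Suc n))"] by (simp add: d_def)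
  then obtain X where X: "\<And>n. X n \<in> V" and JX: "\<And>n. J (X n) < d + inverse (real (Suc n))"
    by metis
  \<comment> \<open>Parallelogram law, with \<open>J\<close> at the midpoint bounded below by
    \<open>d\<close>: near-minimizers are close to each other, so a minimizing sequence is
    Cauchy.\<close>
  have par: "(nrm (\<lambda>x. w x - v x))\<^sup>2 \<le> 2 * (J w - d) + 2 * (J v - d)" if "w \<in> V" "v \<in> V" for w v
  proof -
    have "4 * d \<le> 4 * J (\<lambda>x. 1/2 * w x + 1/2 * v x)"
      using d_le[OF comb[OF that, of "1/2" "1/2"]] by simp
    also have "\<dots> = B w w + 2 * B w v + B v v - 4 * (r w + r v)"
      unfolding J_def comb_square[OF that] r_lin[OF that] by (simp add: power2_eq_square field_simps)
    finally have "4 * d \<le> B w w + 2 * B w v + B v v - 4 * (r w + r v)" .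
    moreover have "(nrm (\<lambda>x. w x - v x))\<^sup>2 = B w w - 2 * B w v + B v v"
      using comb_square[OF that, of 1 "-1"] nrm_square[OF diff_mem[OF that]] by simp
    ultimately show ?thesis by (simp add: J_def)
  qed
  have "\<exists>z\<in>V. (\<lambda>n. nrm (\<lambda>x. X n x - z x)) \<longlonglongrightarrow> 0"
  proof (rule complete[OF X])
    fix e :: real assume e: "e > 0"
    obtain N where N: "inverse (real (Suc N)) < e\<^sup>2 / 4"
      using reals_Archimedean[of "e\<^sup>2/4"] e by auto
    have JN: "J (X i) - d < e\<^sup>2 / 4" if "i \<ge> N" for i
    proof -
      have "inverse (real (Suc i)) \<le> inverse (real (Suc N))" using that by (simp add: field_simps)
      then show ?thesis using JX[of i] N by linarith
    qed
    have arith: "s < q" if "s \<le> 2 * a + 2 * b" "a < q / 4" "b < q / 4" for s a b q :: real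
      using that by simp
    have "nrm (\<lambda>x. X i x - X j x) < e" if "i \<ge> N" "j \<ge> N" for i j
    proof (rule power2_less_imp_less)
      show "(nrm (\<lambda>x. X i x - X j x))\<^sup>2 < e\<^sup>2"
        by (rule arith[OF par[OF X X] JN[OF that(1)] JN[OF that(2)]])
    qed (use e in simp)
    then show "\<exists>N. \<forall>i\<ge>N. \<forall>j\<ge>N. nrm (\<lambda>x. X i x - X j x) < e" by blast
  qed
  then obtain z where z: "z \<in> V" and lim: "(\<lambda>n. nrm (\<lambda>x. X n x - z x)) \<longlonglongrightarrow> 0" by blast
  have "B z v = r v" if v: "v \<in> V" for v
  proof -
    have quad: "0 \<le> 2 * t * (B z v - r v) + t\<^sup>2 * B v v" for t
    proof -
      \<comment> \<open>The variation is taken at \<open>X n\<close> and not at the limit: only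
        \<open>B (X n) v\<close> has to converge, and the defect
        \<open>inverse (real (Suc n))\<close> disappears.\<close>
      have ge: "0 \<le> inverse (real (Suc n)) + 2 * t * (B (X n) v - r v) + t\<^sup>2 * B v v" for n
      proof -
        have "d \<le> J (\<lambda>x. 1 * X n x + t * v x)" by (rule d_le[OF comb[OF X v]])
        also have "\<dots> = J (X n) + 2 * t * (B (X n) v - r v) + t\<^sup>2 * B v v"
          unfolding J_def comb_square[OF X v] r_lin[OF X v] by (simp add: algebra_simps)
        finally show ?thesis using JX[of n] by simp
      qed
      moreover have "(\<lambda>n. B (X n) v) \<longlonglongrightarrow> B z v"
      proof (rule LIM_zero_cancel, rule Lim_null_comparison)
        show "\<forall>\<^sub>F n in sequentially. norm (B (X n) v - B z v) \<le> nrm (\<lambda>x. X n x - z x) * nrm v"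
          using Cauchy_Schwarz[OF diff_mem[OF X z] v] by (simp add: diff_left X z v)
        show "(\<lambda>n. nrm (\<lambda>x. X n x - z x) * nrm v) \<longlonglongrightarrow> 0"
          using tendsto_mult_left_zero[OF lim] .
      qed
      then have "(\<lambda>n. inverse (real (Suc n)) + 2 * t * (B (X n) v - r v) + t\<^sup>2 * B v v)
          \<longlonglongrightarrow> 0 + 2 * t * (B z v - r v) + t\<^sup>2 * B v v"
        by (intro tendsto_intros LIMSEQ_inverse_real_of_nat)
      from LIMSEQ_le_const[OF this, of 0] ge show ?thesis by simp
    qed
    show ?thesis
      using quadratic_nonneg_imp_zero[OF quad nonneg[OF v]] by simp
  qed
  then show ?thesis using z by blast
qed

end

section \<open>Galerkin approximation of monotone semilinear problems\<close>

definition linear_set :: "('x \<Rightarrow> real) set \<Rightarrow> bool" where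
  "linear_set W \<longleftrightarrow> W \<noteq> {} \<and> (\<forall>w\<in>W. \<forall>v\<in>W. \<forall>b c. (\<lambda>x. b * w x + c * v x) \<in> W)"

lemma linear_set_comb:
  "linear_set W \<Longrightarrow> w \<in> W \<Longrightarrow> v \<in> W \<Longrightarrow> (\<lambda>x. b * w x + c * v x) \<in> W"
  by (simp add: linear_set_def)

lemma linear_set_diff: "linear_set W \<Longrightarrow> w \<in> W \<Longrightarrow> v \<in> W \<Longrightarrow> (\<lambda>x. w x - v x) \<in> W"
  using linear_set_comb[of W w v 1 "-1"] by simp

lemma linear_set_zero: "linear_set W \<Longrightarrow> (\<lambda>x. 0) \<in> W"
  using linear_set_diff[of W] by (fastforce simp: linear_set_def)

lemma linear_set_span:
  assumes "linear_set W"
  shows "linear_set {\<lambda>x. v x + c * t x |v c. v \<in> W}"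
  unfolding linear_set_def
proof (intro conjI ballI allI)
  show "{\<lambda>x. v x + c * t x |v c. v \<in> W} \<noteq> {}" using linear_set_zero[OF assms] by blast
  fix w v b c
  assume "w \<in> {\<lambda>x. v x + c * t x |v c. v \<in> W}" "v \<in> {\<lambda>x. v x + c * t x |v c. v \<in> W}"
  then obtain w' d v' e where *: "w' \<in> W" "v' \<in> W" and
    eq: "w = (\<lambda>x. w' x + d * t x)" "v = (\<lambda>x. v' x + e * t x)" by auto
  have "(\<lambda>x. b * w x + c * v x) = (\<lambda>x. (b * w' x + c * v' x) + (b * d + c * e) * t x)"
    by (simp add: eq algebra_simps)
  moreover have "(\<lambda>x. b * w' x + c * v' x) \<in> W" by (rule linear_set_comb[OF assms *])
  ultimately show "(\<lambda>x. b * w x + c * v x) \<in> {\<lambda>x. v x + c * t x |v c. v \<in> W}"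
    by (intro CollectI exI[of _ "\<lambda>x. b * w' x + c * v' x"] exI[of _ "b * d + c * e"] conjI)
qed

text \<open>Energy arguments bound the square of a norm by a multiple of that norm; this cancels the
  factor, which may be zero.\<close>

lemma le_if_square_le:
  fixes s t :: real
  assumes "s\<^sup>2 \<le> t * s" "0 \<le> s" "0 \<le> t"
  shows "s \<le> t"
  using assms by (cases "s = 0") (auto simp: power2_eq_square mult_le_cancel_right)

text \<open>Collects what the multigrid argument uses about the differential equation.
  \<open>F u v\<close> stands for the pairing of \<open>f(x, u)\<close> with \<open>v\<close> and is
  linear in \<open>v\<close> only. The Lipschitz bound measures the arguments in the weak norm of
  \<open>p0\<close> and the test function in the energy norm of \<open>B\<close>; \<kappa> is the
  embedding constant between the two.\<close>

locale semilinear = semi_hilbert V B + P: semi_inner V p0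
  for V :: "('x \<Rightarrow> real) set" and B p0 +
  fixes F :: "('x \<Rightarrow> real) \<Rightarrow> ('x \<Rightarrow> real) \<Rightarrow> real" and K \<kappa> :: real
  assumes F_lin: "\<And>w v u b c. u \<in> V \<Longrightarrow> w \<in> V \<Longrightarrow> v \<in> V \<Longrightarrow>
      F u (\<lambda>x. b * w x + c * v x) = b * F u w + c * F u v"
    and F_mono: "\<And>w v. w \<in> V \<Longrightarrow> v \<in> V \<Longrightarrow> F v (\<lambda>x. w x - v x) \<le> F w (\<lambda>x. w x - v x)"
    and F_lip: "\<And>w v \<phi>. w \<in> V \<Longrightarrow> v \<in> V \<Longrightarrow> \<phi> \<in> V \<Longrightarrow>
      F w \<phi> - F v \<phi> \<le> K * P.nrm (\<lambda>x. w x - v x) * nrm \<phi>"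
    and K_nonneg: "0 \<le> K" and \<kappa>_nonneg: "0 \<le> \<kappa>"
    and embed: "\<And>w. w \<in> V \<Longrightarrow> P.nrm w \<le> \<kappa> * nrm w"
begin

section \<open>Duality estimate and quasi-optimality of Galerkin solutions\<close>

definition galerkin :: "(('x \<Rightarrow> real) \<Rightarrow> real) \<Rightarrow> ('x \<Rightarrow> real) set \<Rightarrow> ('x \<Rightarrow> real) \<Rightarrow> bool" where
  "galerkin G W w \<longleftrightarrow> w \<in> W \<and> (\<forall>v\<in>W. B w v + F w v = G v)"

text \<open>Abstract counterpart of \<open>eta_a\<close>, with \<open>z\<close> the dual solution
  for the datum \<psi>. The bound is homogeneous in \<psi> instead of normalized, and the slack
  \<open>e\<close> replaces the infimum over \<open>W\<close>, so no best approximation has to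
  exist.\<close>

definition dual_rate :: "('x \<Rightarrow> real) set \<Rightarrow> real \<Rightarrow> bool" where
  "dual_rate W \<eta> \<longleftrightarrow> 0 \<le> \<eta> \<and> (\<forall>\<psi>\<in>V. \<exists>z\<in>V. (\<forall>v\<in>V. B z v = p0 \<psi> v) \<and>
     (\<forall>e>0. \<exists>v\<in>W. nrm (\<lambda>x. z x - v x) \<le> \<eta> * P.nrm \<psi> + e))"

lemma F_diff: "u \<in> V \<Longrightarrow> w \<in> V \<Longrightarrow> v \<in> V \<Longrightarrow> F u (\<lambda>x. w x - v x) = F u w - F u v"
  using F_lin[of u w v 1 "-1"] by simp

lemma F_lip_abs:
  assumes "w \<in> V" "v \<in> V" "\<phi> \<in> V"
  shows "\<bar>F w \<phi> - F v \<phi>\<bar> \<le> K * P.nrm (\<lambda>x. w x - v x) * nrm \<phi>"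
  using F_lip[OF assms] F_lip[OF assms(2,1,3)] P.nrm_diff_commute[OF assms(1,2)] by (simp add: abs_le_iff)

text \<open>Split the error \<open>e = u - w\<close> as \<open>e1 + e2\<close>, where \<open>e1\<close> represents the residual functional and is
  therefore estimated by the usual duality argument. Comparing \<open>u\<close> with the intermediate function
  \<open>w + e1\<close> makes the monotone part of the nonlinearity act on \<open>e2\<close> with a favourable sign, so that
  no linearization of the problem is needed.\<close>

lemma aubin_nitsche:
  assumes W: "W \<subseteq> V" and rate: "dual_rate W \<eta>" and u: "u \<in> V" and w: "w \<in> V"
    and orth: "\<And>v. v \<in> W \<Longrightarrow> B u v + F u v = B w v + F w v"
  shows "P.nrm (\<lambda>x. u x - w x) \<le> (1 + \<kappa> * K)\<^sup>2 * \<eta> * nrm (\<lambda>x. u x - w x)"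
proof -
  define e where "e = (\<lambda>x. u x - w x)"
  define r where "r v = B e v + (F u v - F w v)" for v
  \<comment> \<open>\<open>M\<close> will bound the dual norm of the residual \<open>r\<close>: the
    1 is the share of \<open>B e v\<close>, and \<open>\<kappa> * K\<close> that of the nonlinear
    difference after the embedding.\<close>
  define M where "M = (1 + \<kappa> * K) * nrm e"
  have e: "e \<in> V" using diff_mem[OF u w] by (simp add: e_def)
  have c_nonneg: "0 \<le> \<kappa> * K" using K_nonneg \<kappa>_nonneg by simp
  have M: "0 \<le> M" using c_nonneg nrm_nonneg[OF e] by (simp add: M_def)
  have \<eta>: "0 \<le> \<eta>" using rate by (simp add: dual_rate_def)
  have r_lin: "r (\<lambda>x. b * v x + c * v' x) = b * r v + c * r v'" if "v \<in> V" "v' \<in> V" for v v' b c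
    using that by (simp add: r_def lin2 e F_lin u w algebra_simps)
  have r_bdd: "\<bar>r v\<bar> \<le> M * nrm v" if v: "v \<in> V" for v
  proof -
    have "\<bar>F u v - F w v\<bar> \<le> K * P.nrm e * nrm v" using F_lip_abs[OF u w v] by (simp add: e_def)
    also have "\<dots> \<le> K * (\<kappa> * nrm e) * nrm v"
      by (intro mult_right_mono mult_left_mono embed e K_nonneg nrm_nonneg v)
    finally show ?thesis using Cauchy_Schwarz[OF e v] by (simp add: r_def M_def algebra_simps)
  qed
  obtain e1 where e1: "e1 \<in> V" and rep: "\<And>v. v \<in> V \<Longrightarrow> B e1 v = r v"
    using riesz_representation[of r M] r_lin r_bdd by blast
  define e2 where "e2 = (\<lambda>x. e x - e1 x)"
  have e2: "e2 \<in> V" using diff_mem[OF e e1] by (simp add: e2_def)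
  have bound1: "P.nrm e1 \<le> M * \<eta>"
  proof (rule le_if_square_le)
    obtain z where z: "z \<in> V" "\<And>v. v \<in> V \<Longrightarrow> B z v = p0 e1 v" and
      approx: "\<And>\<epsilon>. \<epsilon> > 0 \<Longrightarrow> \<exists>v\<in>W. nrm (\<lambda>x. z x - v x) \<le> \<eta> * P.nrm e1 + \<epsilon>"
      using rate e1 by (auto simp: dual_rate_def)
    show "(P.nrm e1)\<^sup>2 \<le> M * \<eta> * P.nrm e1"
    proof (rule field_le_epsilon)
      fix \<epsilon> :: real assume \<epsilon>: "0 < \<epsilon>"
      \<comment> \<open>The slack gets multiplied by \<open>M\<close> below and must stay within
        \<epsilon>; the divisor \<open>M + 1\<close> also allows \<open>M = 0\<close>.\<close>
      then obtain v where v: "v \<in> W" and le: "nrm (\<lambda>x. z x - v x) \<le> \<eta> * P.nrm e1 + \<epsilon> / (M + 1)"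
        using approx[of "\<epsilon> / (M + 1)"] M by auto
      have v': "v \<in> V" using v W by auto
      have "(P.nrm e1)\<^sup>2 = r z"
        using P.nrm_square[OF e1] z(2)[OF e1] sym[OF z(1) e1] rep[OF z(1)] by simp
      \<comment> \<open>Galerkin orthogonality: the residual vanishes on \<open>W\<close>.\<close>
      also have "\<dots> = r (\<lambda>x. z x - v x)"
        using r_lin[OF z(1) v', of 1 "-1"] orth[OF v] by (simp add: r_def e_def diff_left u w v')
      also have "\<dots> \<le> M * nrm (\<lambda>x. z x - v x)"
        using r_bdd[OF diff_mem[OF z(1) v']] by simp
      also have "\<dots> \<le> M * (\<eta> * P.nrm e1 + \<epsilon> / (M + 1))" by (rule mult_left_mono[OF le M])
      also have "\<dots> = M * \<eta> * P.nrm e1 + M / (M + 1) * \<epsilon>" by (simp add: algebra_simps)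
      also have "M / (M + 1) * \<epsilon> \<le> 1 * \<epsilon>"
        by (rule mult_right_mono) (use M \<epsilon> in auto)
      finally show "(P.nrm e1)\<^sup>2 \<le> M * \<eta> * P.nrm e1 + \<epsilon>" by simp
    qed
  qed (use M \<eta> P.nrm_nonneg[OF e1] in auto)
  have "nrm e2 \<le> K * P.nrm e1"
  proof (rule le_if_square_le)
    define m where "m = (\<lambda>x. w x + e1 x)"
    have m: "m \<in> V" using add_mem[OF w e1] by (simp add: m_def)
    have e2_m: "e2 = (\<lambda>x. u x - m x)" by (auto simp: e2_def e_def m_def algebra_simps)
    \<comment> \<open>Since \<open>B e1 e2 = r e2\<close>, the term \<open>B e e2\<close> cancels
      and \<open>F w e2 - F u e2\<close> remains, which is split at \<open>m\<close>. As
      \<open>u - m = e2\<close>, monotonicity settles one part; as \<open>w - m = - e1\<close>, the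
      other is controlled by the \<open>p0\<close> norm of \<open>e1\<close>.\<close>
    have "(nrm e2)\<^sup>2 = B e e2 - B e1 e2"
      using nrm_square[OF e2] diff_left[OF e e1 e2] by (simp add: e2_def)
    also have "\<dots> = (F m e2 - F u e2) + (F w e2 - F m e2)"
      using rep[OF e2] by (simp add: r_def)
    also have "\<dots> \<le> 0 + K * P.nrm (\<lambda>x. w x - m x) * nrm e2"
      using F_mono[OF u m] F_lip[OF w m e2] by (intro add_mono) (auto simp: e2_m)
    also have "P.nrm (\<lambda>x. w x - m x) = P.nrm e1"
      using P.nrm_diff_commute[OF w m] by (simp add: m_def)
    finally show "(nrm e2)\<^sup>2 \<le> K * P.nrm e1 * nrm e2" by simp
  qed (use K_nonneg P.nrm_nonneg[OF e1] nrm_nonneg[OF e2] in auto)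
  then have "P.nrm e2 \<le> \<kappa> * (K * P.nrm e1)"
    using embed[OF e2] mult_left_mono[OF _ \<kappa>_nonneg] order_trans by blast
  moreover have "P.nrm e \<le> P.nrm e1 + P.nrm e2"
    using P.nrm_add_le[OF e1 e2] by (simp add: e2_def)
  \<comment> \<open>The factor \<open>1 + \<kappa> * K\<close> enters a second time, now from adding
    \<open>e2\<close> to \<open>e1\<close>; the first one sits inside \<open>M\<close>. Hence the
    square in the estimate.\<close>
  ultimately have "P.nrm e \<le> (1 + \<kappa> * K) * P.nrm e1" by (simp add: algebra_simps)
  also have "\<dots> \<le> (1 + \<kappa> * K) * (M * \<eta>)"
    using bound1 c_nonneg by (intro mult_left_mono) auto
  finally show ?thesis by (simp add: e_def M_def power2_eq_square mult_ac)
qed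

text \<open>The square comes from \<open>aubin_nitsche\<close>. The factor \<open>1 + K\<close>
  makes one constant serve both for the weak norm of an error and for \<open>K\<close> times it, the
  form in which nonlinear differences appear.\<close>

definition stab :: real where "stab = (1 + K) * (1 + \<kappa> * K)\<^sup>2"

lemma stab_nonneg: "0 \<le> stab"
  using K_nonneg by (simp add: stab_def)

lemma aubin_nitsche_stab:
  assumes "W \<subseteq> V" "dual_rate W \<eta>" "u \<in> V" "w \<in> V"
    and "\<And>v. v \<in> W \<Longrightarrow> B u v + F u v = B w v + F w v"
  shows "P.nrm (\<lambda>x. u x - w x) \<le> stab * \<eta> * nrm (\<lambda>x. u x - w x)"
    and "K * P.nrm (\<lambda>x. u x - w x) \<le> stab * \<eta> * nrm (\<lambda>x. u x - w x)"
proof -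
  define D where "D = (1 + \<kappa> * K)\<^sup>2 * \<eta> * nrm (\<lambda>x. u x - w x)"
  have D: "0 \<le> D"
    using assms(2) nrm_nonneg[OF diff_mem[OF assms(3,4)]] by (simp add: D_def dual_rate_def)
  have le: "P.nrm (\<lambda>x. u x - w x) \<le> D" unfolding D_def by (rule aubin_nitsche[OF assms])
  have eq: "stab * \<eta> * nrm (\<lambda>x. u x - w x) = D + K * D" by (simp add: stab_def D_def algebra_simps)
  show "P.nrm (\<lambda>x. u x - w x) \<le> stab * \<eta> * nrm (\<lambda>x. u x - w x)"
    unfolding eq using le D K_nonneg by (simp add: add_increasing2)
  show "K * P.nrm (\<lambda>x. u x - w x) \<le> stab * \<eta> * nrm (\<lambda>x. u x - w x)"
    unfolding eq using mult_left_mono[OF le K_nonneg] D by simp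
qed

text \<open>Cea's argument with a nonlinear term. As \<open>e - d = v - w\<close> lies in
  \<open>X\<close>, testing with it turns \<open>B\<close> into a difference of \<open>F\<close>;
  monotonicity disposes of the part along \<open>e\<close>, and the part along \<open>d\<close> has
  relative size \<open>stab * \<eta>\<close>. The duality runs on \<open>W\<close> even if
  \<open>X\<close> is larger, so the constant tends to 1 with the coarse quantity \<eta>.\<close>

lemma quasi_optimality:
  assumes X: "X \<subseteq> V" "linear_set X" and W: "W \<subseteq> X" and rate: "dual_rate W \<eta>"
    and u: "u \<in> V" and w: "w \<in> X" and v: "v \<in> X"
    and orth: "\<And>v. v \<in> X \<Longrightarrow> B u v + F u v = B w v + F w v"
  shows "nrm (\<lambda>x. u x - w x) \<le> (1 + stab * \<eta>) * nrm (\<lambda>x. u x - v x)"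
proof -
  define e where "e = (\<lambda>x. u x - w x)"
  define d where "d = (\<lambda>x. u x - v x)"
  have wV: "w \<in> V" and vV: "v \<in> V" using X w v by auto
  have e: "e \<in> V" and d: "d \<in> V" using diff_mem[OF u wV] diff_mem[OF u vV] by (simp_all add: e_def d_def)
  have \<eta>: "0 \<le> \<eta>" using rate by (simp add: dual_rate_def)
  have ed: "(\<lambda>x. e x - d x) \<in> X"
    using linear_set_diff[OF X(2) v w] by (simp add: e_def d_def)
  show ?thesis unfolding e_def[symmetric] d_def[symmetric]
  proof (rule le_if_square_le)
    have "B e (\<lambda>x. e x - d x) = F w (\<lambda>x. e x - d x) - F u (\<lambda>x. e x - d x)"
      using orth[OF ed] ed X(1) by (subst e_def) (simp add: diff_left u wV subset_iff)
    then have "(nrm e)\<^sup>2 = B e d + (F w e - F u e) + (F u d - F w d)"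
      using nrm_square[OF e] by (simp add: diff_right F_diff e d u wV)
    also have "\<dots> \<le> nrm e * nrm d + 0 + K * P.nrm e * nrm d"
      using Cauchy_Schwarz[OF e d] F_mono[OF u wV] F_lip[OF u wV d]
      by (intro add_mono) (auto simp: e_def)
    also have "K * P.nrm e \<le> stab * \<eta> * nrm e"
      unfolding e_def using W X orth by (intro aubin_nitsche_stab(2)[of W] rate u wV) auto
    finally show "(nrm e)\<^sup>2 \<le> (1 + stab * \<eta>) * nrm d * nrm e"
      using nrm_nonneg[OF d] by (simp add: algebra_simps mult_right_mono)
  qed (use \<eta> stab_nonneg nrm_nonneg e d in auto)
qed

section \<open>Contraction by one correction step\<close>

definition nested_galerkin ::
    "(('x \<Rightarrow> real) \<Rightarrow> real) \<Rightarrow> ('x \<Rightarrow> real) set \<Rightarrow> ('x \<Rightarrow> real) set \<Rightarrow> ('x \<Rightarrow> real) \<Rightarrow> bool" where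
  "nested_galerkin G W Y w \<longleftrightarrow> (\<exists>X. linear_set X \<and> W \<subseteq> X \<and> X \<subseteq> Y \<and> galerkin G X w)"

definition mg_step where
  "mg_step G \<theta> W Y w w' \<longleftrightarrow>
     w \<in> Y \<and>
     (\<exists>what\<in>Y. \<exists>wtilde\<in>Y.
        (\<forall>v\<in>Y. B what v = - F w v + G v) \<and>
        nrm (\<lambda>x. wtilde x - what x) \<le> \<theta> * nrm (\<lambda>x. w x - what x) \<and>
        galerkin G {\<lambda>x. v x + c * wtilde x |v c. v \<in> W} w')"

text \<open>Lets the last iterate of one level start the next. The witness space changes with every
  step, so the invariant records only that it lies between \<open>W\<close> and the current
  space.\<close>

lemma nested_galerkin_mono: "nested_galerkin G W Y w \<Longrightarrow> Y \<subseteq> Y' \<Longrightarrow> nested_galerkin G W Y' w"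
  unfolding nested_galerkin_def by blast

text \<open>\<open>W\<close> is contained in both solution spaces, so the two functions satisfy the
  same equation against \<open>W\<close>, and that is what the duality argument asks for.\<close>

lemma nested_galerkin_L2:
  assumes "Y \<subseteq> V" "dual_rate W \<eta>" "galerkin G Y ub" "nested_galerkin G W Y w"
  shows "P.nrm (\<lambda>x. ub x - w x) \<le> stab * \<eta> * nrm (\<lambda>x. ub x - w x)"
    and "K * P.nrm (\<lambda>x. ub x - w x) \<le> stab * \<eta> * nrm (\<lambda>x. ub x - w x)"
proof -
  obtain X where X: "W \<subseteq> X" "X \<subseteq> Y" "galerkin G X w"
    using assms(4) by (auto simp: nested_galerkin_def)
  have *: "W \<subseteq> V" "ub \<in> V" "w \<in> V" "\<And>v. v \<in> W \<Longrightarrow> B ub v + F ub v = B w v + F w v"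
    using X assms(1,3) by (auto simp: galerkin_def subset_iff)
  show "P.nrm (\<lambda>x. ub x - w x) \<le> stab * \<eta> * nrm (\<lambda>x. ub x - w x)"
    by (rule aubin_nitsche_stab(1)[OF *(1) assms(2) *(2,3,4)])
  show "K * P.nrm (\<lambda>x. ub x - w x) \<le> stab * \<eta> * nrm (\<lambda>x. ub x - w x)"
    by (rule aubin_nitsche_stab(2)[OF *(1) assms(2) *(2,3,4)])
qed

text \<open>Shows where \<gamma> comes from. With \<open>s = stab * \<eta>\<close> and old error
  \<open>E\<close>, freezing the nonlinearity costs \<open>s * E\<close>. The linear iteration
  starts at distance at most \<open>(1 + s) * E\<close> from its target and leaves
  \<open>\<theta> * (1 + s) * E\<close>. The sum is
  \<open>(\<theta> + (1 + \<theta>) * s) * E\<close>; the last factor \<open>1 + s\<close> is the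
  quasi-optimality of the Galerkin solve on a space containing \<open>wt\<close>.\<close>

lemma mg_step_contraction:
  assumes Y: "Y \<subseteq> V" "linear_set Y" and W: "linear_set W" "W \<subseteq> Y" and rate: "dual_rate W \<eta>"
    and \<theta>: "0 \<le> \<theta>" and ub: "galerkin G Y ub" and w: "nested_galerkin G W Y w"
    and step: "mg_step G \<theta> W Y w w'"
  shows "nested_galerkin G W Y w'"
    and "nrm (\<lambda>x. ub x - w' x)
      \<le> (\<theta> + (1 + \<theta>) * stab * \<eta>) * (1 + stab * \<eta>) * nrm (\<lambda>x. ub x - w x)"
proof -
  obtain wh wt where wh: "wh \<in> Y" "\<And>v. v \<in> Y \<Longrightarrow> B wh v = - F w v + G v" and wt: "wt \<in> Y"
    and contr: "nrm (\<lambda>x. wt x - wh x) \<le> \<theta> * nrm (\<lambda>x. w x - wh x)"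
    and w': "galerkin G {\<lambda>x. v x + c * wt x |v c. v \<in> W} w'" and wY: "w \<in> Y"
    using step by (auto simp: mg_step_def)
  define X where "X = {\<lambda>x. v x + c * wt x |v c. v \<in> W}"
  have w'X: "galerkin G X w'" using w' by (simp add: X_def)
  have X: "linear_set X" unfolding X_def by (rule linear_set_span[OF W(1)])
  have WX: "W \<subseteq> X"
  proof
    fix v assume "v \<in> W"
    then have "(\<lambda>x. v x + 0 * wt x) \<in> X" unfolding X_def by blast
    then show "v \<in> X" by simp
  qed
  have XY: "X \<subseteq> Y"
  proof
    fix y assume "y \<in> X"
    then obtain v c where "y = (\<lambda>x. 1 * v x + c * wt x)" "v \<in> Y" using W by (auto simp: X_def)
    then show "y \<in> Y" using linear_set_comb[OF Y(2) _ wt] by blast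
  qed
  have wtX: "wt \<in> X"
  proof -
    have "(\<lambda>x. 0 + 1 * wt x) \<in> X"
      unfolding X_def by (intro CollectI exI[of _ "\<lambda>x. 0"] exI[of _ 1] conjI linear_set_zero[OF W(1)] refl)
    then show ?thesis by simp
  qed
  show "nested_galerkin G W Y w'"
    unfolding nested_galerkin_def using X WX XY w'X by blast
  have ubY: "ub \<in> Y" using ub by (simp add: galerkin_def)
  have V: "wh \<in> V" "wt \<in> V" "ub \<in> V" "w \<in> V" using wh wt ubY wY Y by auto
  have \<eta>: "0 \<le> \<eta>" using rate by (simp add: dual_rate_def)
  define s where "s = stab * \<eta>"
  have s: "0 \<le> s" using \<eta> stab_nonneg by (simp add: s_def)
  define E where "E = nrm (\<lambda>x. ub x - w x)"
  \<comment> \<open>Subtracting the equations of \<open>wh\<close> and \<open>ub\<close> on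
    \<open>Y\<close> leaves only \<open>F ub - F w\<close>, hence a weak-norm error of the old
    iterate, which its Galerkin property makes small.\<close>
  have hat: "nrm (\<lambda>x. wh x - ub x) \<le> s * E"
  proof (rule le_if_square_le)
    define d where "d = (\<lambda>x. wh x - ub x)"
    have dY: "d \<in> Y" using linear_set_diff[OF Y(2) wh(1) ubY] by (simp add: d_def)
    then have d: "d \<in> V" using Y by auto
    have "B wh d - B ub d = F ub d - F w d"
      using wh(2)[OF dY] ub dY by (force simp: galerkin_def)
    then have "(nrm d)\<^sup>2 = F ub d - F w d"
      using nrm_square[OF d] diff_left[OF V(1,3) d] by (simp add: d_def)
    also have "\<dots> \<le> K * P.nrm (\<lambda>x. ub x - w x) * nrm d" by (rule F_lip[OF V(3,4) d])
    also have "\<dots> \<le> s * E * nrm d"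
      using nested_galerkin_L2(2)[OF Y(1) rate ub w] nrm_nonneg[OF d]
      by (intro mult_right_mono) (auto simp: E_def s_def)
    finally show "(nrm (\<lambda>x. wh x - ub x))\<^sup>2 \<le> s * E * nrm (\<lambda>x. wh x - ub x)"
      by (simp add: d_def)
  qed (use s nrm_nonneg diff_mem V in \<open>auto simp: E_def\<close>)
  have "nrm (\<lambda>x. w x - wh x) \<le> nrm (\<lambda>x. w x - ub x) + nrm (\<lambda>x. ub x - wh x)"
    by (rule nrm_diff_triangle[OF V(4,3,1)])
  also have "\<dots> \<le> E + s * E"
    using hat by (simp add: E_def nrm_diff_commute[OF V(4,3)] nrm_diff_commute[OF V(3,1)])
  finally have tilde: "\<theta> * nrm (\<lambda>x. w x - wh x) \<le> \<theta> * (E + s * E)"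
    by (rule mult_left_mono[OF _ \<theta>])
  have "nrm (\<lambda>x. ub x - wt x) \<le> nrm (\<lambda>x. ub x - wh x) + nrm (\<lambda>x. wh x - wt x)"
    by (rule nrm_diff_triangle[OF V(3,1,2)])
  also have "\<dots> \<le> s * E + \<theta> * (E + s * E)"
    using hat contr tilde by (simp add: nrm_diff_commute[OF V(3,1)] nrm_diff_commute[OF V(1,2)])
  finally have ut: "nrm (\<lambda>x. ub x - wt x) \<le> (\<theta> + (1 + \<theta>) * s) * E" by (simp add: algebra_simps)
  have "nrm (\<lambda>x. ub x - w' x) \<le> (1 + stab * \<eta>) * nrm (\<lambda>x. ub x - wt x)"
  proof (rule quasi_optimality[OF _ X WX rate V(3) _ wtX])
    show "X \<subseteq> V" "w' \<in> X" using XY Y w'X by (auto simp: galerkin_def)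
    show "B ub v + F ub v = B w' v + F w' v" if "v \<in> X" for v
      using that w'X ub XY by (auto simp: galerkin_def subset_iff)
  qed
  also have "\<dots> \<le> (1 + s) * ((\<theta> + (1 + \<theta>) * s) * E)"
    unfolding s_def[symmetric] using s by (intro mult_left_mono ut) auto
  finally show "nrm (\<lambda>x. ub x - w' x)
      \<le> (\<theta> + (1 + \<theta>) * stab * \<eta>) * (1 + stab * \<eta>) * nrm (\<lambda>x. ub x - w x)"
    by (simp add: s_def E_def mult_ac)
qed

lemma multigrid_level:
  assumes Y: "Y \<subseteq> V" "linear_set Y" and W: "linear_set W" "W \<subseteq> Y" and rate: "dual_rate W \<eta>"
    and \<theta>: "0 \<le> \<theta>" and ub: "galerkin G Y ub" and w: "nested_galerkin G W Y (it 0)"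
    and step: "\<And>l. l < p \<Longrightarrow> mg_step G \<theta> W Y (it l) (it (Suc l))"
  defines "\<gamma> \<equiv> (\<theta> + (1 + \<theta>) * stab * \<eta>) * (1 + stab * \<eta>)"
  shows "nested_galerkin G W Y (it p) \<and> nrm (\<lambda>x. ub x - it p x) \<le> \<gamma> ^ p * nrm (\<lambda>x. ub x - it 0 x)"
  using step
proof (induction p)
  case 0
  then show ?case using w by simp
next
  case (Suc p)
  have IH: "nested_galerkin G W Y (it p)"
    "nrm (\<lambda>x. ub x - it p x) \<le> \<gamma> ^ p * nrm (\<lambda>x. ub x - it 0 x)"
    using Suc.IH Suc.prems by auto
  have "0 \<le> \<eta>" using rate by (simp add: dual_rate_def)
  then have "0 \<le> \<gamma>" using \<theta> stab_nonneg by (simp add: \<gamma>_def)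
  note contr = mg_step_contraction[OF Y W rate \<theta> ub IH(1) Suc.prems[OF lessI]]
  have "nrm (\<lambda>x. ub x - it (Suc p) x) \<le> \<gamma> * nrm (\<lambda>x. ub x - it p x)"
    using contr(2) by (simp add: \<gamma>_def)
  also have "\<dots> \<le> \<gamma> * (\<gamma> ^ p * nrm (\<lambda>x. ub x - it 0 x))"
    by (rule mult_left_mono[OF IH(2) \<open>0 \<le> \<gamma>\<close>])
  finally show ?case using contr(1) by (simp add: mult_ac)
qed

section \<open>Summation over the levels\<close>

lemma galerkin_best_approximation:
  assumes X: "X \<subseteq> V" "linear_set X" and W: "W \<subseteq> X" and rate: "dual_rate W \<eta>"
    and u: "galerkin G V u" and w: "galerkin G X w"
  shows "nrm (\<lambda>x. u x - w x) \<le> (1 + stab * \<eta>) * (INF v\<in>X. nrm (\<lambda>x. u x - v x))"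
proof -
  have pos: "0 < 1 + stab * \<eta>"
    using rate stab_nonneg by (intro add_pos_nonneg mult_nonneg_nonneg) (auto simp: dual_rate_def)
  have "nrm (\<lambda>x. u x - w x) / (1 + stab * \<eta>) \<le> (INF v\<in>X. nrm (\<lambda>x. u x - v x))"
  proof (rule cINF_greatest)
    show "X \<noteq> {}" using w by (auto simp: galerkin_def)
    fix v assume v: "v \<in> X"
    have "nrm (\<lambda>x. u x - w x) \<le> (1 + stab * \<eta>) * nrm (\<lambda>x. u x - v x)"
      by (rule quasi_optimality[OF X W rate]) (use u w v X in \<open>auto simp: galerkin_def subset_iff\<close>)
    then show "nrm (\<lambda>x. u x - w x) / (1 + stab * \<eta>) \<le> nrm (\<lambda>x. u x - v x)"
      using pos by (simp add: field_simps)
  qed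
  then show ?thesis using pos by (simp add: field_simps)
qed

lemma best_approximation_antimono:
  assumes "X \<subseteq> Y" "X \<noteq> {}" "Y \<subseteq> V" "u \<in> V"
  shows "(INF v\<in>Y. nrm (\<lambda>x. u x - v x)) \<le> (INF v\<in>X. nrm (\<lambda>x. u x - v x))"
proof (rule cINF_superset_mono)
  show "bdd_below ((\<lambda>v. nrm (\<lambda>x. u x - v x)) ` Y)"
    using assms nrm_nonneg[OF diff_mem] by (auto intro!: bdd_belowI[of _ 0])
qed (use assms in auto)

lemma best_approximation_nonneg:
  assumes "X \<subseteq> V" "X \<noteq> {}" "u \<in> V"
  shows "0 \<le> (INF v\<in>X. nrm (\<lambda>x. u x - v x))"
  using assms by (intro cINF_greatest nrm_nonneg diff_mem) auto

theorem full_multigrid_error: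
  fixes C :: real and n p :: nat
  assumes rate: "dual_rate W \<eta>" and W: "linear_set W" "W \<subseteq> Y 1"
    and Y: "\<And>k. k \<in> {1..n} \<Longrightarrow> Y k \<subseteq> V \<and> linear_set (Y k)"
    and nested: "\<And>k. k \<in> {2..n} \<Longrightarrow> Y (k - 1) \<subseteq> Y k"
    and u: "galerkin G V u" and ub: "\<And>k. k \<in> {1..n} \<Longrightarrow> galerkin G (Y k) (ub k)"
    and uh1: "galerkin G (Y 1) (uh 1)"
    and level: "\<And>k. k \<in> {2..n} \<Longrightarrow> \<exists>it. it 0 = uh (k - 1) \<and>
        (\<forall>l<p. mg_step G \<theta> W (Y k) (it l) (it (Suc l))) \<and> uh k = it p"
    and p: "1 \<le> p" and n: "1 \<le> n" and \<theta>: "0 \<le> \<theta>" and b: "0 \<le> b"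
    and \<delta>: "\<And>k. \<delta> k = (INF v\<in>Y k. nrm (\<lambda>x. u x - v x))"
    and decay: "\<And>k. k \<in> {2..n} \<Longrightarrow> \<delta> (k - 1) \<le> b * \<delta> k"
    and C: "stab \<le> C" "(1 + stab * \<eta>)\<^sup>2 \<le> 1 + C * \<eta>"
  defines "\<gamma> \<equiv> (\<theta> + (1 + \<theta>) * C * \<eta>) * (1 + C * \<eta>)"
  shows "P.nrm (\<lambda>x. ub n x - uh n x) \<le> C * \<eta> * nrm (\<lambda>x. ub n x - uh n x)"
    and "\<gamma> ^ p * b < 1 \<Longrightarrow> nrm (\<lambda>x. ub n x - uh n x) \<le> 2 * \<gamma> ^ p * b / (1 - \<gamma> ^ p * b) * \<delta> n"
proof -
  define s where "s = stab * \<eta>"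
  define \<gamma>' where "\<gamma>' = (\<theta> + (1 + \<theta>) * stab * \<eta>) * (1 + stab * \<eta>)"
  define q where "q = \<gamma> ^ p * b"
  have \<eta>: "0 \<le> \<eta>" using rate by (simp add: dual_rate_def)
  have s: "0 \<le> s" "s \<le> C * \<eta>"
    using \<eta> stab_nonneg C(1) by (auto simp: s_def mult_right_mono)
  have \<gamma>': "0 \<le> \<gamma>'" using s \<theta> \<eta> stab_nonneg by (simp add: \<gamma>'_def)
  have "\<theta> + (1 + \<theta>) * stab * \<eta> \<le> \<theta> + (1 + \<theta>) * C * \<eta>"
    using \<theta> \<eta> C(1) by (intro add_left_mono mult_right_mono mult_left_mono) auto
  then have "(\<theta> + (1 + \<theta>) * stab * \<eta>) * (1 + s)\<^sup>2 \<le> (\<theta> + (1 + \<theta>) * C * \<eta>) * (1 + C * \<eta>)"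
    using C(2) \<theta> \<eta> stab_nonneg order_trans[OF stab_nonneg C(1)] unfolding s_def
    by (intro mult_mono) auto
  \<comment> \<open>One factor \<open>1 + s\<close> of the square belongs to
    \<open>\<gamma>'\<close>; the other is held in reserve for the quasi-optimality constant of the
    finite element solutions.\<close>
  then have \<gamma>'_s: "\<gamma>' * (1 + s) \<le> \<gamma>"
    by (simp add: \<gamma>'_def \<gamma>_def s_def power2_eq_square mult_ac)
  have \<gamma>'_le: "\<gamma>' \<le> \<gamma>"
  proof -
    have "\<gamma>' * 1 \<le> \<gamma>' * (1 + s)" using s \<gamma>' by (intro mult_left_mono) auto
    then show ?thesis using \<gamma>'_s by simp
  qed
  have \<gamma>: "0 \<le> \<gamma>" using \<gamma>' \<gamma>'_le by simp
  \<comment> \<open>The reserve is spent once per level, so one of the \<open>p\<close> factors has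
    to supply it; this is where at least one correction step is needed.\<close>
  have pow_s: "\<gamma>' ^ p * (1 + s) \<le> \<gamma> ^ p"
  proof -
    obtain p' where p': "p = Suc p'" using p by (cases p) auto
    have "\<gamma>' ^ p' * (\<gamma>' * (1 + s)) \<le> \<gamma> ^ p' * \<gamma>"
      using \<gamma>' \<gamma>'_le \<gamma>'_s \<gamma> s by (intro mult_mono power_mono) auto
    then show ?thesis by (simp add: p' mult_ac)
  qed
  have pow_le: "\<gamma>' ^ p \<le> \<gamma> ^ p" by (rule power_mono[OF \<gamma>'_le \<gamma>'])
  have q: "0 \<le> q" using \<gamma> b by (simp add: q_def)
  have WY: "W \<subseteq> Y k" if "k \<in> {1..n}" for k
    using that
  proof (induction k)
    case (Suc k)
    then show ?case using W(2) nested[of "Suc k"] by (cases "k = 0") auto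
  qed auto
  \<comment> \<open>The Galerkin property stays outside the implication because the weak-norm
    estimate is claimed without \<open>q < 1\<close>.\<close>
  have key: "nested_galerkin G W (Y k) (uh k) \<and>
      (q < 1 \<longrightarrow> nrm (\<lambda>x. ub k x - uh k x) \<le> 2 * q / (1 - q) * \<delta> k)" if "k \<in> {1..n}" for k
    using that
  proof (induction k)
    case (Suc k)
    show ?case
    proof (cases "k = 0")
      case True
      have 1: "1 \<in> {1..n}" using n by simp
      \<comment> \<open>\<open>uh 1\<close> and \<open>ub 1\<close> solve the same problem but need
        not coincide as functions; quasi-optimality with \<open>ub 1\<close> as its own competitor
        shows that their distance is zero.\<close>
      have "nrm (\<lambda>x. ub 1 x - uh 1 x) \<le> (1 + stab * \<eta>) * nrm (\<lambda>x. ub 1 x - ub 1 x)"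
        by (rule quasi_optimality[OF _ _ W(2) rate])
          (use Y[OF 1] ub[OF 1] uh1 in \<open>auto simp: galerkin_def subset_iff\<close>)
      also have "nrm (\<lambda>x. ub 1 x - ub 1 x) = 0"
        using nrm_scale[OF zero_mem, of 0] by simp
      also have "(1 + stab * \<eta>) * 0 \<le> 2 * q / (1 - q) * \<delta> 1" if "q < 1"
        using that q best_approximation_nonneg[of "Y 1" u] Y[OF 1] u
        by (auto simp: \<delta> galerkin_def linear_set_def)
      finally show ?thesis
        using True Y[OF 1] W uh1 by (auto simp: nested_galerkin_def)
    next
      case False
      have k: "k \<in> {1..n}" "Suc k \<in> {2..n}" "Suc k \<in> {1..n}" using Suc.prems False by auto
      have Yk: "Y k \<subseteq> Y (Suc k)" using nested[OF k(2)] by simp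
      have IH: "nested_galerkin G W (Y k) (uh k)"
        "q < 1 \<Longrightarrow> nrm (\<lambda>x. ub k x - uh k x) \<le> 2 * q / (1 - q) * \<delta> k"
        using Suc.IH[OF k(1)] by auto
      obtain it where it0: "it 0 = uh k" and itp: "uh (Suc k) = it p"
        and it: "\<And>l. l < p \<Longrightarrow> mg_step G \<theta> W (Y (Suc k)) (it l) (it (Suc l))"
        using level[OF k(2)] by auto
      have lev: "nested_galerkin G W (Y (Suc k)) (it p) \<and>
          nrm (\<lambda>x. ub (Suc k) x - it p x) \<le> \<gamma>' ^ p * nrm (\<lambda>x. ub (Suc k) x - it 0 x)"
        unfolding \<gamma>'_def
        by (rule multigrid_level[OF _ _ W(1) WY[OF k(3)] rate \<theta> ub[OF k(3)]])
          (use Y[OF k(3)] it0 it nested_galerkin_mono[OF IH(1) Yk] in auto)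
      have "nrm (\<lambda>x. ub (Suc k) x - uh (Suc k) x) \<le> 2 * q / (1 - q) * \<delta> (Suc k)" if q1: "q < 1"
      proof -
        have V: "u \<in> V" "ub k \<in> V" "ub (Suc k) \<in> V" "uh k \<in> V"
          using u ub[OF k(1)] ub[OF k(3)] Y[OF k(1)] Y[OF k(3)] IH(1)
          by (auto simp: galerkin_def nested_galerkin_def)
        have best: "nrm (\<lambda>x. u x - ub j x) \<le> (1 + s) * \<delta> j" if "j \<in> {1..n}" for j
          unfolding s_def \<delta>
          by (rule galerkin_best_approximation[OF _ _ WY[OF that] rate u ub[OF that]])
            (use Y[OF that] in auto)
        \<comment> \<open>By nestedness both discretization errors can be expressed through the
          coarser \<open>\<delta> k\<close>. Their sum gives \<open>2 * \<delta> k\<close>, the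
          origin of the 2.\<close>
        have "\<delta> (Suc k) \<le> \<delta> k"
          unfolding \<delta> using Y[OF k(1)] Y[OF k(3)] Yk V
          by (intro best_approximation_antimono) (auto simp: linear_set_def)
        then have "(1 + s) * \<delta> (Suc k) \<le> (1 + s) * \<delta> k" using s by (intro mult_left_mono) auto
        then have "nrm (\<lambda>x. ub (Suc k) x - u x) \<le> (1 + s) * \<delta> k"
          using best[OF k(3)] nrm_diff_commute[OF V(1,3)] by simp
        moreover have "nrm (\<lambda>x. ub (Suc k) x - uh k x) \<le> nrm (\<lambda>x. ub (Suc k) x - u x)
            + (nrm (\<lambda>x. u x - ub k x) + nrm (\<lambda>x. ub k x - uh k x))"
          using nrm_diff_triangle[OF V(3,1,4)] nrm_diff_triangle[OF V(1,2,4)] by simp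
        ultimately have tri: "nrm (\<lambda>x. ub (Suc k) x - uh k x)
            \<le> (1 + s) * (2 * \<delta> k) + nrm (\<lambda>x. ub k x - uh k x)"
          using best[OF k(1)] by simp
        have \<delta>k: "0 \<le> \<delta> k"
          unfolding \<delta> using Y[OF k(1)] V by (intro best_approximation_nonneg) (auto simp: linear_set_def)
        have "nrm (\<lambda>x. ub (Suc k) x - uh (Suc k) x) \<le> \<gamma>' ^ p * nrm (\<lambda>x. ub (Suc k) x - uh k x)"
          using lev by (simp add: it0 itp)
        also have "\<dots> \<le> \<gamma>' ^ p * ((1 + s) * (2 * \<delta> k) + nrm (\<lambda>x. ub k x - uh k x))"
          using \<gamma>' by (intro mult_left_mono[OF tri]) auto
        also have "\<dots> = (\<gamma>' ^ p * (1 + s)) * (2 * \<delta> k) + \<gamma>' ^ p * nrm (\<lambda>x. ub k x - uh k x)"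
          by (simp add: algebra_simps)
        also have "\<dots> \<le> \<gamma> ^ p * (2 * \<delta> k) + \<gamma> ^ p * (2 * q / (1 - q) * \<delta> k)"
          using \<gamma> \<gamma>' \<delta>k nrm_nonneg[OF diff_mem[OF V(2,4)]]
          by (intro add_mono mult_right_mono mult_mono pow_s pow_le IH(2) q1) auto
        \<comment> \<open>\<open>2 * q / (1 - q)\<close> is the fixed point of
          \<open>x = q * (2 + x)\<close>, so the bound reproduces itself once \<open>decay\<close>
          trades \<open>\<delta> k\<close> for \<open>\<delta> (Suc k)\<close>.\<close>
        also have "\<dots> = 2 * \<gamma> ^ p / (1 - q) * \<delta> k"
          using q1 by (simp add: field_simps)
        also have "\<dots> \<le> 2 * \<gamma> ^ p / (1 - q) * (b * \<delta> (Suc k))"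
          using decay[OF k(2)] \<gamma> q1 by (intro mult_left_mono) auto
        also have "\<dots> = 2 * q / (1 - q) * \<delta> (Suc k)" by (simp add: q_def)
        finally show ?thesis .
      qed
      then show ?thesis using lev itp by simp
    qed
  qed auto
  have nn: "n \<in> {1..n}" using n by simp
  show "nrm (\<lambda>x. ub n x - uh n x) \<le> 2 * \<gamma> ^ p * b / (1 - \<gamma> ^ p * b) * \<delta> n" if "\<gamma> ^ p * b < 1"
    using key[OF nn] that by (simp add: q_def mult.assoc)
  have "P.nrm (\<lambda>x. ub n x - uh n x) \<le> s * nrm (\<lambda>x. ub n x - uh n x)"
    using nested_galerkin_L2(1)[OF _ rate ub[OF nn]] Y[OF nn] key[OF nn] by (simp add: s_def)
  also have "\<dots> \<le> C * \<eta> * nrm (\<lambda>x. ub n x - uh n x)"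
  proof (intro mult_right_mono s nrm_nonneg diff_mem)
    show "ub n \<in> V" "uh n \<in> V"
      using key[OF nn] ub[OF nn] Y[OF nn] by (auto simp: galerkin_def nested_galerkin_def)
  qed
  finally show "P.nrm (\<lambda>x. ub n x - uh n x) \<le> C * \<eta> * nrm (\<lambda>x. ub n x - uh n x)" .
qed

end

section \<open>The space of square integrable functions\<close>

lemma L2_mult_integrable:
  assumes "w \<in> L2 \<Omega>" "v \<in> L2 \<Omega>"
  shows "integrable (lebesgue_on \<Omega>) (\<lambda>x. w x * v x)"
proof (rule Bochner_Integration.integrable_bound)
  show "integrable (lebesgue_on \<Omega>) (\<lambda>x. (w x)\<^sup>2 + (v x)\<^sup>2)"
    using assms by (auto simp: L2_def)
  show "(\<lambda>x. w x * v x) \<in> borel_measurable (lebesgue_on \<Omega>)"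
    using assms by (auto simp: L2_def)
  have "\<bar>s * t\<bar> \<le> s\<^sup>2 + t\<^sup>2" for s t :: real
  proof -
    have "2 * (\<bar>s\<bar> * \<bar>t\<bar>) \<le> s\<^sup>2 + t\<^sup>2"
      using sum_squares_bound[of "\<bar>s\<bar>" "\<bar>t\<bar>"] by simp
    moreover have "0 \<le> s\<^sup>2 + t\<^sup>2" by simp
    ultimately have "\<bar>s\<bar> * \<bar>t\<bar> \<le> s\<^sup>2 + t\<^sup>2" by linarith
    then show ?thesis by (simp add: abs_mult)
  qed
  then show "AE x in lebesgue_on \<Omega>. norm (w x * v x) \<le> norm ((w x)\<^sup>2 + (v x)\<^sup>2)"
    by (intro AE_I2) simp
qed

interpretation L2: semi_inner "L2 \<Omega>" "ip0 \<Omega>" for \<Omega> :: "(real ^ 'd) set"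
proof
  have "(\<lambda>x. 0) \<in> L2 \<Omega>" by (simp add: L2_def)
  then show "L2 \<Omega> \<noteq> {}" by blast
next
  fix w v :: "real ^ 'd \<Rightarrow> real" and b c :: real
  assume w: "w \<in> L2 \<Omega>" and v: "v \<in> L2 \<Omega>"
  have "integrable (lebesgue_on \<Omega>) (\<lambda>x. b\<^sup>2 * (w x)\<^sup>2 + 2 * b * c * (w x * v x) + c\<^sup>2 * (v x)\<^sup>2)"
    using w v L2_mult_integrable[OF w v]
    by (intro Bochner_Integration.integrable_add integrable_mult_right) (auto simp: L2_def)
  then have "integrable (lebesgue_on \<Omega>) (\<lambda>x. (b * w x + c * v x)\<^sup>2)"
    by (simp add: power2_sum power_mult_distrib mult_ac add_ac)
  then show "(\<lambda>x. b * w x + c * v x) \<in> L2 \<Omega>"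
    using w v by (auto simp: L2_def)
  fix u assume u: "u \<in> L2 \<Omega>"
  have "ip0 \<Omega> (\<lambda>x. b * w x + c * v x) u = (LINT x|lebesgue_on \<Omega>. b * (w x * u x) + c * (v x * u x))"
    by (simp add: ip0_def algebra_simps)
  also have "\<dots> = b * ip0 \<Omega> w u + c * ip0 \<Omega> v u"
    using L2_mult_integrable[OF w u] L2_mult_integrable[OF v u] by (simp add: ip0_def)
  finally show "ip0 \<Omega> (\<lambda>x. b * w x + c * v x) u = b * ip0 \<Omega> w u + c * ip0 \<Omega> v u" .
next
  show "ip0 \<Omega> w v = ip0 \<Omega> v w" for w v by (simp add: ip0_def mult.commute)
  show "0 \<le> ip0 \<Omega> w w" for w by (simp add: ip0_def)
qed

lemma L2_nrm [simp]: "L2.nrm \<Omega> = norm0 \<Omega>"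
  by (rule ext) (simp add: L2.nrm_def norm0_def)

lemma norm0_nonneg: "0 \<le> norm0 \<Omega> w"
  by (simp add: norm0_def ip0_def)

lemma ip0_cong_AE:
  assumes "w \<in> L2 \<Omega>" "w' \<in> L2 \<Omega>" "v \<in> L2 \<Omega>" "v' \<in> L2 \<Omega>"
    and "AE x in lebesgue_on \<Omega>. w x = w' x" "AE x in lebesgue_on \<Omega>. v x = v' x"
  shows "ip0 \<Omega> w v = ip0 \<Omega> w' v'"
  unfolding ip0_def
proof (rule integral_cong_AE)
  show "AE x in lebesgue_on \<Omega>. w x * v x = w' x * v' x"
    using assms(5,6) by eventually_elim simp
qed (use assms in \<open>auto simp: L2_def\<close>)

lemma finite_measure_bounded_open:
  assumes "open \<Omega>" "bounded \<Omega>"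
  shows "finite_measure (lebesgue_on (\<Omega> :: (real ^ 'd) set))"
  using assms by (intro finite_measure_lebesgue_on bounded_set_imp_lmeasurable) auto

lemma L2_const:
  assumes "open \<Omega>" "bounded \<Omega>"
  shows "(\<lambda>x. c) \<in> L2 \<Omega>"
proof -
  interpret finite_measure "lebesgue_on \<Omega>" by (rule finite_measure_bounded_open[OF assms])
  show ?thesis by (simp add: L2_def)
qed

lemma L2_abs: "w \<in> L2 \<Omega> \<Longrightarrow> (\<lambda>x. \<bar>w x\<bar>) \<in> L2 \<Omega>"
  by (auto simp: L2_def intro: borel_measurable_abs)

lemma L2_integral_abs_le:
  assumes "open \<Omega>" "bounded \<Omega>" "w \<in> L2 \<Omega>"
  shows "(LINT x|lebesgue_on \<Omega>. \<bar>w x\<bar>) \<le> norm0 \<Omega> w * norm0 \<Omega> (\<lambda>x. 1)"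
  using L2.Cauchy_Schwarz[OF L2_abs[OF assms(3)] L2_const[OF assms(1,2), of 1]]
  by (simp add: ip0_def norm0_def)

lemma L2_integrable:
  assumes "open \<Omega>" "bounded \<Omega>" "w \<in> L2 \<Omega>"
  shows "integrable (lebesgue_on \<Omega>) w"
  using L2_mult_integrable[OF assms(3) L2_const[OF assms(1,2), of 1]] by simp

text \<open>Meant for the differences \<open>X m - X (r i)\<close>, whose norms are uniformly small
  but for which no common majorant is at hand. Membership in \<open>L2\<close> is part of the
  conclusion because only measurability of the limit is known beforehand.\<close>

lemma L2_Fatou:
  assumes Y: "\<And>i. Y i \<in> L2 \<Omega>" and bound: "\<And>i. norm0 \<Omega> (Y i) \<le> e"
    and meas: "w \<in> borel_measurable (lebesgue_on \<Omega>)"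
    and lim: "AE x in lebesgue_on \<Omega>. (\<lambda>i. Y i x) \<longlonglongrightarrow> w x"
  shows "w \<in> L2 \<Omega> \<and> norm0 \<Omega> w \<le> e"
proof -
  have e: "0 \<le> e" using bound norm0_nonneg order_trans by blast
  have Ym [measurable]: "Y i \<in> borel_measurable (lebesgue_on \<Omega>)" for i
    using Y by (simp add: L2_def)
  note [measurable] = meas
  have le: "(\<integral>\<^sup>+x. ennreal ((Y i x)\<^sup>2) \<partial>lebesgue_on \<Omega>) \<le> ennreal (e\<^sup>2)" for i
  proof -
    have "(\<integral>\<^sup>+x. ennreal ((Y i x)\<^sup>2) \<partial>lebesgue_on \<Omega>) = ennreal (LINT x|lebesgue_on \<Omega>. (Y i x)\<^sup>2)"
      using Y[of i] by (intro nn_integral_eq_integral) (auto simp: L2_def)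
    also have "(LINT x|lebesgue_on \<Omega>. (Y i x)\<^sup>2) = (norm0 \<Omega> (Y i))\<^sup>2"
      by (simp add: norm0_def ip0_def power2_eq_square)
    also have "\<dots> \<le> e\<^sup>2" using bound norm0_nonneg by (intro power_mono)
    finally show ?thesis by (simp add: ennreal_leI)
  qed
  have "(\<integral>\<^sup>+x. ennreal ((w x)\<^sup>2) \<partial>lebesgue_on \<Omega>)
      = (\<integral>\<^sup>+x. liminf (\<lambda>i. ennreal ((Y i x)\<^sup>2)) \<partial>lebesgue_on \<Omega>)"
  proof (rule nn_integral_cong_AE)
    show "AE x in lebesgue_on \<Omega>. ennreal ((w x)\<^sup>2) = liminf (\<lambda>i. ennreal ((Y i x)\<^sup>2))"
      using lim
    proof eventually_elim
      case (elim x)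
      then have "(\<lambda>i. ennreal ((Y i x)\<^sup>2)) \<longlonglongrightarrow> ennreal ((w x)\<^sup>2)"
        by (intro tendsto_ennrealI tendsto_power)
      from lim_imp_Liminf[OF sequentially_bot this] show ?case by (rule HOL.sym)
    qed
  qed
  also have "\<dots> \<le> liminf (\<lambda>i. \<integral>\<^sup>+x. ennreal ((Y i x)\<^sup>2) \<partial>lebesgue_on \<Omega>)"
    by (rule nn_integral_liminf) measurable
  also have "\<dots> \<le> liminf (\<lambda>i. ennreal (e\<^sup>2))"
    by (intro Liminf_mono always_eventually allI le)
  also have "\<dots> = ennreal (e\<^sup>2)" by (simp add: Liminf_const)
  finally have nn: "(\<integral>\<^sup>+x. ennreal ((w x)\<^sup>2) \<partial>lebesgue_on \<Omega>) \<le> ennreal (e\<^sup>2)" .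
  have int: "integrable (lebesgue_on \<Omega>) (\<lambda>x. (w x)\<^sup>2)"
    by (rule integrableI_nonneg) (use nn in \<open>auto intro: order_le_less_trans\<close>)
  then have L2: "w \<in> L2 \<Omega>" using meas by (simp add: L2_def)
  have "(norm0 \<Omega> w)\<^sup>2 = (LINT x|lebesgue_on \<Omega>. (w x)\<^sup>2)"
    by (simp add: norm0_def ip0_def power2_eq_square)
  moreover have "ennreal (LINT x|lebesgue_on \<Omega>. (w x)\<^sup>2) \<le> ennreal (e\<^sup>2)"
    using nn nn_integral_eq_integral[OF int] by simp
  ultimately have "(norm0 \<Omega> w)\<^sup>2 \<le> e\<^sup>2" by (simp add: ennreal_le_iff)
  then show ?thesis using L2 e by (auto intro: power2_le_imp_le)
qed

text \<open>Riesz--Fischer: an \<open>L\<^sup>1\<close>-Cauchy subsequence converges almost everywhere, and Fatou's lemma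
  upgrades this to convergence in the norm.\<close>

lemma L2_complete:
  assumes \<Omega>: "open \<Omega>" "bounded \<Omega>" and X: "\<And>n. X n \<in> L2 \<Omega>"
    and cauchy: "\<And>e. e > 0 \<Longrightarrow> \<exists>N. \<forall>i\<ge>N. \<forall>j\<ge>N. norm0 \<Omega> (\<lambda>x. X i x - X j x) < e"
  shows "\<exists>w\<in>L2 \<Omega>. (\<lambda>n. norm0 \<Omega> (\<lambda>x. X n x - w x)) \<longlonglongrightarrow> 0"
proof -
  have Xm [measurable]: "X i \<in> borel_measurable (lebesgue_on \<Omega>)" for i
    using X by (simp add: L2_def)
  \<comment> \<open>Cauchy-Schwarz against the constant 1 turns \<open>L2\<close> smallness into
    \<open>L1\<close> smallness; adding 1 keeps \<open>c\<close> positive even if \<Omega> is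
    empty.\<close>
  define c where "c = norm0 \<Omega> (\<lambda>x. 1) + 1"
  have c: "0 < c" using norm0_nonneg[of \<Omega> "\<lambda>x. 1"] by (simp add: c_def)
  have L1: "\<exists>N. \<forall>i\<ge>N. \<forall>j\<ge>N. (LINT x|lebesgue_on \<Omega>. norm (X i x - X j x)) < e" if "e > 0" for e
  proof -
    obtain N where N: "\<And>i j. i \<ge> N \<Longrightarrow> j \<ge> N \<Longrightarrow> norm0 \<Omega> (\<lambda>x. X i x - X j x) < e / c"
      using cauchy[of "e / c"] c \<open>e > 0\<close> by auto
    have "(LINT x|lebesgue_on \<Omega>. norm (X i x - X j x)) < e" if "i \<ge> N" "j \<ge> N" for i j
    proof -
      have "(LINT x|lebesgue_on \<Omega>. norm (X i x - X j x)) \<le> norm0 \<Omega> (\<lambda>x. X i x - X j x) * norm0 \<Omega> (\<lambda>x. 1)"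
        using L2_integral_abs_le[OF \<Omega> L2.diff_mem[OF X X]] by simp
      also have "\<dots> \<le> norm0 \<Omega> (\<lambda>x. X i x - X j x) * c"
        by (intro mult_left_mono norm0_nonneg) (simp add: c_def)
      also have "\<dots> < e" using N[OF that] c by (simp add: field_simps)
      finally show ?thesis .
    qed
    then show ?thesis by blast
  qed
  obtain r where r: "strict_mono r" and ae: "AE x in lebesgue_on \<Omega>. Cauchy (\<lambda>i. X (r i) x)"
    using cauchy_L1_AE_cauchy_subseq[OF L2_integrable[OF \<Omega> X] L1] by blast
  define w where "w x = lim (\<lambda>i. X (r i) x)" for x
  have w [measurable]: "w \<in> borel_measurable (lebesgue_on \<Omega>)"
    unfolding w_def by (rule borel_measurable_lim_metric) measurable
  have lim: "AE x in lebesgue_on \<Omega>. (\<lambda>i. X (r i) x) \<longlonglongrightarrow> w x"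
    using ae by eventually_elim (simp add: w_def Cauchy_convergent convergent_LIMSEQ_iff[symmetric])
  have close: "\<exists>N. \<forall>m\<ge>N. (\<lambda>x. X m x - w x) \<in> L2 \<Omega> \<and> norm0 \<Omega> (\<lambda>x. X m x - w x) \<le> e" if e: "e > 0" for e
  proof -
    obtain N where N: "\<And>i j. i \<ge> N \<Longrightarrow> j \<ge> N \<Longrightarrow> norm0 \<Omega> (\<lambda>x. X i x - X j x) < e"
      using cauchy[OF e] by auto
    have "(\<lambda>x. X m x - w x) \<in> L2 \<Omega> \<and> norm0 \<Omega> (\<lambda>x. X m x - w x) \<le> e" if m: "m \<ge> N" for m
    proof (rule L2_Fatou)
      show "(\<lambda>x. X m x - X (r (i + N)) x) \<in> L2 \<Omega>" for i by (rule L2.diff_mem[OF X X])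
      show "norm0 \<Omega> (\<lambda>x. X m x - X (r (i + N)) x) \<le> e" for i
        using N[OF m, of "r (i + N)"] seq_suble[OF r, of "i + N"] by simp
      show "AE x in lebesgue_on \<Omega>. (\<lambda>i. X m x - X (r (i + N)) x) \<longlonglongrightarrow> X m x - w x"
        using lim
      proof eventually_elim
        case (elim x)
        then have "(\<lambda>i. X (r (i + N)) x) \<longlonglongrightarrow> w x" by (rule LIMSEQ_ignore_initial_segment)
        then show ?case by (intro tendsto_intros)
      qed
    qed measurable
    then show ?thesis by blast
  qed
  \<comment> \<open>So far only differences with \<open>w\<close> are known to lie in
    \<open>L2\<close>; one of them recovers \<open>w\<close> itself.\<close>
  obtain N where "(\<lambda>x. X N x - w x) \<in> L2 \<Omega>" using close[of 1] by auto
  from L2.diff_mem[OF X[of N] this] have "w \<in> L2 \<Omega>" by simp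
  moreover have "(\<lambda>n. norm0 \<Omega> (\<lambda>x. X n x - w x)) \<longlonglongrightarrow> 0"
  proof (rule LIMSEQ_I)
    fix e :: real assume "0 < e"
    then obtain N where "\<forall>m\<ge>N. norm0 \<Omega> (\<lambda>x. X m x - w x) \<le> e / 2" using close[of "e / 2"] by auto
    then have "norm0 \<Omega> (\<lambda>x. X m x - w x) < e" if "m \<ge> N" for m using that \<open>0 < e\<close> by fastforce
    then show "\<exists>N. \<forall>n\<ge>N. norm (norm0 \<Omega> (\<lambda>x. X n x - w x) - 0) < e"
      by (intro exI[of _ N]) (auto simp: abs_of_nonneg[OF norm0_nonneg])
  qed
  ultimately show ?thesis by blast
qed

section \<open>Test functions\<close>

lemma has_derivative_partial:
  "\<phi> differentiable (at x) \<Longrightarrow> (\<phi> has_derivative frechet_derivative \<phi> (at x)) (at x)"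
  by (simp add: frechet_derivative_works)

lemma partial_eqI: "(\<phi> has_derivative D) (at x) \<Longrightarrow> partial i \<phi> x = D (axis i 1)"
  using frechet_derivative_at[of \<phi> D x] by (simp add: partial_def)

lemma Ck_imp_continuous: "Ck k \<phi> \<Longrightarrow> continuous_on UNIV \<phi>"
  by (cases k) (auto intro!: differentiable_imp_continuous_on simp: differentiable_on_def)

lemma Ck_SucD: "Ck (Suc k) \<phi> \<Longrightarrow> Ck k \<phi>"
proof (induction k arbitrary: \<phi>)
  case 0
  then show ?case by (auto intro!: differentiable_imp_continuous_on simp: differentiable_on_def)
next
  case (Suc k)
  from Suc.prems have d: "\<And>x. \<phi> differentiable (at x)" and p: "\<And>i. Ck (Suc k) (partial i \<phi>)"
    by (simp_all only: Ck.simps(2)[of "Suc k"])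
  show ?case using d Suc.IH[OF p] by simp
qed

lemma partial_comb:
  assumes "\<phi> differentiable (at x)" "\<psi> differentiable (at x)"
  shows "partial i (\<lambda>x. b * \<phi> x + c * \<psi> x) x = b * partial i \<phi> x + c * partial i \<psi> x"
proof -
  have "((\<lambda>x. b * \<phi> x + c * \<psi> x) has_derivative
      (\<lambda>h. b * frechet_derivative \<phi> (at x) h + c * frechet_derivative \<psi> (at x) h)) (at x)"
    using assms by (intro has_derivative_add has_derivative_mult_right has_derivative_partial)
  from partial_eqI[OF this] show ?thesis by (simp add: partial_def)
qed

lemma partial_mult:
  assumes "\<phi> differentiable (at x)" "\<psi> differentiable (at x)"
  shows "partial i (\<lambda>x. \<phi> x * \<psi> x) x = \<phi> x * partial i \<psi> x + partial i \<phi> x * \<psi> x"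
proof -
  have "((\<lambda>x. \<phi> x * \<psi> x) has_derivative
      (\<lambda>h. \<phi> x * frechet_derivative \<psi> (at x) h + frechet_derivative \<phi> (at x) h * \<psi> x)) (at x)"
    using assms by (intro has_derivative_mult has_derivative_partial)
  from partial_eqI[OF this] show ?thesis by (simp add: partial_def)
qed

lemma Ck_comb: "Ck k \<phi> \<Longrightarrow> Ck k \<psi> \<Longrightarrow> Ck k (\<lambda>x. b * \<phi> x + c * \<psi> x)"
proof (induction k arbitrary: \<phi> \<psi>)
  case 0
  then show ?case by (auto intro!: continuous_intros)
next
  case (Suc k)
  then have "partial i (\<lambda>x. b * \<phi> x + c * \<psi> x) = (\<lambda>x. b * partial i \<phi> x + c * partial i \<psi> x)" for i
    by (intro ext partial_comb) auto
  then show ?case using Suc by (auto intro!: derivative_intros)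
qed

lemma Ck_mult: "Ck k \<phi> \<Longrightarrow> Ck k \<psi> \<Longrightarrow> Ck k (\<lambda>x. \<phi> x * \<psi> x)"
proof (induction k arbitrary: \<phi> \<psi>)
  case 0
  then show ?case by (auto intro!: continuous_intros)
next
  case (Suc k)
  then have eq: "partial i (\<lambda>x. \<phi> x * \<psi> x) = (\<lambda>x. 1 * (\<phi> x * partial i \<psi> x) + 1 * (partial i \<phi> x * \<psi> x))" for i
    by (auto intro!: ext simp: partial_mult)
  have "Ck k (partial i (\<lambda>x. \<phi> x * \<psi> x))" for i
    unfolding eq using Suc.prems by (intro Ck_comb Suc.IH Ck_SucD[OF Suc.prems(1)] Ck_SucD[OF Suc.prems(2)]) auto
  then show ?case using Suc.prems by (auto intro!: derivative_intros)
qed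

lemma Ck_const: "Ck k (\<lambda>x :: real ^ 'd. c)"
proof (induction k arbitrary: c)
  case (Suc k)
  have "partial i (\<lambda>x :: real ^ 'd. c) = (\<lambda>x. 0)" for i c
    by (rule ext, subst partial_eqI[where D = "\<lambda>h. 0"]) (auto intro: has_derivative_const)
  then show ?case using Suc by simp
qed simp

lemma Ck_component: "Ck k (\<lambda>x :: real ^ 'd. x $ j)"
proof (cases k)
  case (Suc k')
  have D: "((\<lambda>x. x $ j) has_derivative (\<lambda>h. h $ j)) (at x)" for x :: "real ^ 'd"
    by (rule bounded_linear.has_derivative[OF bounded_linear_vec_nth has_derivative_ident])
  have "partial i (\<lambda>x :: real ^ 'd. x $ j) = (\<lambda>x. axis i 1 $ j)" for i
    by (rule ext) (rule partial_eqI[OF D])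
  then show ?thesis using Suc D by (auto simp: Ck_const differentiable_def)
qed (auto intro!: continuous_intros)

lemma Ck_prod:
  assumes "finite S" "\<And>i. i \<in> S \<Longrightarrow> Ck k (\<phi> i)"
  shows "Ck k (\<lambda>x. \<Prod>i\<in>S. \<phi> i x)"
  using assms by (induction S rule: finite_induct) (auto simp: Ck_const Ck_mult)

section \<open>Smooth bump functions on boxes\<close>

text \<open>The powers of \<open>1/t\<close> make the family closed under differentiation.\<close>

definition flat :: "nat \<Rightarrow> real \<Rightarrow> real" where
  "flat m t = (if t > 0 then exp (- 1 / t) / t ^ m else 0)"

lemma flat_nonneg: "0 \<le> flat m t"
  by (simp add: flat_def)

text \<open>Keeps the term of order \<open>m + 2\<close> in the series of
  \<open>exp (1 / t)\<close>. Of its powers, \<open>m\<close> cancel the denominator and two remain,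
  so that the difference quotient at 0 tends to 0.\<close>

lemma flat_le: "flat m t \<le> fact (m + 2) * t\<^sup>2" if "t > 0"
proof -
  have "(1 / t) ^ (m + 2) / fact (m + 2) \<le> exp (1 / t)"
  proof -
    have "(\<Sum>n<Suc (m + 2). inverse (fact n) *\<^sub>R (1 / t) ^ n) \<le> exp (1 / t)"
      unfolding exp_def by (rule sum_le_suminf) (use that summable_exp_generic[of "1 / t"] in auto)
    moreover have "inverse (fact (m + 2)) *\<^sub>R (1 / t) ^ (m + 2)
        \<le> (\<Sum>n<Suc (m + 2). inverse (fact n) *\<^sub>R (1 / t) ^ n)"
      by (rule member_le_sum[where f = "\<lambda>n. inverse (fact n) *\<^sub>R (1 / t) ^ n"]) (use that in auto)
    ultimately have "inverse (fact (m + 2)) *\<^sub>R (1 / t) ^ (m + 2) \<le> exp (1 / t)" by (rule order_trans[rotated])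
    then show ?thesis by (simp only: real_scaleR_def divide_inverse mult.commute[of "inverse (fact _)"])
  qed
  then have "1 \<le> exp (1 / t) * fact (m + 2) * t ^ (m + 2)"
    using that by (simp add: power_divide divide_le_eq mult_ac del: fact_Suc power_Suc add_2_eq_Suc')
  then have "exp (- (1 / t)) * 1 \<le> exp (- (1 / t)) * (exp (1 / t) * fact (m + 2) * t ^ (m + 2))"
    by (intro mult_left_mono) auto
  also have "\<dots> = fact (m + 2) * t ^ (m + 2)"
    by (simp only: mult.assoc[symmetric] exp_add[symmetric]) simp
  finally show ?thesis
    using that by (simp add: flat_def divide_le_eq power_add mult_ac power2_eq_square del: fact_Suc)
qed

lemma flat_has_derivative: "(flat m has_real_derivative flat (m + 2) t - m * flat (m + 1) t) (at t)"
proof (cases t "0 :: real" rule: linorder_cases)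
  case less
  have "((\<lambda>_. 0) has_real_derivative 0) (at t)" by simp
  then have "(flat m has_real_derivative 0) (at t)"
    by (rule has_field_derivative_transform_within_open[of _ _ _ "{..<0}"]) (use less in \<open>auto simp: flat_def\<close>)
  then show ?thesis using less by (simp add: flat_def)
next
  case greater
  have "((\<lambda>t. exp (- 1 / t) / t ^ m) has_real_derivative
      (exp (- 1 / t) * (1 / t\<^sup>2) * t ^ m - exp (- 1 / t) * (m * t ^ (m - 1))) / (t ^ m * t ^ m)) (at t)"
    using greater by (auto intro!: derivative_eq_intros simp: power2_eq_square)
  also have "(exp (- 1 / t) * (1 / t\<^sup>2) * t ^ m - exp (- 1 / t) * (m * t ^ (m - 1))) / (t ^ m * t ^ m)
      = flat (m + 2) t - m * flat (m + 1) t"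
    using greater by (cases m) (auto simp: flat_def field_simps power2_eq_square)
  finally show ?thesis
    by (rule has_field_derivative_transform_within_open[of _ _ _ "{0<..}"]) (use greater in \<open>auto simp: flat_def\<close>)
next
  case equal
  have "((\<lambda>h. (flat m (0 + h) - flat m 0) / h) \<longlongrightarrow> 0) (at 0)"
  proof (rule Lim_null_comparison)
    show "((\<lambda>h::real. fact (m + 2) * \<bar>h\<bar>) \<longlongrightarrow> 0) (at 0)"
      by (auto intro!: tendsto_eq_intros)
    have "norm ((flat m (0 + h) - flat m 0) / h) \<le> fact (m + 2) * \<bar>h\<bar>" for h
    proof (cases "h > 0")
      case True
      then show ?thesis
        using flat_le[OF True, of m] flat_nonneg[of m h]
        by (simp add: flat_def[of m 0] divide_le_eq power2_eq_square mult_ac del: fact_Suc)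
    next
      case False
      then have "(flat m (0 + h) - flat m 0) / h = 0" by (simp add: flat_def)
      moreover have "0 \<le> fact (m + 2) * \<bar>h\<bar>" by (intro mult_nonneg_nonneg fact_ge_zero abs_ge_zero)
      ultimately show ?thesis by (simp only: norm_zero)
    qed
    then show "\<forall>\<^sub>F h in at 0. norm ((flat m (0 + h) - flat m 0) / h) \<le> fact (m + 2) * \<bar>h\<bar>"
      by simp
  qed
  then have "(flat m has_real_derivative 0) (at 0)" by (simp add: DERIV_def)
  then show ?thesis using equal by (simp add: flat_def)
qed

lemma Ck_flat:
  assumes "\<And>k. Ck k q"
  shows "Ck k (\<lambda>x. flat m (q x))"
proof (induction k arbitrary: m)
  case 0
  have "continuous_on UNIV (flat m)"
    using flat_has_derivative
    by (intro differentiable_imp_continuous_on)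
      (auto simp: differentiable_on_def real_differentiable_def intro!: exI)
  then show ?case using assms[of 0] by (auto intro: continuous_on_compose2)
next
  case (Suc k)
  have q: "q differentiable (at x)" "Ck k (partial i q)" for x i using assms[of "Suc k"] by auto
  have D: "((\<lambda>x. flat m (q x)) has_derivative
      (\<lambda>h. frechet_derivative q (at x) h * (flat (m + 2) (q x) - m * flat (m + 1) (q x)))) (at x)" for x
    by (rule DERIV_compose_FDERIV[OF flat_has_derivative has_derivative_partial[OF q(1)]])
  have eq: "partial i (\<lambda>x. flat m (q x))
      = (\<lambda>x. partial i q x * (1 * flat (m + 2) (q x) + (- real m) * flat (m + 1) (q x)))" for i
    by (rule ext, subst partial_eqI[OF D]) (simp add: partial_def)
  have "Ck k (partial i (\<lambda>x. flat m (q x)))" for i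
    unfolding eq by (intro Ck_mult Ck_comb Suc.IH q)
  then show ?case using D by (auto simp: differentiable_def)
qed

lemma test_function_comb:
  assumes "\<phi> \<in> test_functions \<Omega>" "\<psi> \<in> test_functions \<Omega>"
  shows "(\<lambda>x. b * \<phi> x + c * \<psi> x) \<in> test_functions \<Omega>"
proof -
  obtain K L where "compact K" "K \<subseteq> \<Omega>" "\<And>x. x \<notin> K \<Longrightarrow> \<phi> x = 0"
    "compact L" "L \<subseteq> \<Omega>" "\<And>x. x \<notin> L \<Longrightarrow> \<psi> x = 0"
    using assms by (auto simp: test_functions_def)
  then show ?thesis
    using assms by (auto simp: test_functions_def Ck_comb intro!: exI[of _ "K \<union> L"])
qed

lemma test_function_mult:
  assumes "\<phi> \<in> test_functions \<Omega>" "\<psi> \<in> test_functions \<Omega>"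
  shows "(\<lambda>x. \<phi> x * \<psi> x) \<in> test_functions \<Omega>"
proof -
  obtain K where "compact K" "K \<subseteq> \<Omega>" "\<And>x. x \<notin> K \<Longrightarrow> \<phi> x = 0"
    using assms by (auto simp: test_functions_def)
  then show ?thesis
    using assms by (auto simp: test_functions_def Ck_mult intro!: exI[of _ K])
qed

lemma test_function_differentiable: "\<phi> \<in> test_functions \<Omega> \<Longrightarrow> \<phi> differentiable (at x)"
  unfolding test_functions_def by (auto dest: spec[of _ "Suc 0"])

lemma test_function_partial:
  assumes "\<phi> \<in> test_functions \<Omega>"
  shows "partial i \<phi> \<in> test_functions \<Omega>"
proof -
  obtain K where K: "compact K" "K \<subseteq> \<Omega>" and zero: "\<And>x. x \<notin> K \<Longrightarrow> \<phi> x = 0"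
    using assms by (auto simp: test_functions_def)
  have "partial i \<phi> x = 0" if "x \<notin> K" for x
  proof -
    have "((\<lambda>x. 0) has_derivative (\<lambda>h. 0)) (at x)" by (rule has_derivative_const)
    then have "(\<phi> has_derivative (\<lambda>h. 0)) (at x)"
      by (rule has_derivative_transform_within_open[of _ _ _ _ "- K"])
        (use that zero K compact_imp_closed in auto)
    then show ?thesis using partial_eqI by fastforce
  qed
  moreover have "Ck k (partial i \<phi>)" for k
    using assms by (auto simp: test_functions_def dest: spec[of _ "Suc k"])
  ultimately show ?thesis using K by (auto simp: test_functions_def)
qed

lemma test_function_continuous: "\<phi> \<in> test_functions \<Omega> \<Longrightarrow> continuous_on UNIV \<phi>"
  using Ck_imp_continuous unfolding test_functions_def by blast

lemma zero_test_function: "(\<lambda>x. 0) \<in> test_functions \<Omega>"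
  by (auto simp: test_functions_def Ck_const)

lemma test_function_bounded:
  assumes "\<phi> \<in> test_functions \<Omega>"
  shows "\<exists>M. \<forall>x. \<bar>\<phi> x\<bar> \<le> M"
proof -
  obtain K where K: "compact K" "K \<subseteq> \<Omega>" and zero: "\<And>x. x \<notin> K \<Longrightarrow> \<phi> x = 0"
    using assms by (auto simp: test_functions_def)
  have "compact (\<phi> ` K)"
    using K test_function_continuous[OF assms] by (meson compact_continuous_image continuous_on_subset subset_UNIV)
  then obtain M where "\<And>x. x \<in> K \<Longrightarrow> \<bar>\<phi> x\<bar> \<le> M"
    using compact_imp_bounded[of "\<phi> ` K"] by (auto simp: bounded_iff)
  then have "\<bar>\<phi> x\<bar> \<le> max M 0" for x using zero[of x] by (cases "x \<in> K") fastforce+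
  then show ?thesis by blast
qed

lemma test_function_integrable:
  assumes "\<phi> \<in> test_functions \<Omega>"
  shows "integrable lborel \<phi>"
proof -
  obtain K where K: "compact K" "K \<subseteq> \<Omega>" and zero: "\<And>x. x \<notin> K \<Longrightarrow> \<phi> x = 0"
    using assms by (auto simp: test_functions_def)
  have "integrable lborel (\<lambda>x. indicator K x *\<^sub>R \<phi> x)"
    using K(1) test_function_continuous[OF assms] by (intro borel_integrable_compact) (auto intro: continuous_on_subset)
  also have "(\<lambda>x. indicator K x *\<^sub>R \<phi> x) = \<phi>" using zero by (auto simp: indicator_def fun_eq_iff)
  finally show ?thesis .
qed

lemma test_function_L2:
  assumes "open \<Omega>" "\<phi> \<in> test_functions \<Omega>"
  shows "\<phi> \<in> L2 \<Omega>"
proof -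
  have \<Omega>: "\<Omega> \<inter> space lebesgue \<in> sets lebesgue" using assms(1) by auto
  have "\<phi> \<in> borel_measurable borel"
    using test_function_continuous[OF assms(2)] by (rule borel_measurable_continuous_onI)
  then have "\<phi> \<in> borel_measurable lebesgue" by (simp add: borel_measurable_if_I measurable_completion)
  moreover have "integrable lebesgue (\<lambda>x. indicator \<Omega> x *\<^sub>R (\<phi> x)\<^sup>2)"
  proof (rule integrable_mult_indicator)
    have "integrable lborel (\<lambda>x. \<phi> x * \<phi> x)"
      by (rule test_function_integrable[OF test_function_mult[OF assms(2,2)]])
    then show "integrable lebesgue (\<lambda>x. (\<phi> x)\<^sup>2)"
      by (subst integrable_completion) (auto simp: power2_eq_square)
  qed (use assms in auto)
  ultimately show ?thesis
    using integrable_restrict_space[OF \<Omega>, of "\<lambda>x. (\<phi> x)\<^sup>2"]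
    by (auto simp: L2_def intro: measurable_restrict_space1)
qed

text \<open>Moves integrals to the whole space, where translation invariance is available.\<close>

lemma test_function_integral:
  assumes "open \<Omega>" "\<phi> \<in> test_functions \<Omega>"
  shows "(LINT x|lebesgue_on \<Omega>. \<phi> x) = (LINT x|lborel. \<phi> x)"
proof -
  have "(\<lambda>x. indicator \<Omega> x *\<^sub>R \<phi> x) = \<phi>"
    using assms(2) by (auto simp: test_functions_def indicator_def fun_eq_iff)
  then have "(LINT x|lebesgue_on \<Omega>. \<phi> x) = (LINT x|lebesgue. \<phi> x)"
    using assms(1) by (subst integral_restrict_space) auto
  also have "\<dots> = (LINT x|lborel. \<phi> x)"
    using test_function_integrable[OF assms(2)] by (intro integral_completion) auto
  finally show ?thesis .
qed

text \<open>Inside the open box each factor is \<open>exp (- 1 / t)\<close> with \<open>t\<close>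
  growing linearly in \<open>Suc n\<close>, so the product tends to 1 there while staying 0 outside.
  The argument is symmetric in \<open>a\<close> and \<open>b\<close>, which is why later lemmas
  require \<open>a $ i \<le> b $ i\<close>.\<close>

definition bump :: "real ^ 'd \<Rightarrow> real ^ 'd \<Rightarrow> nat \<Rightarrow> 'd::finite rfun" where
  "bump a b n x = (\<Prod>i\<in>UNIV. flat 0 (real (Suc n) * ((x $ i - a $ i) * (b $ i - x $ i))))"

lemma flat_0_le_1: "flat 0 t \<le> 1"
  by (simp add: flat_def)

lemma bump_bounds: "0 \<le> bump a b n x" "bump a b n x \<le> 1"
  unfolding bump_def by (auto intro!: prod_nonneg prod_le_1 flat_nonneg flat_0_le_1)

lemma bump_eq_0:
  assumes "\<And>i. a $ i \<le> b $ i" "x \<notin> box a b"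
  shows "bump a b n x = 0"
proof -
  obtain i where i: "x $ i \<le> a $ i \<or> b $ i \<le> x $ i"
    using assms(2) by (auto simp: mem_box_cart not_less)
  have "(x $ i - a $ i) * (b $ i - x $ i) \<le> 0"
    using i assms(1)[of i] by (auto simp: mult_le_0_iff)
  then have "\<not> 0 < real (Suc n) * ((x $ i - a $ i) * (b $ i - x $ i))"
    using mult_nonneg_nonpos[of "real (Suc n)"] by (simp add: not_less)
  then have "flat 0 (real (Suc n) * ((x $ i - a $ i) * (b $ i - x $ i))) = 0"
    unfolding flat_def by (rule if_not_P)
  then show ?thesis unfolding bump_def by (intro prod_zero) auto
qed

lemma bump_test_function:
  assumes "\<And>i. a $ i \<le> b $ i" "cbox a b \<subseteq> \<Omega>"
  shows "bump a b n \<in> test_functions \<Omega>"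
proof -
  have "Ck k (\<lambda>x. real (Suc n) * ((1 * x $ i + (- a $ i) * 1) * ((- 1) * x $ i + b $ i * 1)))" for k i
    by (intro Ck_mult Ck_comb Ck_const Ck_component)
  then have "Ck k (\<lambda>x. real (Suc n) * ((x $ i - a $ i) * (b $ i - x $ i)))" for k i
    by simp
  then have "Ck k (bump a b n)" for k
    unfolding bump_def[abs_def] by (intro Ck_prod Ck_flat) auto
  moreover have "bump a b n x = 0" if "x \<notin> cbox a b" for x
    using bump_eq_0[OF assms(1)] that box_subset_cbox by blast
  ultimately show ?thesis
    using assms(2) by (auto simp: test_functions_def intro!: exI[of _ "cbox a b"])
qed

lemma bump_tendsto:
  assumes "\<And>i. a $ i \<le> b $ i"
  shows "(\<lambda>n. bump a b n x) \<longlonglongrightarrow> indicator (box a b) x"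
proof (cases "x \<in> box a b")
  case True
  have "(\<lambda>n. flat 0 (real (Suc n) * t)) \<longlonglongrightarrow> 1" if "t > 0" for t
  proof -
    have "(\<lambda>n. exp (- (inverse (real (Suc n)) * (1 / t)))) \<longlonglongrightarrow> exp (- (0 * (1 / t)))"
      by (intro tendsto_intros LIMSEQ_inverse_real_of_nat)
    moreover have "flat 0 (real (Suc n) * t) = exp (- (inverse (real (Suc n)) * (1 / t)))" for n
      using that by (simp add: flat_def field_simps del: of_nat_Suc)
    ultimately show ?thesis by simp
  qed
  then have "(\<lambda>n. bump a b n x) \<longlonglongrightarrow> (\<Prod>i\<in>(UNIV :: 'a set). 1)"
    unfolding bump_def using True by (intro tendsto_prod) (auto simp: mem_box_cart)
  then show ?thesis using True by simp
qed (simp add: bump_eq_0 assms)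

section \<open>Fundamental lemma of the calculus of variations\<close>

lemma integral_box_eq_0:
  assumes h: "integrable (lebesgue_on \<Omega>) h" and \<Omega>: "open \<Omega>"
    and zero: "\<And>\<phi>. \<phi> \<in> test_functions \<Omega> \<Longrightarrow> (LINT x|lebesgue_on \<Omega>. h x * \<phi> x) = 0"
    and ab: "\<And>i. a $ i \<le> b $ i" "cbox a b \<subseteq> \<Omega>"
  shows "(LINT x|lebesgue_on \<Omega>. h x * indicator (box a b) x) = 0"
proof -
  have "(\<lambda>n. LINT x|lebesgue_on \<Omega>. h x * bump a b n x)
      \<longlonglongrightarrow> (LINT x|lebesgue_on \<Omega>. h x * indicator (box a b) x)"
  proof (rule integral_dominated_convergence)
    have m: "h \<in> borel_measurable (lebesgue_on \<Omega>)" using h by auto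
    show "(\<lambda>x. h x * indicator (box a b) x) \<in> borel_measurable (lebesgue_on \<Omega>)"
      using m \<Omega> order_trans[OF box_subset_cbox ab(2)]
      by (intro borel_measurable_times borel_measurable_indicator) (auto simp: sets_restrict_space_iff)
    show "(\<lambda>x. h x * bump a b n x) \<in> borel_measurable (lebesgue_on \<Omega>)" for n
      using m test_function_L2[OF \<Omega> bump_test_function[OF ab]]
      by (intro borel_measurable_times) (auto simp: L2_def)
    show "integrable (lebesgue_on \<Omega>) (\<lambda>x. norm (h x))" using h by simp
    show "AE x in lebesgue_on \<Omega>. (\<lambda>n. h x * bump a b n x) \<longlonglongrightarrow> h x * indicator (box a b) x"
      by (intro AE_I2 tendsto_mult tendsto_const bump_tendsto ab)
    show "AE x in lebesgue_on \<Omega>. norm (h x * bump a b n x) \<le> norm (h x)" for n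
      using bump_bounds[of a b n] by (intro AE_I2) (simp add: abs_mult mult_left_le)
  qed
  from LIMSEQ_unique[OF this[unfolded zero[OF bump_test_function[OF ab]]] tendsto_const]
  show ?thesis .
qed

text \<open>Bump functions make the integral of \<open>h\<close> over every box inside \<Omega>
  vanish, and by Lebesgue differentiation the averages over shrinking cubes with corner
  \<open>x\<close> converge to the value at almost every \<open>x\<close>.\<close>

lemma fundamental_lemma:
  fixes h :: "'d::finite rfun"
  assumes h: "integrable (lebesgue_on \<Omega>) h" and \<Omega>: "open \<Omega>"
    and zero: "\<And>\<phi>. \<phi> \<in> test_functions \<Omega> \<Longrightarrow> (LINT x|lebesgue_on \<Omega>. h x * \<phi> x) = 0"
  shows "AE x in lebesgue_on \<Omega>. h x = 0"
proof -
  \<comment> \<open>Extension by zero gives a function integrable over the whole space, to which the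
    differentiation theorem applies on arbitrary cubes.\<close>
  define f where "f x = (if x \<in> \<Omega> then h x else 0)" for x
  have \<Omega>_sets: "\<Omega> \<in> sets lebesgue" using \<Omega> by auto
  have f: "integrable lebesgue f"
  proof -
    have "integrable lebesgue (\<lambda>x. indicator \<Omega> x *\<^sub>R h x)"
      using h \<Omega>_sets by (subst (asm) integrable_restrict_space) auto
    also have "(\<lambda>x. indicator \<Omega> x *\<^sub>R h x) = f" by (auto simp: f_def fun_eq_iff indicator_def)
    finally show ?thesis .
  qed
  have f_on: "f integrable_on cbox a b" for a b
    using integrable_on_subcbox[OF integrable_on_lebesgue[OF f]] by simp
  obtain N where N: "negligible N" and lim: "\<And>x e. \<lbrakk>x \<notin> N; 0 < e\<rbrakk> \<Longrightarrow> \<exists>d>0. \<forall>t. 0 < t \<and> t < d \<longrightarrow>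
      norm (integral (cbox x (x + t *\<^sub>R One)) f /\<^sub>R t ^ DIM(real ^ 'd) - f x) < e"
    using integrable_ccontinuous_explicit[OF f_on] by blast
  have box_zero: "integral (cbox a b) f = 0" if ab: "\<And>i. a $ i \<le> b $ i" "cbox a b \<subseteq> \<Omega>" for a b
  proof -
    have sub: "box a b \<subseteq> \<Omega>" using ab(2) box_subset_cbox by blast
    have "integral (cbox a b) f = integral (box a b) f" by (simp add: integral_open_interval)
    also have "\<dots> = (LINT x|lebesgue_on (box a b). f x)"
    proof (rule lebesgue_integral_eq_integral[symmetric])
      show "integrable (lebesgue_on (box a b)) f"
        using f by (subst integrable_restrict_space) (auto intro: integrable_mult_indicator simp del: real_scaleR_def)
    qed auto
    also have "\<dots> = (LINT x|lebesgue. indicator (box a b) x *\<^sub>R f x)"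
      by (rule integral_restrict_space) auto
    also have "\<dots> = (LINT x|lebesgue. indicator \<Omega> x *\<^sub>R (h x * indicator (box a b) x))"
      by (rule Bochner_Integration.integral_cong) (use sub in \<open>auto simp: f_def indicator_def\<close>)
    also have "\<dots> = (LINT x|lebesgue_on \<Omega>. h x * indicator (box a b) x)"
      by (rule integral_restrict_space[symmetric]) (use \<Omega>_sets in auto)
    also have "\<dots> = 0" by (rule integral_box_eq_0[OF h \<Omega> zero ab])
    finally show ?thesis .
  qed
  have f_zero: "f x = 0" if x: "x \<notin> N" for x
  proof (cases "x \<in> \<Omega>")
    case True
    then obtain r where r: "r > 0" "cball x r \<subseteq> \<Omega>" using \<Omega> open_contains_cball by blast
    define c where "c = norm (One :: real ^ 'd) + 1"
    have c: "c > 0" by (simp add: c_def add_nonneg_pos)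
    show ?thesis
    proof (rule ccontr)
      assume "f x \<noteq> 0"
      then obtain d where d: "d > 0" and close: "\<And>t. 0 < t \<Longrightarrow> t < d \<Longrightarrow>
          norm (integral (cbox x (x + t *\<^sub>R One)) f /\<^sub>R t ^ DIM(real ^ 'd) - f x) < norm (f x)"
        using lim[OF x, of "norm (f x)"] by auto
      \<comment> \<open>Small enough for the differentiation estimate, \<open>t < d\<close>, and for
        the cube of side \<open>t\<close> to stay in the ball of radius \<open>r\<close>.\<close>
      define t where "t = min (d / 2) (r / c)"
      have t: "0 < t" "t < d" "t * c \<le> r" using d r c by (auto simp: t_def min_def field_simps)
      have "cbox x (x + t *\<^sub>R One) \<subseteq> cball x r"
      proof
        fix y assume y: "y \<in> cbox x (x + t *\<^sub>R One)"
        have "norm (y - x) \<le> norm (t *\<^sub>R One :: real ^ 'd)"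
          by (rule norm_le_componentwise) (use y t in \<open>auto simp: mem_box algebra_simps\<close>)
        also have "\<dots> \<le> t * c" using t by (simp add: c_def)
        finally show "y \<in> cball x r" using t by (simp add: dist_norm norm_minus_commute)
      qed
      moreover have "x $ i \<le> (x + t *\<^sub>R One) $ i" for i
        using t by (simp add: cart_eq_inner_axis inner_add_left axis_in_Basis_iff)
      ultimately have "integral (cbox x (x + t *\<^sub>R One)) f = 0"
        using r by (intro box_zero) auto
      then show False using close[OF t(1,2)] by simp
    qed
  qed (simp add: f_def)
  have "AE x in lebesgue. x \<notin> N"
    using N by (simp add: negligible_iff_null_sets AE_not_in)
  then have "AE x in lebesgue. x \<in> \<Omega> \<longrightarrow> h x = 0"
  proof eventually_elim
    case (elim x)
    then show ?case using f_zero[of x] by (auto simp: f_def)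
  qed
  then show ?thesis using \<Omega>_sets by (subst AE_restrict_space_iff) auto
qed

text \<open>By translation invariance all difference quotients of \<open>\<phi>\<close> have integral zero.\<close>

lemma integral_partial_eq_0:
  fixes \<phi> :: "'d::finite rfun"
  assumes \<phi>: "\<phi> \<in> test_functions \<Omega>"
  shows "(LINT x|lborel. partial i \<phi> x) = 0"
proof -
  define e where "e = (axis i 1 :: real ^ 'd)"
  define t where "t n = inverse (real (Suc n))" for n
  have t: "0 < t n" "t n \<le> 1" for n by (auto simp: t_def divide_simps)
  define s where "s n x = (\<phi> (t n *\<^sub>R e + x) - \<phi> x) / t n" for n x
  have ne: "norm e = 1" by (simp add: e_def)
  obtain K where K: "compact K" "K \<subseteq> \<Omega>" and zero: "\<And>x. x \<notin> K \<Longrightarrow> \<phi> x = 0"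
    using \<phi> by (auto simp: test_functions_def)
  obtain R where R: "\<And>x. x \<in> K \<Longrightarrow> norm x \<le> R"
    using compact_imp_bounded[OF K(1)] by (auto simp: bounded_iff)
  obtain M where M: "\<And>x. \<bar>partial i \<phi> x\<bar> \<le> M"
    using test_function_bounded[OF test_function_partial[OF \<phi>]] by blast
  have M0: "0 \<le> M" using M[of 0] by linarith
  have line: "((\<lambda>\<tau>. \<phi> (\<tau> *\<^sub>R e + x)) has_real_derivative partial i \<phi> (\<tau> *\<^sub>R e + x)) (at \<tau>)" for \<tau> x
  proof -
    have "((\<lambda>\<tau>. \<tau> *\<^sub>R e + x) has_derivative (\<lambda>h. h *\<^sub>R e)) (at \<tau>)"
      by (auto intro!: derivative_eq_intros)
    from has_derivative_compose[OF this has_derivative_partial[OF test_function_differentiable[OF \<phi>]]]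
    have D: "((\<lambda>\<tau>. \<phi> (\<tau> *\<^sub>R e + x)) has_derivative
        (\<lambda>h. frechet_derivative \<phi> (at (\<tau> *\<^sub>R e + x)) (h *\<^sub>R e))) (at \<tau>)" .
    have "linear (frechet_derivative \<phi> (at (\<tau> *\<^sub>R e + x)))"
      using test_function_differentiable[OF \<phi>] by (rule linear_frechet_derivative)
    then have "frechet_derivative \<phi> (at (\<tau> *\<^sub>R e + x)) (h *\<^sub>R e) = partial i \<phi> (\<tau> *\<^sub>R e + x) * h" for h
      by (simp add: linear_cmul partial_def e_def)
    then show ?thesis using D by (simp add: has_field_derivative_def)
  qed
  have int\<phi>: "integrable lborel \<phi>" by (rule test_function_integrable[OF \<phi>])
  have shift: "integrable lborel (\<lambda>x. \<phi> (c + x)) \<and> (LINT x|lborel. \<phi> (c + x)) = (LINT x|lborel. \<phi> x)" for c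
  proof -
    have m: "(+) c \<in> measurable lborel borel" by simp
    have \<phi>m: "\<phi> \<in> borel_measurable borel" using int\<phi> by auto
    have "integrable (distr lborel borel ((+) c)) \<phi>" using int\<phi> by (simp add: lborel_distr_plus)
    then have "integrable lborel (\<lambda>x. \<phi> (c + x))"
      using integrable_distr_eq[OF m \<phi>m] by simp
    moreover have "(LINT x|lborel. \<phi> (c + x)) = (LINT x|distr lborel borel ((+) c). \<phi> x)"
      using integral_distr[OF m \<phi>m] by simp
    ultimately show ?thesis by (simp add: lborel_distr_plus)
  qed
  have int_s: "(LINT x|lborel. s n x) = 0" for n
    using shift[of "t n *\<^sub>R e"] int\<phi> by (simp add: s_def)
  have "(\<lambda>n. LINT x|lborel. s n x) \<longlonglongrightarrow> (LINT x|lborel. partial i \<phi> x)"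
  proof (rule integral_dominated_convergence)
    show "partial i \<phi> \<in> borel_measurable lborel"
      using test_function_integrable[OF test_function_partial[OF \<phi>]] by auto
    show "s n \<in> borel_measurable lborel" for n
      unfolding s_def using shift[of "t n *\<^sub>R e"] int\<phi> by (intro borel_measurable_integrable) auto
    \<comment> \<open>The integrable majorant: the mean value theorem bounds the quotients by
      \<open>M\<close>, and as the shifts have length at most 1, they all vanish outside the ball of
      radius \<open>R + 1\<close>.\<close>
    have "integrable lborel (\<lambda>x. indicator (cball (0 :: real ^ 'd) (R + 1)) x *\<^sub>R M)"
      by (intro borel_integrable_compact) auto
    then show "integrable lborel (\<lambda>x. indicator (cball (0 :: real ^ 'd) (R + 1)) x * M)"
      by simp
    show "AE x in lborel. (\<lambda>n. s n x) \<longlonglongrightarrow> partial i \<phi> x"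
    proof (rule AE_I2)
      fix x
      have "((\<lambda>h. (\<phi> ((0 + h) *\<^sub>R e + x) - \<phi> (0 *\<^sub>R e + x)) / h) \<longlongrightarrow> partial i \<phi> (0 *\<^sub>R e + x)) (at 0)"
        using line[of x 0] by (simp only: DERIV_def)
      then have L: "((\<lambda>h. (\<phi> (h *\<^sub>R e + x) - \<phi> x) / h) \<longlongrightarrow> partial i \<phi> x) (at 0)" by simp
      have T: "filterlim t (at 0) sequentially"
        using LIMSEQ_inverse_real_of_nat t(1)
        by (auto simp: filterlim_at t_def[abs_def] simp del: of_nat_Suc)
      show "(\<lambda>n. s n x) \<longlonglongrightarrow> partial i \<phi> x"
        using filterlim_compose[OF L T] by (simp add: s_def)
    qed
    show "AE x in lborel. norm (s n x) \<le> indicator (cball 0 (R + 1)) x * M" for n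
    proof (rule AE_I2)
      fix x
      show "norm (s n x) \<le> indicator (cball 0 (R + 1)) x * M"
      proof (cases "x \<in> cball 0 (R + 1)")
        case True
        obtain z where z: "\<phi> (t n *\<^sub>R e + x) - \<phi> (0 *\<^sub>R e + x) = (t n - 0) * partial i \<phi> (z *\<^sub>R e + x)"
          using MVT2[OF t(1)[of n] line] by blast
        have "norm (s n x) = \<bar>partial i \<phi> (z *\<^sub>R e + x)\<bar>"
          using z t(1)[of n] by (simp add: s_def)
        then show ?thesis using M True by simp
      next
        case False
        have "x \<notin> K" using False R[of x] by auto
        moreover have "t n *\<^sub>R e + x \<notin> K"
        proof
          assume "t n *\<^sub>R e + x \<in> K"
          then have "norm (t n *\<^sub>R e + x) \<le> R" by (rule R)
          moreover have "norm x \<le> norm (t n *\<^sub>R e + x) + norm (t n *\<^sub>R e)"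
            using norm_triangle_ineq4[of "t n *\<^sub>R e + x" "t n *\<^sub>R e"] by simp
          ultimately show False using False t[of n] ne by simp
        qed
        ultimately have "s n x = 0" using zero by (simp add: s_def)
        then show ?thesis using M0 by simp
      qed
    qed
  qed
  from LIMSEQ_unique[OF this[unfolded int_s] tendsto_const] show ?thesis .
qed

section \<open>Sobolev spaces\<close>

lemma integration_by_parts:
  assumes \<Omega>: "open \<Omega>" and \<phi>: "\<phi> \<in> test_functions \<Omega>" and \<psi>: "\<psi> \<in> test_functions \<Omega>"
  shows "ip0 \<Omega> \<phi> (partial i \<psi>) = - ip0 \<Omega> (partial i \<phi>) \<psi>"
proof -
  note L2 = test_function_L2[OF \<Omega>]
  have "ip0 \<Omega> \<phi> (partial i \<psi>) + ip0 \<Omega> (partial i \<phi>) \<psi>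
      = (LINT x|lebesgue_on \<Omega>. \<phi> x * partial i \<psi> x + partial i \<phi> x * \<psi> x)"
    unfolding ip0_def
    by (rule Bochner_Integration.integral_add[symmetric])
      (intro L2_mult_integrable L2 \<phi> \<psi> test_function_partial)+
  also have "\<dots> = (LINT x|lebesgue_on \<Omega>. partial i (\<lambda>x. \<phi> x * \<psi> x) x)"
    by (simp only: partial_mult[OF test_function_differentiable[OF \<phi>] test_function_differentiable[OF \<psi>]])
  also have "\<dots> = 0"
    using test_function_integral[OF \<Omega> test_function_partial[OF test_function_mult[OF \<phi> \<psi>]]]
      integral_partial_eq_0[OF test_function_mult[OF \<phi> \<psi>]] by simp
  finally show ?thesis by simp
qed

lemma test_function_gradient:
  assumes "open \<Omega>" "\<phi> \<in> test_functions \<Omega>"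
  shows "is_L2_gradient \<Omega> \<phi> (\<lambda>x. \<chi> i. partial i \<phi> x)"
  using assms test_function_L2[OF assms(1) test_function_partial[OF assms(2)]]
    integration_by_parts[OF assms]
  by (auto simp: is_L2_gradient_def is_weak_gradient_def)

lemma test_function_H1:
  assumes "open \<Omega>" "\<phi> \<in> test_functions \<Omega>"
  shows "\<phi> \<in> H1 \<Omega>"
  using test_function_gradient[OF assms] test_function_L2[OF assms] by (auto simp: H1_def)

definition ip1 :: "(real ^ 'd) set \<Rightarrow> 'd rfun \<Rightarrow> 'd rfun \<Rightarrow> real" where
  "ip1 \<Omega> w v = ip0 \<Omega> w v + (\<Sum>i\<in>UNIV. ip0 \<Omega> (\<lambda>x. wgrad \<Omega> w x $ i) (\<lambda>x. wgrad \<Omega> v x $ i))"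

lemma norm1_eq: "norm1 \<Omega> w = sqrt (ip1 \<Omega> w w)"
  by (simp add: norm1_def ip1_def norm0_def ip0_def)

lemma norm0_le_norm1: "norm0 \<Omega> w \<le> norm1 \<Omega> w"
  unfolding norm1_def by (rule real_le_rsqrt) (simp add: sum_nonneg)

lemma norm1_nonneg: "0 \<le> norm1 \<Omega> w"
  unfolding norm1_def by (intro real_sqrt_ge_zero add_nonneg_nonneg sum_nonneg zero_le_power2)

lemma H1_L2: "w \<in> H1 \<Omega> \<Longrightarrow> w \<in> L2 \<Omega>"
  by (simp add: H1_def)

lemma H10_H1: "w \<in> H10 \<Omega> \<Longrightarrow> w \<in> H1 \<Omega>"
  by (simp add: H10_def)

lemma wgrad_gradient: "w \<in> H1 \<Omega> \<Longrightarrow> is_L2_gradient \<Omega> w (wgrad \<Omega> w)"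
  unfolding wgrad_def by (rule someI_ex[of "is_L2_gradient \<Omega> w"]) (simp add: H1_def)

lemma wgrad_L2: "w \<in> H1 \<Omega> \<Longrightarrow> (\<lambda>x. wgrad \<Omega> w x $ i) \<in> L2 \<Omega>"
  using wgrad_gradient by (auto simp: is_L2_gradient_def)

lemma ip0_tendsto:
  assumes X: "\<And>n. X n \<in> L2 \<Omega>" and w: "w \<in> L2 \<Omega>" and v: "v \<in> L2 \<Omega>"
    and lim: "(\<lambda>n. norm0 \<Omega> (\<lambda>x. X n x - w x)) \<longlonglongrightarrow> 0"
  shows "(\<lambda>n. ip0 \<Omega> (X n) v) \<longlonglongrightarrow> ip0 \<Omega> w v"
proof (rule LIM_zero_cancel, rule Lim_null_comparison)
  show "\<forall>\<^sub>F n in sequentially. norm (ip0 \<Omega> (X n) v - ip0 \<Omega> w v) \<le> norm0 \<Omega> (\<lambda>x. X n x - w x) * norm0 \<Omega> v"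
    using L2.Cauchy_Schwarz[OF L2.diff_mem[OF X w] v] by (simp add: L2.diff_left X w v)
  show "(\<lambda>n. norm0 \<Omega> (\<lambda>x. X n x - w x) * norm0 \<Omega> v) \<longlonglongrightarrow> 0"
    using tendsto_mult_left_zero[OF lim] .
qed

section \<open>Uniqueness of weak gradients; completeness of \<open>H1\<close> and
  \<open>H10\<close>\<close>

locale bounded_open =
  fixes \<Omega> :: "(real ^ 'd) set"
  assumes op: "open \<Omega>" and bdd: "bounded \<Omega>"
begin

text \<open>Componentwise, the difference is orthogonal to all test functions, and it is integrable
  because \<Omega> has finite measure; finitely many exceptional null sets are then merged.\<close>

lemma gradient_unique:
  assumes "is_L2_gradient \<Omega> w G" "is_L2_gradient \<Omega> w G'"
  shows "AE x in lebesgue_on \<Omega>. G x = G' x"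
proof -
  have "AE x in lebesgue_on \<Omega>. G x $ i - G' x $ i = 0" for i
  proof (rule fundamental_lemma[OF _ op])
    have L2: "(\<lambda>x. G x $ i) \<in> L2 \<Omega>" "(\<lambda>x. G' x $ i) \<in> L2 \<Omega>"
      using assms by (auto simp: is_L2_gradient_def)
    show "integrable (lebesgue_on \<Omega>) (\<lambda>x. G x $ i - G' x $ i)"
      by (intro L2_integrable op bdd L2.diff_mem L2)
    fix \<phi> assume \<phi>: "\<phi> \<in> test_functions \<Omega>"
    have "ip0 \<Omega> (\<lambda>x. G x $ i - G' x $ i) \<phi> = ip0 \<Omega> (\<lambda>x. G x $ i) \<phi> - ip0 \<Omega> (\<lambda>x. G' x $ i) \<phi>"
      by (intro L2.diff_left L2 test_function_L2 op \<phi>)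
    also have "\<dots> = 0"
    proof -
      have "ip0 \<Omega> w (partial i \<phi>) = - ip0 \<Omega> (\<lambda>x. G x $ i) \<phi>"
        "ip0 \<Omega> w (partial i \<phi>) = - ip0 \<Omega> (\<lambda>x. G' x $ i) \<phi>"
        using assms \<phi> by (auto simp: is_L2_gradient_def is_weak_gradient_def)
      then show ?thesis by simp
    qed
    finally show "(LINT x|lebesgue_on \<Omega>. (G x $ i - G' x $ i) * \<phi> x) = 0" by (simp add: ip0_def)
  qed
  then have "AE x in lebesgue_on \<Omega>. \<forall>i\<in>UNIV. G x $ i - G' x $ i = 0"
    by (intro AE_finite_allI) auto
  then show ?thesis by eventually_elim (simp add: vec_eq_iff)
qed

lemma gradient_comb:
  assumes w: "w \<in> L2 \<Omega>" "is_L2_gradient \<Omega> w G" and v: "v \<in> L2 \<Omega>" "is_L2_gradient \<Omega> v G'"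
  shows "is_L2_gradient \<Omega> (\<lambda>x. b * w x + c * v x) (\<lambda>x. b *\<^sub>R G x + c *\<^sub>R G' x)"
  unfolding is_L2_gradient_def is_weak_gradient_def
proof (intro conjI allI ballI)
  have L2: "(\<lambda>x. G x $ i) \<in> L2 \<Omega>" "(\<lambda>x. G' x $ i) \<in> L2 \<Omega>" for i
    using assms by (auto simp: is_L2_gradient_def)
  show "(\<lambda>x. (b *\<^sub>R G x + c *\<^sub>R G' x) $ i) \<in> L2 \<Omega>" for i
    using L2.comb[OF L2] by simp
  fix \<phi> i assume \<phi>: "\<phi> \<in> test_functions \<Omega>"
  have "ip0 \<Omega> w (partial i \<phi>) = - ip0 \<Omega> (\<lambda>x. G x $ i) \<phi>"
    "ip0 \<Omega> v (partial i \<phi>) = - ip0 \<Omega> (\<lambda>x. G' x $ i) \<phi>"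
    using w v \<phi> by (auto simp: is_L2_gradient_def is_weak_gradient_def)
  moreover have "ip0 \<Omega> (\<lambda>x. b * w x + c * v x) (partial i \<phi>)
      = b * ip0 \<Omega> w (partial i \<phi>) + c * ip0 \<Omega> v (partial i \<phi>)"
    by (intro L2.lin w v test_function_L2 op test_function_partial \<phi>)
  moreover have "ip0 \<Omega> (\<lambda>x. b * G x $ i + c * G' x $ i) \<phi>
      = b * ip0 \<Omega> (\<lambda>x. G x $ i) \<phi> + c * ip0 \<Omega> (\<lambda>x. G' x $ i) \<phi>"
    by (intro L2.lin L2 test_function_L2 op \<phi>)
  ultimately show "ip0 \<Omega> (\<lambda>x. b * w x + c * v x) (partial i \<phi>)
      = - ip0 \<Omega> (\<lambda>x. (b *\<^sub>R G x + c *\<^sub>R G' x) $ i) \<phi>"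
    by simp
qed

lemma H1_comb: "w \<in> H1 \<Omega> \<Longrightarrow> v \<in> H1 \<Omega> \<Longrightarrow> (\<lambda>x. b * w x + c * v x) \<in> H1 \<Omega>"
  using gradient_comb[of w "wgrad \<Omega> w" v "wgrad \<Omega> v" b c] wgrad_gradient L2.comb
  by (auto simp: H1_def)

lemma wgrad_comb:
  assumes "w \<in> H1 \<Omega>" "v \<in> H1 \<Omega>"
  shows "AE x in lebesgue_on \<Omega>.
    wgrad \<Omega> (\<lambda>x. b * w x + c * v x) x = b *\<^sub>R wgrad \<Omega> w x + c *\<^sub>R wgrad \<Omega> v x"
  by (rule gradient_unique[OF wgrad_gradient[OF H1_comb[OF assms]]
        gradient_comb[OF H1_L2 wgrad_gradient H1_L2 wgrad_gradient]]) (use assms in auto)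

sublocale H1: semi_inner "H1 \<Omega>" "ip1 \<Omega>"
proof
  show "H1 \<Omega> \<noteq> {}" using test_function_H1[OF op zero_test_function] by blast
next
  fix w v :: "'d rfun" and b c assume w: "w \<in> H1 \<Omega>" and v: "v \<in> H1 \<Omega>"
  show "(\<lambda>x. b * w x + c * v x) \<in> H1 \<Omega>" by (rule H1_comb[OF w v])
  fix u assume u: "u \<in> H1 \<Omega>"
  have "ip0 \<Omega> (\<lambda>x. wgrad \<Omega> (\<lambda>x. b * w x + c * v x) x $ i) (\<lambda>x. wgrad \<Omega> u x $ i)
      = b * ip0 \<Omega> (\<lambda>x. wgrad \<Omega> w x $ i) (\<lambda>x. wgrad \<Omega> u x $ i)
      + c * ip0 \<Omega> (\<lambda>x. wgrad \<Omega> v x $ i) (\<lambda>x. wgrad \<Omega> u x $ i)" for i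
  proof -
    have "ip0 \<Omega> (\<lambda>x. wgrad \<Omega> (\<lambda>x. b * w x + c * v x) x $ i) (\<lambda>x. wgrad \<Omega> u x $ i)
        = ip0 \<Omega> (\<lambda>x. b * wgrad \<Omega> w x $ i + c * wgrad \<Omega> v x $ i) (\<lambda>x. wgrad \<Omega> u x $ i)"
    proof (rule ip0_cong_AE)
      show "AE x in lebesgue_on \<Omega>. wgrad \<Omega> (\<lambda>x. b * w x + c * v x) x $ i
          = b * wgrad \<Omega> w x $ i + c * wgrad \<Omega> v x $ i"
        using wgrad_comb[OF w v, of b c] by eventually_elim simp
    qed (intro wgrad_L2 L2.comb H1_comb w v u AE_I2 refl)+
    also have "\<dots> = b * ip0 \<Omega> (\<lambda>x. wgrad \<Omega> w x $ i) (\<lambda>x. wgrad \<Omega> u x $ i)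
        + c * ip0 \<Omega> (\<lambda>x. wgrad \<Omega> v x $ i) (\<lambda>x. wgrad \<Omega> u x $ i)"
      by (intro L2.lin wgrad_L2 w v u)
    finally show ?thesis .
  qed
  then show "ip1 \<Omega> (\<lambda>x. b * w x + c * v x) u = b * ip1 \<Omega> w u + c * ip1 \<Omega> v u"
    by (simp add: ip1_def L2.lin[OF H1_L2[OF w] H1_L2[OF v] H1_L2[OF u]]
        sum.distrib sum_distrib_left distrib_left)
next
  show "ip1 \<Omega> w v = ip1 \<Omega> v w" for w v by (simp add: ip1_def ip0_def mult.commute)
  show "0 \<le> ip1 \<Omega> w w" for w
    unfolding ip1_def by (intro add_nonneg_nonneg sum_nonneg) (simp_all add: ip0_def)
qed

lemma H1_nrm [simp]: "H1.nrm = norm1 \<Omega>"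
  by (rule ext) (simp add: H1.nrm_def norm1_eq)

text \<open>Frees the norm from the choice made in \<open>wgrad\<close>, so that differences and
  limits can be measured with whatever gradient is at hand.\<close>

lemma norm1_gradient:
  assumes w: "w \<in> L2 \<Omega>" and G: "is_L2_gradient \<Omega> w G"
  shows "norm1 \<Omega> w = sqrt ((norm0 \<Omega> w)\<^sup>2 + (\<Sum>i\<in>UNIV. (norm0 \<Omega> (\<lambda>x. G x $ i))\<^sup>2))"
proof -
  have H1: "w \<in> H1 \<Omega>" using assms by (auto simp: H1_def)
  have GL2: "(\<lambda>x. G x $ i) \<in> L2 \<Omega>" for i using G by (simp add: is_L2_gradient_def)
  have ae: "AE x in lebesgue_on \<Omega>. wgrad \<Omega> w x $ i = G x $ i" for i
    using gradient_unique[OF wgrad_gradient[OF H1] G] by eventually_elim simp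
  have "norm0 \<Omega> (\<lambda>x. wgrad \<Omega> w x $ i) = norm0 \<Omega> (\<lambda>x. G x $ i)" for i
    unfolding norm0_def using ip0_cong_AE[OF wgrad_L2[OF H1] GL2 wgrad_L2[OF H1] GL2 ae ae] by simp
  then show ?thesis by (simp add: norm1_def)
qed

text \<open>The weak gradient is a closed operator: functions and gradient components converge
  separately in \<open>L2\<close>, and the defining identity, tested with a fixed test function,
  survives both limits.\<close>

lemma H1_complete:
  assumes X: "\<And>n. X n \<in> H1 \<Omega>"
    and cauchy: "\<And>e. e > 0 \<Longrightarrow> \<exists>N. \<forall>i\<ge>N. \<forall>j\<ge>N. norm1 \<Omega> (\<lambda>x. X i x - X j x) < e"
  shows "\<exists>w\<in>H1 \<Omega>. (\<lambda>n. norm1 \<Omega> (\<lambda>x. X n x - w x)) \<longlonglongrightarrow> 0"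
proof -
  have diff_gradient: "is_L2_gradient \<Omega> (\<lambda>x. X m x - v x) (\<lambda>x. wgrad \<Omega> (X m) x - G x)"
    if "v \<in> L2 \<Omega>" "is_L2_gradient \<Omega> v G" for m v G
    using gradient_comb[OF H1_L2[OF X] wgrad_gradient[OF X] that, of 1 m "-1"] by simp
  have "\<exists>N. \<forall>i\<ge>N. \<forall>j\<ge>N. norm0 \<Omega> (\<lambda>x. X i x - X j x) < e" if "e > 0" for e
    using cauchy[OF that] order_le_less_trans[OF norm0_le_norm1] by fast
  then obtain w where w: "w \<in> L2 \<Omega>" and wlim: "(\<lambda>n. norm0 \<Omega> (\<lambda>x. X n x - w x)) \<longlonglongrightarrow> 0"
    using L2_complete[OF op bdd, of X] H1_L2[OF X] by blast
  have ex: "\<exists>g\<in>L2 \<Omega>. (\<lambda>n. norm0 \<Omega> (\<lambda>x. wgrad \<Omega> (X n) x $ k - g x)) \<longlonglongrightarrow> 0" for k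
  proof (rule L2_complete[OF op bdd wgrad_L2[OF X]])
    fix e :: real assume "e > 0"
    have "norm0 \<Omega> (\<lambda>x. wgrad \<Omega> (X i) x $ k - wgrad \<Omega> (X j) x $ k) \<le> norm1 \<Omega> (\<lambda>x. X i x - X j x)" for i j
      unfolding norm1_gradient[OF L2.diff_mem[OF H1_L2[OF X] H1_L2[OF X]]
          diff_gradient[OF H1_L2[OF X] wgrad_gradient[OF X]]]
    proof (rule real_le_rsqrt, rule add_increasing[OF zero_le_power2])
      show "(norm0 \<Omega> (\<lambda>x. wgrad \<Omega> (X i) x $ k - wgrad \<Omega> (X j) x $ k))\<^sup>2
          \<le> (\<Sum>k\<in>UNIV. (norm0 \<Omega> (\<lambda>x. (wgrad \<Omega> (X i) x - wgrad \<Omega> (X j) x) $ k))\<^sup>2)"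
        unfolding vector_minus_component by (rule member_le_sum) auto
    qed
    note le = this
    show "\<exists>N. \<forall>i\<ge>N. \<forall>j\<ge>N. norm0 \<Omega> (\<lambda>x. wgrad \<Omega> (X i) x $ k - wgrad \<Omega> (X j) x $ k) < e"
      using cauchy[OF \<open>e > 0\<close>] order_le_less_trans[OF le] by fast
  qed
  obtain g where g: "\<And>k. g k \<in> L2 \<Omega>"
    and glim: "\<And>k. (\<lambda>n. norm0 \<Omega> (\<lambda>x. wgrad \<Omega> (X n) x $ k - g k x)) \<longlonglongrightarrow> 0"
    using bchoice[of UNIV "\<lambda>k g. g \<in> L2 \<Omega> \<and> (\<lambda>n. norm0 \<Omega> (\<lambda>x. wgrad \<Omega> (X n) x $ k - g x)) \<longlonglongrightarrow> 0"] ex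
    by blast
  define G where "G x = (\<chi> k. g k x)" for x
  have G: "is_L2_gradient \<Omega> w G"
    unfolding is_L2_gradient_def is_weak_gradient_def
  proof (intro conjI allI ballI)
    show "(\<lambda>x. G x $ i) \<in> L2 \<Omega>" for i using g by (simp add: G_def)
    fix \<phi> i assume \<phi>: "\<phi> \<in> test_functions \<Omega>"
    have "(\<lambda>n. ip0 \<Omega> (X n) (partial i \<phi>)) \<longlonglongrightarrow> ip0 \<Omega> w (partial i \<phi>)"
      by (rule ip0_tendsto[OF H1_L2[OF X] w test_function_L2[OF op test_function_partial[OF \<phi>]] wlim])
    moreover have "ip0 \<Omega> (X n) (partial i \<phi>) = - ip0 \<Omega> (\<lambda>x. wgrad \<Omega> (X n) x $ i) \<phi>" for n
      using wgrad_gradient[OF X] \<phi> by (auto simp: is_L2_gradient_def is_weak_gradient_def)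
    moreover have "(\<lambda>n. - ip0 \<Omega> (\<lambda>x. wgrad \<Omega> (X n) x $ i) \<phi>) \<longlonglongrightarrow> - ip0 \<Omega> (g i) \<phi>"
      by (intro tendsto_minus ip0_tendsto[OF wgrad_L2[OF X] g test_function_L2[OF op \<phi>] glim])
    ultimately show "ip0 \<Omega> w (partial i \<phi>) = - ip0 \<Omega> (\<lambda>x. G x $ i) \<phi>"
      using LIMSEQ_unique by (simp add: G_def)
  qed
  have "w \<in> H1 \<Omega>" using w G by (auto simp: H1_def)
  moreover have "(\<lambda>n. norm1 \<Omega> (\<lambda>x. X n x - w x)) \<longlonglongrightarrow> 0"
  proof -
    have "norm1 \<Omega> (\<lambda>x. X n x - w x) = sqrt ((norm0 \<Omega> (\<lambda>x. X n x - w x))\<^sup>2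
        + (\<Sum>k\<in>UNIV. (norm0 \<Omega> (\<lambda>x. wgrad \<Omega> (X n) x $ k - g k x))\<^sup>2))" for n
      using norm1_gradient[OF L2.diff_mem[OF H1_L2[OF X] w] diff_gradient[OF w G]]
      by (simp add: G_def)
    moreover have "(\<lambda>n. sqrt ((norm0 \<Omega> (\<lambda>x. X n x - w x))\<^sup>2
        + (\<Sum>k\<in>UNIV. (norm0 \<Omega> (\<lambda>x. wgrad \<Omega> (X n) x $ k - g k x))\<^sup>2))) \<longlonglongrightarrow> sqrt (0\<^sup>2 + (\<Sum>k\<in>(UNIV :: 'd set). 0\<^sup>2))"
      by (intro tendsto_intros wlim glim)
    ultimately show ?thesis by simp
  qed
  ultimately show ?thesis by blast
qed

text \<open>Density in epsilon form, which spares the closure arguments below from handling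
  sequences of test functions.\<close>

lemma H10_iff: "w \<in> H10 \<Omega> \<longleftrightarrow> w \<in> H1 \<Omega> \<and> (\<forall>e>0. \<exists>\<phi>\<in>test_functions \<Omega>. norm1 \<Omega> (\<lambda>x. w x - \<phi> x) < e)"
proof (intro iffI conjI allI impI)
  fix e :: real assume "w \<in> H10 \<Omega>" "0 < e"
  then obtain \<phi> where \<phi>: "\<And>m. \<phi> m \<in> test_functions \<Omega>"
    and "(\<lambda>m. norm1 \<Omega> (\<lambda>x. w x - \<phi> m x)) \<longlonglongrightarrow> 0"
    by (auto simp: H10_def)
  then obtain m where "norm (norm1 \<Omega> (\<lambda>x. w x - \<phi> m x) - 0) < e"
    using LIMSEQ_D \<open>0 < e\<close> by blast
  then show "\<exists>\<phi>\<in>test_functions \<Omega>. norm1 \<Omega> (\<lambda>x. w x - \<phi> x) < e" using \<phi>[of m] by (intro bexI[of _ "\<phi> m"]) auto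
next
  assume *: "w \<in> H1 \<Omega> \<and> (\<forall>e>0. \<exists>\<phi>\<in>test_functions \<Omega>. norm1 \<Omega> (\<lambda>x. w x - \<phi> x) < e)"
  then have "\<exists>\<phi>\<in>test_functions \<Omega>. norm1 \<Omega> (\<lambda>x. w x - \<phi> x) < inverse (real (Suc m))" for m
    by (intro conjunct2[OF *, rule_format]) simp
  then obtain \<phi> where \<phi>: "\<And>m. \<phi> m \<in> test_functions \<Omega>"
    and lt: "\<And>m. norm1 \<Omega> (\<lambda>x. w x - \<phi> m x) < inverse (real (Suc m))"
    by metis
  have "(\<lambda>m. norm1 \<Omega> (\<lambda>x. w x - \<phi> m x)) \<longlonglongrightarrow> 0"
  proof (rule Lim_null_comparison[OF _ LIMSEQ_inverse_real_of_nat])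
    show "\<forall>\<^sub>F m in sequentially. norm (norm1 \<Omega> (\<lambda>x. w x - \<phi> m x)) \<le> inverse (real (Suc m))"
      using lt by (intro always_eventually) (simp add: norm1_nonneg less_imp_le del: of_nat_Suc)
  qed
  then show "w \<in> H10 \<Omega>" using * \<phi> by (auto simp: H10_def)
qed (simp add: H10_def)

lemma H10_comb:
  assumes w: "w \<in> H10 \<Omega>" and v: "v \<in> H10 \<Omega>"
  shows "(\<lambda>x. b * w x + c * v x) \<in> H10 \<Omega>"
  unfolding H10_iff
proof (intro conjI allI impI)
  show "(\<lambda>x. b * w x + c * v x) \<in> H1 \<Omega>" by (intro H1_comb H10_H1 w v)
  fix e :: real assume e: "0 < e"
  \<comment> \<open>The added 1 covers \<open>b = c = 0\<close> and makes the final inequality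
    strict.\<close>
  define d where "d = e / (\<bar>b\<bar> + \<bar>c\<bar> + 1)"
  have pos: "0 < \<bar>b\<bar> + \<bar>c\<bar> + 1" by simp
  have d: "0 < d" unfolding d_def using e pos by (rule divide_pos_pos)
  obtain \<phi> \<psi> where \<phi>: "\<phi> \<in> test_functions \<Omega>" "norm1 \<Omega> (\<lambda>x. w x - \<phi> x) < d"
    and \<psi>: "\<psi> \<in> test_functions \<Omega>" "norm1 \<Omega> (\<lambda>x. v x - \<psi> x) < d"
    using w v d unfolding H10_iff by blast
  have H1: "(\<lambda>x. w x - \<phi> x) \<in> H1 \<Omega>" "(\<lambda>x. v x - \<psi> x) \<in> H1 \<Omega>"
    by (intro H1.diff_mem H10_H1 w v test_function_H1 op \<phi> \<psi>)+
  have eq: "(\<lambda>x. (b * w x + c * v x) - (b * \<phi> x + c * \<psi> x))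
      = (\<lambda>x. b * (w x - \<phi> x) + c * (v x - \<psi> x))"
    by (simp add: algebra_simps)
  have "norm1 \<Omega> (\<lambda>x. (b * w x + c * v x) - (b * \<phi> x + c * \<psi> x))
      \<le> \<bar>b\<bar> * norm1 \<Omega> (\<lambda>x. w x - \<phi> x) + \<bar>c\<bar> * norm1 \<Omega> (\<lambda>x. v x - \<psi> x)"
    unfolding eq using H1.nrm_comb_le[OF H1] by simp
  also have "\<dots> \<le> \<bar>b\<bar> * d + \<bar>c\<bar> * d"
    using \<phi>(2) \<psi>(2) by (intro add_mono mult_left_mono) auto
  also have "\<dots> < (\<bar>b\<bar> + \<bar>c\<bar> + 1) * d" using d by (simp add: algebra_simps)
  also have "\<dots> = e" using pos by (simp add: d_def)
  finally show "\<exists>\<zeta>\<in>test_functions \<Omega>. norm1 \<Omega> (\<lambda>x. (b * w x + c * v x) - \<zeta> x) < e"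
    by (rule bexI[OF _ test_function_comb[OF \<phi>(1) \<psi>(1)]])
qed

lemma H10_complete:
  assumes X: "\<And>n. X n \<in> H10 \<Omega>"
    and cauchy: "\<And>e. e > 0 \<Longrightarrow> \<exists>N. \<forall>i\<ge>N. \<forall>j\<ge>N. norm1 \<Omega> (\<lambda>x. X i x - X j x) < e"
  shows "\<exists>w\<in>H10 \<Omega>. (\<lambda>n. norm1 \<Omega> (\<lambda>x. X n x - w x)) \<longlonglongrightarrow> 0"
proof -
  obtain w where w: "w \<in> H1 \<Omega>" and lim: "(\<lambda>n. norm1 \<Omega> (\<lambda>x. X n x - w x)) \<longlonglongrightarrow> 0"
    using H1_complete[OF H10_H1[OF X] cauchy] by blast
  have "\<exists>\<phi>\<in>test_functions \<Omega>. norm1 \<Omega> (\<lambda>x. w x - \<phi> x) < e" if e: "0 < e" for e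
  proof -
    have "0 < e / 2" using e by simp
    then obtain n where "norm (norm1 \<Omega> (\<lambda>x. X n x - w x) - 0) < e / 2"
      using LIMSEQ_D[OF lim] by blast
    then have 1: "norm1 \<Omega> (\<lambda>x. w x - X n x) < e / 2"
      using H1.nrm_diff_commute[OF w H10_H1[OF X[of n]]] by simp
    obtain \<phi> where \<phi>: "\<phi> \<in> test_functions \<Omega>" and 2: "norm1 \<Omega> (\<lambda>x. X n x - \<phi> x) < e / 2"
      using X[of n] \<open>0 < e / 2\<close> unfolding H10_iff by blast
    have "norm1 \<Omega> (\<lambda>x. w x - \<phi> x) < e"
      using H1.nrm_diff_triangle[OF w H10_H1[OF X[of n]] test_function_H1[OF op \<phi>]] 1 2 by simp
    then show ?thesis using \<phi> by blast
  qed
  then have "w \<in> H10 \<Omega>" using w unfolding H10_iff by blast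
  then show ?thesis using lim by blast
qed

lemma zero_H10: "(\<lambda>x. 0) \<in> H10 \<Omega>"
  unfolding H10_iff
proof (intro conjI allI impI bexI[OF _ zero_test_function])
  show "(\<lambda>x. 0) \<in> H1 \<Omega>" by (rule test_function_H1[OF op zero_test_function])
  then have "H1.nrm (\<lambda>x. 0 * 0) = 0" using H1.nrm_scale[of "\<lambda>x. 0" 0] by simp
  then show "norm1 \<Omega> (\<lambda>x. 0 - 0) < e" if "0 < e" for e using that by simp
qed

end

section \<open>The elliptic form\<close>

locale elliptic = bounded_open \<Omega> for \<Omega> :: "(real ^ 'd) set" +
  fixes A :: "real ^ 'd \<Rightarrow> real ^ 'd ^ 'd" and Ca ca :: real
  assumes matrix: "coefficient_matrix \<Omega> A"
    and a_bounded: "\<And>w v. w \<in> H10 \<Omega> \<Longrightarrow> v \<in> H10 \<Omega> \<Longrightarrow> aform \<Omega> A w v \<le> Ca * norm1 \<Omega> w * norm1 \<Omega> v"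
    and ca_pos: "0 < ca"
    and a_coercive: "\<And>w. w \<in> H10 \<Omega> \<Longrightarrow> ca * (norm1 \<Omega> w)\<^sup>2 \<le> aform \<Omega> A w w"
begin

text \<open>Entries of \<open>A\<close> are essentially bounded and products of gradient components
  integrable. This is what allows integrals to be split when linearity of the form is
  proved.\<close>

lemma aform_integrable:
  assumes w: "w \<in> H1 \<Omega>" and v: "v \<in> H1 \<Omega>"
  shows "integrable (lebesgue_on \<Omega>) (\<lambda>x. (A x *v wgrad \<Omega> w x) \<bullet> wgrad \<Omega> v x)"
proof -
  have "integrable (lebesgue_on \<Omega>) (\<lambda>x. A x $ i $ j * (wgrad \<Omega> w x $ j * wgrad \<Omega> v x $ i))" for i j
  proof -
    have W: "(\<lambda>x. A x $ i $ j) \<in> W1inf \<Omega>" using matrix by (simp add: coefficient_matrix_def)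
    then have m: "(\<lambda>x. A x $ i $ j) \<in> borel_measurable (lebesgue_on \<Omega>)" by (simp add: W1inf_def)
    obtain M where M: "AE x in lebesgue_on \<Omega>. \<bar>A x $ i $ j\<bar> \<le> M"
      using W unfolding W1inf_def by fastforce
    have int: "integrable (lebesgue_on \<Omega>) (\<lambda>x. wgrad \<Omega> w x $ j * wgrad \<Omega> v x $ i)"
      by (intro L2_mult_integrable wgrad_L2 w v)
    show ?thesis
    proof (rule Bochner_Integration.integrable_bound)
      show "integrable (lebesgue_on \<Omega>) (\<lambda>x. M * (wgrad \<Omega> w x $ j * wgrad \<Omega> v x $ i))"
        using int by simp
      show "(\<lambda>x. A x $ i $ j * (wgrad \<Omega> w x $ j * wgrad \<Omega> v x $ i)) \<in> borel_measurable (lebesgue_on \<Omega>)"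
        using m int by (intro borel_measurable_times[OF m] borel_measurable_integrable)
      show "AE x in lebesgue_on \<Omega>. norm (A x $ i $ j * (wgrad \<Omega> w x $ j * wgrad \<Omega> v x $ i))
          \<le> norm (M * (wgrad \<Omega> w x $ j * wgrad \<Omega> v x $ i))"
        using M
      proof eventually_elim
        case (elim x)
        then have "\<bar>A x $ i $ j\<bar> \<le> \<bar>M\<bar>" by linarith
        then show ?case by (simp add: abs_mult mult_right_mono)
      qed
    qed
  qed
  then have "integrable (lebesgue_on \<Omega>)
      (\<lambda>x. \<Sum>i\<in>UNIV. \<Sum>j\<in>UNIV. A x $ i $ j * (wgrad \<Omega> w x $ j * wgrad \<Omega> v x $ i))"
    by (intro Bochner_Integration.integrable_sum) auto
  then show ?thesis
    by (simp add: inner_vec_def matrix_vector_mult_def sum_distrib_right mult.assoc)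
qed

lemma aform_lin:
  assumes w: "w \<in> H1 \<Omega>" and v: "v \<in> H1 \<Omega>" and u: "u \<in> H1 \<Omega>"
  shows "aform \<Omega> A (\<lambda>x. b * w x + c * v x) u = b * aform \<Omega> A w u + c * aform \<Omega> A v u"
proof -
  have "aform \<Omega> A (\<lambda>x. b * w x + c * v x) u = (LINT x|lebesgue_on \<Omega>.
      b * ((A x *v wgrad \<Omega> w x) \<bullet> wgrad \<Omega> u x) + c * ((A x *v wgrad \<Omega> v x) \<bullet> wgrad \<Omega> u x))"
    unfolding aform_def
  proof (rule integral_cong_AE)
    show "AE x in lebesgue_on \<Omega>. (A x *v wgrad \<Omega> (\<lambda>x. b * w x + c * v x) x) \<bullet> wgrad \<Omega> u x
        = b * ((A x *v wgrad \<Omega> w x) \<bullet> wgrad \<Omega> u x) + c * ((A x *v wgrad \<Omega> v x) \<bullet> wgrad \<Omega> u x)"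
      using wgrad_comb[OF w v, of b c]
      by eventually_elim
        (simp add: matrix_vector_right_distrib inner_add_left matrix_vector_mult_scaleR scalar_mult_eq_scaleR)
  qed (intro borel_measurable_integrable aform_integrable H1_comb w v u
      Bochner_Integration.integrable_add integrable_mult_right)+
  also have "\<dots> = b * aform \<Omega> A w u + c * aform \<Omega> A v u"
    using aform_integrable[OF w u] aform_integrable[OF v u] by (simp add: aform_def)
  finally show ?thesis .
qed

lemma aform_sym:
  assumes w: "w \<in> H1 \<Omega>" and v: "v \<in> H1 \<Omega>"
  shows "aform \<Omega> A w v = aform \<Omega> A v w"
  unfolding aform_def
proof (rule integral_cong_AE)
  have "AE x in lebesgue_on \<Omega>. transpose (A x) = A x"
    using matrix by (auto simp: coefficient_matrix_def)
  then show "AE x in lebesgue_on \<Omega>. (A x *v wgrad \<Omega> w x) \<bullet> wgrad \<Omega> v x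
      = (A x *v wgrad \<Omega> v x) \<bullet> wgrad \<Omega> w x"
  proof eventually_elim
    case (elim x)
    have "(A x *v wgrad \<Omega> w x) \<bullet> wgrad \<Omega> v x = (transpose (A x) *v wgrad \<Omega> v x) \<bullet> wgrad \<Omega> w x"
      by (simp only: inner_commute[of "A x *v wgrad \<Omega> w x"] dot_lmul_matrix[symmetric] transpose_matrix_vector)
    then show ?case by (simp only: elim)
  qed
qed (intro borel_measurable_integrable aform_integrable w v)+

sublocale P: semi_inner "H10 \<Omega>" "ip0 \<Omega>"
proof (rule L2.subspace)
  show "H10 \<Omega> \<subseteq> L2 \<Omega>" using H10_H1 H1_L2 by blast
  show "H10 \<Omega> \<noteq> {}" using zero_H10 by blast
qed (rule H10_comb)

sublocale a: semi_inner "H10 \<Omega>" "aform \<Omega> A"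
proof
  show "H10 \<Omega> \<noteq> {}" using zero_H10 by blast
  show "0 \<le> aform \<Omega> A w w" if "w \<in> H10 \<Omega>" for w
    by (rule order_trans[OF _ a_coercive[OF that]]) (use ca_pos in simp)
qed (intro H10_comb aform_lin aform_sym H10_H1; assumption)+

lemma a_nrm [simp]: "a.nrm = norm_a \<Omega> A"
  by (rule ext) (simp add: a.nrm_def norm_a_def)

lemma norm1_le_norm_a:
  assumes w: "w \<in> H10 \<Omega>"
  shows "norm1 \<Omega> w \<le> 1 / sqrt ca * norm_a \<Omega> A w"
proof -
  have "sqrt ca * norm1 \<Omega> w \<le> norm_a \<Omega> A w"
    using real_sqrt_le_mono[OF a_coercive[OF w]]
    by (simp add: norm_a_def real_sqrt_mult norm1_nonneg)
  then show ?thesis using ca_pos by (simp add: field_simps)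
qed

lemma norm_a_le_norm1:
  assumes w: "w \<in> H10 \<Omega>"
  shows "norm_a \<Omega> A w \<le> sqrt Ca * norm1 \<Omega> w"
proof -
  have "aform \<Omega> A w w \<le> Ca * (norm1 \<Omega> w)\<^sup>2"
    using a_bounded[OF w w] by (simp add: power2_eq_square mult.assoc)
  from real_sqrt_le_mono[OF this] show ?thesis
    by (simp add: norm_a_def real_sqrt_mult norm1_nonneg)
qed

text \<open>The energy norm is equivalent to \<open>norm1\<close>: coercivity carries the Cauchy
  property over to \<open>norm1\<close>, and boundedness carries the convergence back.\<close>

sublocale a: semi_hilbert "H10 \<Omega>" "aform \<Omega> A"
proof
  fix X :: "nat \<Rightarrow> 'd rfun"
  assume X: "\<And>n. X n \<in> H10 \<Omega>"
    and cauchy: "\<And>e. 0 < e \<Longrightarrow> \<exists>N. \<forall>i\<ge>N. \<forall>j\<ge>N. a.nrm (\<lambda>x. X i x - X j x) < e"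
  have cauchy1: "\<exists>N. \<forall>i\<ge>N. \<forall>j\<ge>N. norm1 \<Omega> (\<lambda>x. X i x - X j x) < e" if e: "0 < e" for e
  proof -
    have "0 < e * sqrt ca" using e ca_pos by simp
    then obtain N where N: "\<And>i j. i \<ge> N \<Longrightarrow> j \<ge> N \<Longrightarrow> a.nrm (\<lambda>x. X i x - X j x) < e * sqrt ca"
      using cauchy by blast
    have "norm1 \<Omega> (\<lambda>x. X i x - X j x) < e" if "i \<ge> N" "j \<ge> N" for i j
    proof -
      have "1 / sqrt ca * norm_a \<Omega> A (\<lambda>x. X i x - X j x) < e"
        using N[OF that] ca_pos by (simp add: field_simps)
      then show ?thesis using norm1_le_norm_a[OF a.diff_mem[OF X X]] by (rule order_le_less_trans[rotated])
    qed
    then show ?thesis by blast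
  qed
  obtain w where w: "w \<in> H10 \<Omega>" and lim: "(\<lambda>n. norm1 \<Omega> (\<lambda>x. X n x - w x)) \<longlonglongrightarrow> 0"
    using H10_complete[OF X cauchy1] by blast
  have "(\<lambda>n. norm_a \<Omega> A (\<lambda>x. X n x - w x)) \<longlonglongrightarrow> 0"
  proof (rule Lim_null_comparison)
    show "\<forall>\<^sub>F n in sequentially. norm (norm_a \<Omega> A (\<lambda>x. X n x - w x)) \<le> sqrt Ca * norm1 \<Omega> (\<lambda>x. X n x - w x)"
      using norm_a_le_norm1[OF a.diff_mem[OF X w]] a.nrm_nonneg[OF a.diff_mem[OF X w]] by simp
    show "(\<lambda>n. sqrt Ca * norm1 \<Omega> (\<lambda>x. X n x - w x)) \<longlonglongrightarrow> 0"
      using tendsto_mult_right_zero[OF lim] .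
  qed
  then show "\<exists>w\<in>H10 \<Omega>. (\<lambda>n. a.nrm (\<lambda>x. X n x - w x)) \<longlonglongrightarrow> 0" using w by auto
qed

section \<open>The solution operator and the approximation quantity \<open>eta_a\<close>\<close>

lemma norm0_le_norm_a: "w \<in> H10 \<Omega> \<Longrightarrow> norm0 \<Omega> w \<le> 1 / sqrt ca * norm_a \<Omega> A w"
  using norm0_le_norm1 norm1_le_norm_a by (rule order_trans)

lemma ip0_le_norm_a:
  assumes "\<psi> \<in> L2 \<Omega>" "v \<in> H10 \<Omega>"
  shows "\<bar>ip0 \<Omega> \<psi> v\<bar> \<le> norm0 \<Omega> \<psi> * (1 / sqrt ca * norm_a \<Omega> A v)"
proof -
  have "\<bar>ip0 \<Omega> \<psi> v\<bar> \<le> norm0 \<Omega> \<psi> * norm0 \<Omega> v"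
    using L2.Cauchy_Schwarz[OF assms(1) H1_L2[OF H10_H1[OF assms(2)]]] by simp
  also have "\<dots> \<le> norm0 \<Omega> \<psi> * (1 / sqrt ca * norm_a \<Omega> A v)"
    by (intro mult_left_mono norm0_le_norm_a assms norm0_nonneg)
  finally show ?thesis .
qed

text \<open>The form is symmetric, so Riesz representation in the energy product takes the place of
  Lax-Milgram and supplies the witness that the choice in \<open>Linv\<close> needs.\<close>

lemma Linv_solves:
  assumes \<psi>: "\<psi> \<in> L2 \<Omega>"
  shows "Linv \<Omega> A \<psi> \<in> H10 \<Omega>" "\<And>v. v \<in> H10 \<Omega> \<Longrightarrow> aform \<Omega> A (Linv \<Omega> A \<psi>) v = ip0 \<Omega> \<psi> v"
proof -
  have "\<exists>z\<in>H10 \<Omega>. \<forall>v\<in>H10 \<Omega>. aform \<Omega> A z v = ip0 \<Omega> \<psi> v"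
  proof (rule a.riesz_representation)
    show "ip0 \<Omega> \<psi> (\<lambda>x. b * w x + c * v x) = b * ip0 \<Omega> \<psi> w + c * ip0 \<Omega> \<psi> v"
      if "w \<in> H10 \<Omega>" "v \<in> H10 \<Omega>" for w v b c
      using that by (intro L2.lin2 \<psi> H1_L2 H10_H1)
    show "\<bar>ip0 \<Omega> \<psi> v\<bar> \<le> norm0 \<Omega> \<psi> * (1 / sqrt ca) * a.nrm v" if "v \<in> H10 \<Omega>" for v
      using ip0_le_norm_a[OF \<psi> that] by (simp add: mult.assoc)
  qed
  then have "\<exists>z. z \<in> H10 \<Omega> \<and> (\<forall>v\<in>H10 \<Omega>. Lop \<Omega> A z v = ip0 \<Omega> \<psi> v)" by (auto simp: Lop_def)
  from someI_ex[OF this]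
  show "Linv \<Omega> A \<psi> \<in> H10 \<Omega>" "\<And>v. v \<in> H10 \<Omega> \<Longrightarrow> aform \<Omega> A (Linv \<Omega> A \<psi>) v = ip0 \<Omega> \<psi> v"
    by (auto simp: Linv_def Lop_def)
qed

lemma norm_a_Linv_le:
  assumes \<psi>: "\<psi> \<in> L2 \<Omega>"
  shows "norm_a \<Omega> A (Linv \<Omega> A \<psi>) \<le> norm0 \<Omega> \<psi> * (1 / sqrt ca)"
proof (rule le_if_square_le)
  note z = Linv_solves[OF \<psi>]
  have "(norm_a \<Omega> A (Linv \<Omega> A \<psi>))\<^sup>2 = ip0 \<Omega> \<psi> (Linv \<Omega> A \<psi>)"
    using a.nrm_square[OF z(1)] z(2)[OF z(1)] by simp
  then show "(norm_a \<Omega> A (Linv \<Omega> A \<psi>))\<^sup>2 \<le> norm0 \<Omega> \<psi> * (1 / sqrt ca) * norm_a \<Omega> A (Linv \<Omega> A \<psi>)"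
    using ip0_le_norm_a[OF \<psi> z(1)] by (simp add: mult.assoc)
  show "0 \<le> norm_a \<Omega> A (Linv \<Omega> A \<psi>)" using a.nrm_nonneg[OF z(1)] by simp
  show "0 \<le> norm0 \<Omega> \<psi> * (1 / sqrt ca)" by (intro mult_nonneg_nonneg norm0_nonneg) (use ca_pos in simp)
qed

lemma best_error_nonneg:
  assumes "W \<subseteq> H10 \<Omega>" "W \<noteq> {}" "w \<in> H10 \<Omega>"
  shows "0 \<le> best_error_a \<Omega> A W w"
  unfolding best_error_a_def using assms a.nrm_nonneg[OF a.diff_mem]
  by (intro cINF_greatest) auto

lemma best_error_le:
  assumes W: "W \<subseteq> H10 \<Omega>" and w: "w \<in> H10 \<Omega>" and v: "v \<in> W"
  shows "best_error_a \<Omega> A W w \<le> norm_a \<Omega> A (\<lambda>x. w x - v x)"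
  unfolding best_error_a_def
proof (rule cINF_lower)
  show "bdd_below ((\<lambda>v. norm_a \<Omega> A (\<lambda>x. w x - v x)) ` W)"
    using W a.nrm_nonneg[OF a.diff_mem[OF w]] by (auto intro!: bdd_belowI[of _ 0])
qed (rule v)

text \<open>Zero is the competitor. The resulting bound, uniform in \<psi> and \<open>W\<close>,
  makes the supremum in \<open>eta_a\<close> bounded and later lets the square of \<eta> be absorbed
  into a multiple of \<eta>.\<close>

lemma best_error_Linv_le:
  assumes W: "W \<subseteq> H10 \<Omega>" "(\<lambda>x. 0) \<in> W" and \<psi>: "\<psi> \<in> L2 \<Omega>" "norm0 \<Omega> \<psi> = 1"
  shows "best_error_a \<Omega> A W (Linv \<Omega> A \<psi>) \<le> 1 / sqrt ca"
  using best_error_le[OF W(1) Linv_solves(1)[OF \<psi>(1)] W(2)] norm_a_Linv_le[OF \<psi>(1)] \<psi>(2) by simp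

lemma best_error_Linv_le_eta:
  assumes W: "W \<subseteq> H10 \<Omega>" "(\<lambda>x. 0) \<in> W" and \<psi>: "\<psi> \<in> L2 \<Omega>" "norm0 \<Omega> \<psi> = 1"
  shows "best_error_a \<Omega> A W (Linv \<Omega> A \<psi>) \<le> eta_a \<Omega> A W"
  unfolding eta_a_def
proof (rule cSUP_upper)
  show "bdd_above ((\<lambda>\<psi>. best_error_a \<Omega> A W (Linv \<Omega> A \<psi>)) ` {\<psi> \<in> L2 \<Omega>. norm0 \<Omega> \<psi> = 1})"
    using best_error_Linv_le[OF W] by (auto intro!: bdd_aboveI[of _ "1 / sqrt ca"])
qed (use \<psi> in simp)

text \<open>Ensures that the supremum in \<open>eta_a\<close> ranges over a nonempty set; otherwise
  its value would carry no information. A normalized constant works because a nonempty open set is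
  not negligible.\<close>

lemma unit_L2:
  assumes "\<Omega> \<noteq> {}"
  shows "\<exists>\<psi>\<in>L2 \<Omega>. norm0 \<Omega> \<psi> = 1"
proof -
  define m where "m = norm0 \<Omega> (\<lambda>x. 1)"
  have one: "(\<lambda>x. 1) \<in> L2 \<Omega>" by (rule L2_const[OF op bdd])
  have "m\<^sup>2 = measure lebesgue \<Omega>"
  proof -
    have "m\<^sup>2 = (LINT x|lebesgue_on \<Omega>. 1)"
      by (simp add: m_def norm0_def ip0_def)
    also have "\<dots> = measure (lebesgue_on \<Omega>) \<Omega>"
      using op by simp
    also have "\<dots> = measure lebesgue \<Omega>" using op by (subst measure_restrict_space) auto
    finally show ?thesis .
  qed
  moreover have "measure lebesgue \<Omega> \<noteq> 0"
    using open_not_negligible[OF op assms] bounded_set_imp_lmeasurable[OF bdd] op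
    by (simp add: negligible_iff_measure0)
  ultimately have "m \<noteq> 0" by auto
  then have m: "0 < m" using norm0_nonneg[of \<Omega> "\<lambda>x. 1"] by (simp add: m_def)
  have "norm0 \<Omega> (\<lambda>x. 1 / m * 1) = \<bar>1 / m\<bar> * norm0 \<Omega> (\<lambda>x. 1)"
    using L2.nrm_scale[OF one, of "1 / m"] unfolding L2_nrm .
  also have "\<dots> = 1" using m by (simp add: m_def)
  finally show ?thesis using L2.scale_mem[OF one, of "1 / m"] by blast
qed

lemma eta_bounds:
  assumes W: "W \<subseteq> H10 \<Omega>" "(\<lambda>x. 0) \<in> W" and ne: "\<Omega> \<noteq> {}"
  shows "0 \<le> eta_a \<Omega> A W" "eta_a \<Omega> A W \<le> 1 / sqrt ca"
proof -
  obtain \<psi> where \<psi>: "\<psi> \<in> L2 \<Omega>" "norm0 \<Omega> \<psi> = 1" using unit_L2[OF ne] by blast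
  have "0 \<le> best_error_a \<Omega> A W (Linv \<Omega> A \<psi>)"
    using W by (intro best_error_nonneg Linv_solves(1)[OF \<psi>(1)]) auto
  then show "0 \<le> eta_a \<Omega> A W" using best_error_Linv_le_eta[OF W \<psi>] by (rule order_trans)
  show "eta_a \<Omega> A W \<le> 1 / sqrt ca"
    unfolding eta_a_def using \<psi> by (intro cSUP_least) (auto intro: best_error_Linv_le[OF W])
qed

text \<open>Passes by homogeneity from the normalized data in \<open>eta_a\<close> to arbitrary
  ones, as \<open>dual_rate\<close> requires. Data of norm zero cannot be normalized; for them zero
  solves the dual problem and approximates itself.\<close>

lemma dual_approximation:
  assumes W: "W \<subseteq> H10 \<Omega>" "linear_set W" and \<psi>: "\<psi> \<in> H10 \<Omega>"
  shows "\<exists>z\<in>H10 \<Omega>. (\<forall>v\<in>H10 \<Omega>. aform \<Omega> A z v = ip0 \<Omega> \<psi> v) \<and>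
     (\<forall>e>0. \<exists>v\<in>W. norm_a \<Omega> A (\<lambda>x. z x - v x) \<le> eta_a \<Omega> A W * norm0 \<Omega> \<psi> + e)"
proof (cases "norm0 \<Omega> \<psi> = 0")
  case True
  have z: "(\<lambda>x. 0) \<in> H10 \<Omega>" by (rule zero_H10)
  have "aform \<Omega> A (\<lambda>x. 0) v = ip0 \<Omega> \<psi> v" if v: "v \<in> H10 \<Omega>" for v
    using P.Cauchy_Schwarz[OF \<psi> v] True a.scale_left[OF z v, of 0] by (simp add: P.nrm_def norm0_def)
  moreover have "norm_a \<Omega> A (\<lambda>x. 0 - 0) = 0" using a.nrm_scale[OF z, of 0] by simp
  ultimately show ?thesis
    using z linear_set_zero[OF W(2)] True by (intro bexI[OF _ z]) (auto intro!: bexI[of _ "\<lambda>x. 0"])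
next
  case False
  define m where "m = norm0 \<Omega> \<psi>"
  have m: "0 < m" using False norm0_nonneg[of \<Omega> \<psi>] by (simp add: m_def)
  have \<psi>L2: "\<psi> \<in> L2 \<Omega>" by (rule H1_L2[OF H10_H1[OF \<psi>]])
  define \<psi>' where "\<psi>' = (\<lambda>x. 1 / m * \<psi> x)"
  have \<psi>': "\<psi>' \<in> L2 \<Omega>" "norm0 \<Omega> \<psi>' = 1"
    using L2.scale_mem[OF \<psi>L2, of "1 / m"] L2.nrm_scale[OF \<psi>L2, of "1 / m"] m
    by (auto simp: \<psi>'_def m_def)
  define z where "z = Linv \<Omega> A \<psi>'"
  have z: "z \<in> H10 \<Omega>" and z_eq: "\<And>v. v \<in> H10 \<Omega> \<Longrightarrow> aform \<Omega> A z v = ip0 \<Omega> \<psi>' v"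
    using Linv_solves[OF \<psi>'(1)] by (auto simp: z_def)
  have mz: "(\<lambda>x. m * z x) \<in> H10 \<Omega>" by (rule a.scale_mem[OF z])
  show ?thesis
  proof (rule bexI[OF _ mz], intro conjI ballI allI impI)
    show "aform \<Omega> A (\<lambda>x. m * z x) v = ip0 \<Omega> \<psi> v" if v: "v \<in> H10 \<Omega>" for v
      using a.scale_left[OF z v, of m] z_eq[OF v] P.scale_left[OF \<psi> v, of "1 / m"] m by (simp add: \<psi>'_def)
    fix e :: real assume e: "0 < e"
    have "best_error_a \<Omega> A W z < eta_a \<Omega> A W + e / m"
      using best_error_Linv_le_eta[OF W(1) linear_set_zero[OF W(2)] \<psi>'] divide_pos_pos[OF e m] by (simp add: z_def)
    then obtain v where v: "v \<in> W" and lt: "norm_a \<Omega> A (\<lambda>x. z x - v x) < eta_a \<Omega> A W + e / m"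
      unfolding best_error_a_def using W
      by (subst (asm) cINF_less_iff) (auto simp: linear_set_def intro!: bdd_belowI[of _ 0] a.nrm_nonneg[OF a.diff_mem[OF z], unfolded a_nrm])
    have vH: "v \<in> H10 \<Omega>" using v W by blast
    have "norm_a \<Omega> A (\<lambda>x. m * z x - m * v x) = m * norm_a \<Omega> A (\<lambda>x. z x - v x)"
      using a.nrm_scale[OF a.diff_mem[OF z vH], of m] m by (simp add: right_diff_distrib)
    also have "\<dots> \<le> m * (eta_a \<Omega> A W + e / m)" using lt m by simp
    also have "\<dots> = eta_a \<Omega> A W * norm0 \<Omega> \<psi> + e" using m by (simp add: m_def field_simps)
    finally show "\<exists>v\<in>W. norm_a \<Omega> A (\<lambda>x. m * z x - v x) \<le> eta_a \<Omega> A W * norm0 \<Omega> \<psi> + e"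
      using linear_set_comb[OF W(2) v v, of m 0] by (intro bexI[of _ "\<lambda>x. m * v x"]) auto
  qed
qed

end

section \<open>Finite element spaces\<close>

lemma fe_space_mono:
  assumes "\<forall>K'\<in>\<T>'. \<exists>K\<in>\<T>. K' \<subseteq> K"
  shows "fe_space \<Omega> \<T> \<subseteq> fe_space \<Omega> \<T>'"
proof
  fix v assume v: "v \<in> fe_space \<Omega> \<T>"
  have "\<exists>a b. \<forall>x\<in>K' \<inter> \<Omega>. v x = a \<bullet> x + b" if K': "K' \<in> \<T>'" for K'
  proof -
    obtain K where "K \<in> \<T>" "K' \<subseteq> K" using assms K' by blast
    moreover from this v obtain a b where "\<forall>x\<in>K \<inter> \<Omega>. v x = a \<bullet> x + b"
      unfolding fe_space_def by blast
    ultimately have "\<forall>x\<in>K' \<inter> \<Omega>. v x = a \<bullet> x + b" by blast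
    then show ?thesis by blast
  qed
  then show "v \<in> fe_space \<Omega> \<T>'" using v by (auto simp: fe_space_def)
qed

lemma mesh_hierarchy_nested:
  assumes "mesh_hierarchy \<Omega> \<sigma> \<beta> n \<T>H \<T>"
  shows "fe_space \<Omega> \<T>H \<subseteq> fe_space \<Omega> (\<T> 1)"
    and "\<And>k. k \<in> {2..n} \<Longrightarrow> fe_space \<Omega> (\<T> (k - 1)) \<subseteq> fe_space \<Omega> (\<T> k)"
proof -
  have mono: "fe_space \<Omega> \<S> \<subseteq> fe_space \<Omega> \<S>'" if "regular_refinement \<Omega> b \<S> \<S>'" for b \<S> \<S>'
    using that by (intro fe_space_mono) (simp add: regular_refinement_def)
  have "(\<lambda>\<S> \<S>'. \<exists>b>1. regular_refinement \<Omega> b \<S> \<S>')\<^sup>*\<^sup>* \<T>H (\<T> 1)"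
    using assms by (simp add: mesh_hierarchy_def)
  then show "fe_space \<Omega> \<T>H \<subseteq> fe_space \<Omega> (\<T> 1)"
    by (induction rule: rtranclp_induct) (use mono in blast)+
  show "fe_space \<Omega> (\<T> (k - 1)) \<subseteq> fe_space \<Omega> (\<T> k)" if "k \<in> {2..n}" for k
    by (rule mono[of \<beta>]) (use assms that in \<open>simp add: mesh_hierarchy_def\<close>)
qed

lemma (in bounded_open) linear_set_fe_space: "linear_set (fe_space \<Omega> \<T>)"
  unfolding linear_set_def
proof (intro conjI ballI allI)
  have "(\<lambda>x. 0) \<in> fe_space \<Omega> \<T>"
    unfolding fe_space_def using zero_H10 by (auto intro!: exI[of _ 0])
  then show "fe_space \<Omega> \<T> \<noteq> {}" by blast
  fix w v b c assume w: "w \<in> fe_space \<Omega> \<T>" and v: "v \<in> fe_space \<Omega> \<T>"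
  have "\<exists>p q. \<forall>x\<in>K \<inter> \<Omega>. b * w x + c * v x = p \<bullet> x + q" if K: "K \<in> \<T>" for K
  proof -
    obtain p q where 1: "\<forall>x\<in>K \<inter> \<Omega>. w x = p \<bullet> x + q" using w K unfolding fe_space_def by blast
    obtain r s where 2: "\<forall>x\<in>K \<inter> \<Omega>. v x = r \<bullet> x + s" using v K unfolding fe_space_def by blast
    have "b * w x + c * v x = (b *\<^sub>R p + c *\<^sub>R r) \<bullet> x + (b * q + c * s)" if "x \<in> K \<inter> \<Omega>" for x
      using 1 2 that by (simp add: inner_add_left algebra_simps)
    then show ?thesis by blast
  qed
  moreover have "(\<lambda>x. b * w x + c * v x) \<in> H10 \<Omega>" using w v by (intro H10_comb) (auto simp: fe_space_def)
  moreover have "continuous_on \<Omega> (\<lambda>x. b * w x + c * v x)"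
    using w v by (intro continuous_intros) (auto simp: fe_space_def)
  ultimately show "(\<lambda>x. b * w x + c * v x) \<in> fe_space \<Omega> \<T>" by (auto simp: fe_space_def)
qed

section \<open>Application to the semilinear problem\<close>

context elliptic begin

text \<open>Both constants carry \<open>1 / sqrt ca\<close>, the price of replacing the norm of
  \<open>H1\<close> by the energy norm. Integrability of the pairings is what permits splitting the
  paired difference in \<open>assumption_A\<close>.\<close>

lemma semilinear_nemytskii:
  assumes adm: "admissible_nonlinearity \<Omega> f" and Cf: "0 < Cf" and A: "assumption_A \<Omega> f Cf"
  shows "semilinear (H10 \<Omega>) (aform \<Omega> A) (ip0 \<Omega>) (\<lambda>w. ip0 \<Omega> (nemytskii f w)) (Cf / sqrt ca) (1 / sqrt ca)"
proof
  have int: "integrable (lebesgue_on \<Omega>) (\<lambda>x. nemytskii f w x * \<phi> x)" if "w \<in> H10 \<Omega>" "\<phi> \<in> H10 \<Omega>" for w \<phi>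
    using adm that by (auto simp: admissible_nonlinearity_def)
  have diff: "ip0 \<Omega> (\<lambda>x. nemytskii f w x - nemytskii f v x) \<phi> = ip0 \<Omega> (nemytskii f w) \<phi> - ip0 \<Omega> (nemytskii f v) \<phi>"
    if "w \<in> H10 \<Omega>" "v \<in> H10 \<Omega>" "\<phi> \<in> H10 \<Omega>" for w v \<phi>
    using int[OF that(1,3)] int[OF that(2,3)] by (simp add: ip0_def left_diff_distrib)
  fix w v assume w: "w \<in> H10 \<Omega>" and v: "v \<in> H10 \<Omega>"
  show "ip0 \<Omega> (nemytskii f u) (\<lambda>x. b * w x + c * v x)
      = b * ip0 \<Omega> (nemytskii f u) w + c * ip0 \<Omega> (nemytskii f u) v" if u: "u \<in> H10 \<Omega>" for u b c
  proof -
    have "ip0 \<Omega> (nemytskii f u) (\<lambda>x. b * w x + c * v x)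
        = (LINT x|lebesgue_on \<Omega>. b * (nemytskii f u x * w x) + c * (nemytskii f u x * v x))"
      by (simp add: ip0_def algebra_simps)
    then show ?thesis using int[OF u w] int[OF u v] by (simp add: ip0_def)
  qed
  show "ip0 \<Omega> (nemytskii f v) (\<lambda>x. w x - v x) \<le> ip0 \<Omega> (nemytskii f w) (\<lambda>x. w x - v x)"
    using A w v diff[OF w v a.diff_mem[OF w v]] by (force simp: assumption_A_def)
  fix \<phi> assume \<phi>: "\<phi> \<in> H10 \<Omega>"
  have "ip0 \<Omega> (nemytskii f w) \<phi> - ip0 \<Omega> (nemytskii f v) \<phi> \<le> Cf * norm0 \<Omega> (\<lambda>x. w x - v x) * norm1 \<Omega> \<phi>"
    using A w v \<phi> by (simp add: assumption_A_def diff)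
  also have "\<dots> \<le> Cf * norm0 \<Omega> (\<lambda>x. w x - v x) * (1 / sqrt ca * norm_a \<Omega> A \<phi>)"
    using Cf by (intro mult_left_mono norm1_le_norm_a \<phi> mult_nonneg_nonneg norm0_nonneg) simp
  finally show "ip0 \<Omega> (nemytskii f w) \<phi> - ip0 \<Omega> (nemytskii f v) \<phi>
      \<le> Cf / sqrt ca * P.nrm (\<lambda>x. w x - v x) * a.nrm \<phi>"
    by (simp add: mult_ac)
next
  show "0 \<le> Cf / sqrt ca" "0 \<le> 1 / sqrt ca" using Cf ca_pos by simp_all
  show "P.nrm w \<le> 1 / sqrt ca * a.nrm w" if "w \<in> H10 \<Omega>" for w
    using norm0_le_norm_a[OF that] by simp
qed

end

text \<open>The relation between consecutive best errors yields
  \<open>\<delta> (k - 1) \<le> C\<delta> * \<beta> * \<delta> k\<close>, so the energy estimate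
  carries \<open>max 1 C\<delta> * \<beta>\<close> in the place of \<beta>; for
  \<open>C\<delta> \<le> 1\<close> the two agree. The weak-norm estimate is free of this
  factor.\<close>

theorem theorem3p2:
  fixes \<Omega> :: "(real ^ 'd) set"
    and A :: "real ^ 'd \<Rightarrow> real ^ 'd ^ 'd"
    and f :: "real ^ 'd \<Rightarrow> real \<Rightarrow> real"
    and g :: "(real ^ 'd \<Rightarrow> real) \<Rightarrow> real"
    and u :: "real ^ 'd \<Rightarrow> real"
    and Ca ca Cf \<sigma> :: real
  assumes dim: "CARD('d) = 2 \<or> CARD('d) = 3"
    and domain: "open \<Omega>" "\<Omega> \<noteq> {}" "bounded \<Omega>" "convex \<Omega>" "lipschitz_boundary \<Omega>"
    and matrix: "coefficient_matrix \<Omega> A"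
    and a_bounded: "Ca > 0"
      "\<And>w v. w \<in> H10 \<Omega> \<Longrightarrow> v \<in> H10 \<Omega> \<Longrightarrow> aform \<Omega> A w v \<le> Ca * norm1 \<Omega> w * norm1 \<Omega> v"
    and a_coercive: "ca > 0"
      "\<And>w. w \<in> H10 \<Omega> \<Longrightarrow> ca * (norm1 \<Omega> w)\<^sup>2 \<le> aform \<Omega> A w w"
    and nonlinearity: "admissible_nonlinearity \<Omega> f"
    and assmA: "Cf > 0" "assumption_A \<Omega> f Cf"
    and rhs: "g \<in> Hminus1 \<Omega>"
    and exact: "solves_on \<Omega> A f g (H10 \<Omega>) u"
  shows "\<exists>C>0. \<forall>\<theta> \<beta> :: real. \<forall>p n :: nat. \<forall>\<T>H \<T>. \<forall>c\<eta> C\<eta> c\<delta> C\<delta> :: real. \<forall>ubar uh.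
    0 \<le> \<theta> \<and> \<theta> < 1 \<and> \<beta> > 1 \<and> n \<ge> 1 \<and>
    mesh_hierarchy \<Omega> \<sigma> \<beta> n \<T>H \<T> \<and>
    c\<eta> > 0 \<and> C\<eta> > 0 \<and> c\<delta> > 0 \<and> C\<delta> > 0 \<and>
    (\<forall>k\<in>{2..n}.
       approx_rel c\<eta> C\<eta> (eta_a \<Omega> A (fe_space \<Omega> (\<T> k)))
                        (1 / \<beta> * eta_a \<Omega> A (fe_space \<Omega> (\<T> (k - 1)))) \<and>
       approx_rel c\<delta> C\<delta> (best_error_a \<Omega> A (fe_space \<Omega> (\<T> k)) u)
                        (1 / \<beta> * best_error_a \<Omega> A (fe_space \<Omega> (\<T> (k - 1))) u)) \<and>
    (\<forall>k\<in>{1..n}. solves_on \<Omega> A f g (fe_space \<Omega> (\<T> k)) (ubar k)) \<and>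
    full_multigrid \<Omega> A f g \<theta> (fe_space \<Omega> \<T>H) (\<lambda>k. fe_space \<Omega> (\<T> k)) p n uh
    \<longrightarrow>
    (let \<eta>H = eta_a \<Omega> A (fe_space \<Omega> \<T>H);
         \<gamma> = (\<theta> + (1 + \<theta>) * C * \<eta>H) * (1 + C * \<eta>H);
         \<kappa> = max 1 C\<delta>;
         err = (\<lambda>x. ubar n x - uh n x)
     in \<gamma> ^ p * \<beta> < 1 \<longrightarrow>
        (\<gamma> ^ p * (\<kappa> * \<beta>) < 1 \<longrightarrow>
           norm_a \<Omega> A err \<le> 2 * \<gamma> ^ p * (\<kappa> * \<beta>) / (1 - \<gamma> ^ p * (\<kappa> * \<beta>))
                               * best_error_a \<Omega> A (fe_space \<Omega> (\<T> n)) u) \<and>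
        norm0 \<Omega> err \<le> C * \<eta>H * norm_a \<Omega> A err)"
proof -
  interpret elliptic \<Omega> A Ca ca
    by unfold_locales (use domain matrix a_bounded a_coercive in auto)
  interpret S: semilinear "H10 \<Omega>" "aform \<Omega> A" "ip0 \<Omega>" "\<lambda>w. ip0 \<Omega> (nemytskii f w)" "Cf / sqrt ca" "1 / sqrt ca"
    by (rule semilinear_nemytskii[OF nonlinearity assmA])
  have galerkin: "S.galerkin = solves_on \<Omega> A f"
    by (intro ext) (simp add: S.galerkin_def solves_on_def)
  have mg_step: "S.mg_step = semilinear_mg \<Omega> A f"
    by (intro ext) (simp add: S.mg_step_def semilinear_mg_def galerkin)
  \<comment> \<open>Chosen so that
    \<open>(1 + S.stab * \<eta>)\<^sup>2 \<le> 1 + C * \<eta>\<close>: the linear term gives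
    \<open>2 * S.stab\<close>, and since \<eta> is at most \<open>1 / sqrt ca\<close>, the quadratic
    one gives the second summand. The 1 makes \<open>C\<close> positive.\<close>
  define C where "C = 2 * S.stab + S.stab\<^sup>2 * (1 / sqrt ca) + 1"
  have stab: "0 \<le> S.stab" by (rule S.stab_nonneg)
  have C_pos: "0 < C" and C_ge: "S.stab \<le> C"
    using stab ca_pos by (auto simp: C_def intro!: add_nonneg_pos add_nonneg_nonneg)
  show ?thesis
  proof (intro exI[of _ C] conjI C_pos allI impI, elim conjE)
    fix \<theta> \<beta> :: real and p n :: nat and \<T>H \<T> and c\<eta> C\<eta> c\<delta> C\<delta> :: real and ubar uh
    assume \<theta>: "0 \<le> \<theta>" "\<theta> < 1" and \<beta>: "1 < \<beta>" and n: "1 \<le> n"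
      and mesh: "mesh_hierarchy \<Omega> \<sigma> \<beta> n \<T>H \<T>" and C\<delta>: "0 < C\<delta>"
      and approx: "\<forall>k\<in>{2..n}.
         approx_rel c\<eta> C\<eta> (eta_a \<Omega> A (fe_space \<Omega> (\<T> k)))
                          (1 / \<beta> * eta_a \<Omega> A (fe_space \<Omega> (\<T> (k - 1)))) \<and>
         approx_rel c\<delta> C\<delta> (best_error_a \<Omega> A (fe_space \<Omega> (\<T> k)) u)
                          (1 / \<beta> * best_error_a \<Omega> A (fe_space \<Omega> (\<T> (k - 1))) u)"
      and ubar: "\<forall>k\<in>{1..n}. solves_on \<Omega> A f g (fe_space \<Omega> (\<T> k)) (ubar k)"
      and fmg: "full_multigrid \<Omega> A f g \<theta> (fe_space \<Omega> \<T>H) (\<lambda>k. fe_space \<Omega> (\<T> k)) p n uh"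
    define W where "W = fe_space \<Omega> \<T>H"
    define Y where "Y k = fe_space \<Omega> (\<T> k)" for k
    define \<eta> where "\<eta> = eta_a \<Omega> A W"
    define \<gamma> where "\<gamma> = (\<theta> + (1 + \<theta>) * C * \<eta>) * (1 + C * \<eta>)"
    define b where "b = max 1 C\<delta> * \<beta>"
    define \<delta> where "\<delta> k = best_error_a \<Omega> A (Y k) u" for k
    have sub: "fe_space \<Omega> \<S> \<subseteq> H10 \<Omega>" for \<S> by (auto simp: fe_space_def)
    have W: "W \<subseteq> H10 \<Omega>" "linear_set W" unfolding W_def by (rule sub linear_set_fe_space)+
    have Y: "Y k \<subseteq> H10 \<Omega>" "linear_set (Y k)" for k unfolding Y_def by (rule sub linear_set_fe_space)+
    have \<eta>: "0 \<le> \<eta>" "\<eta> \<le> 1 / sqrt ca"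
      unfolding \<eta>_def using eta_bounds[OF W(1) linear_set_zero[OF W(2)]] domain(2) by auto
    have rate: "S.dual_rate W \<eta>"
      using dual_approximation[OF W] \<eta> by (simp add: S.dual_rate_def \<eta>_def)
    have C_square: "(1 + S.stab * \<eta>)\<^sup>2 \<le> 1 + C * \<eta>"
    proof -
      have "S.stab\<^sup>2 * \<eta> * \<eta> \<le> S.stab\<^sup>2 * \<eta> * (1 / sqrt ca)"
        using \<eta> by (intro mult_left_mono) auto
      then show ?thesis using \<eta> by (simp add: C_def power2_eq_square algebra_simps)
    qed
    have u: "u \<in> H10 \<Omega>" using exact by (simp add: solves_on_def)
    have \<delta>_INF: "\<delta> k = (INF v\<in>Y k. a.nrm (\<lambda>x. u x - v x))" for k
      by (simp add: \<delta>_def best_error_a_def)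
    have decay: "\<delta> (k - 1) \<le> b * \<delta> k" if "k \<in> {2..n}" for k
    proof -
      have "0 \<le> \<delta> k" unfolding \<delta>_def using Y u by (intro best_error_nonneg) (auto simp: linear_set_def)
      have "1 / \<beta> * \<delta> (k - 1) \<le> C\<delta> * \<delta> k"
        using approx that by (auto simp: approx_rel_def \<delta>_def Y_def)
      also have "\<dots> \<le> max 1 C\<delta> * \<delta> k" using \<open>0 \<le> \<delta> k\<close> by (intro mult_right_mono) auto
      finally have "\<beta> * (1 / \<beta> * \<delta> (k - 1)) \<le> \<beta> * (max 1 C\<delta> * \<delta> k)"
        using \<beta> by (intro mult_left_mono) auto
      then show ?thesis using \<beta> by (simp add: b_def mult_ac)
    qed
    have uh1: "S.galerkin g (Y 1) (uh 1)"
      and level: "\<And>k. k \<in> {2..n} \<Longrightarrow> \<exists>it. it 0 = uh (k - 1) \<and>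
        (\<forall>l<p. S.mg_step g \<theta> W (Y k) (it l) (it (Suc l))) \<and> uh k = it p"
      using fmg by (auto simp: full_multigrid_def galerkin mg_step Y_def W_def)
    have WY: "W \<subseteq> Y 1" and nested: "\<And>k. k \<in> {2..n} \<Longrightarrow> Y (k - 1) \<subseteq> Y k"
      using mesh_hierarchy_nested[OF mesh] by (simp_all add: W_def Y_def)
    have Y': "\<And>k. k \<in> {1..n} \<Longrightarrow> Y k \<subseteq> H10 \<Omega> \<and> linear_set (Y k)" using Y by blast
    have gu: "S.galerkin g (H10 \<Omega>) u" using exact by (simp add: galerkin)
    have gub: "\<And>k. k \<in> {1..n} \<Longrightarrow> S.galerkin g (Y k) (ubar k)"
      using ubar by (simp add: galerkin Y_def)
    have b: "0 \<le> b" using \<beta> by (simp add: b_def)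
    have main: "norm_a \<Omega> A (\<lambda>x. ubar n x - uh n x) \<le> 2 * \<gamma> ^ p * b / (1 - \<gamma> ^ p * b) * \<delta> n"
      if "1 \<le> p" "\<gamma> ^ p * b < 1"
      unfolding a_nrm[symmetric] \<gamma>_def
      by (rule S.full_multigrid_error(2)[OF rate W(2) WY Y' nested gu gub uh1 level that(1) n \<theta>(1) b
            \<delta>_INF decay C_ge C_square that(2)[unfolded \<gamma>_def]])
    have main0: "norm0 \<Omega> (\<lambda>x. ubar n x - uh n x) \<le> C * \<eta> * norm_a \<Omega> A (\<lambda>x. ubar n x - uh n x)"
      if "1 \<le> p"
      unfolding a_nrm[symmetric] L2_nrm[symmetric]
      by (rule S.full_multigrid_error(1)[OF rate W(2) WY Y' nested gu gub uh1 level that n \<theta>(1) b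
            \<delta>_INF decay C_ge C_square])
    \<comment> \<open>For \<open>p = 0\<close> the smallness condition would read
      \<open>\<beta> < 1\<close>.\<close>
    have p: "1 \<le> p" if "\<gamma> ^ p * \<beta> < 1" using that \<beta> by (cases p) auto
    show "let \<eta>H = eta_a \<Omega> A (fe_space \<Omega> \<T>H);
         \<gamma> = (\<theta> + (1 + \<theta>) * C * \<eta>H) * (1 + C * \<eta>H);
         \<kappa> = max 1 C\<delta>;
         err = (\<lambda>x. ubar n x - uh n x)
     in \<gamma> ^ p * \<beta> < 1 \<longrightarrow>
        (\<gamma> ^ p * (\<kappa> * \<beta>) < 1 \<longrightarrow>
           norm_a \<Omega> A err \<le> 2 * \<gamma> ^ p * (\<kappa> * \<beta>) / (1 - \<gamma> ^ p * (\<kappa> * \<beta>))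
                               * best_error_a \<Omega> A (fe_space \<Omega> (\<T> n)) u) \<and>
        norm0 \<Omega> err \<le> C * \<eta>H * norm_a \<Omega> A err"
      unfolding Let_def W_def[symmetric] \<eta>_def[symmetric] \<gamma>_def[symmetric] b_def[symmetric]
        Y_def[symmetric] \<delta>_def[symmetric]
      using main main0 p by blast
  qed
qed

end
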